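(* Let $c\le0$. Suppose the coefficients $a^{ij},b^i,c$ are continuous in $x$, Borel measurable in $t$, and bounded on $D_k\times[0,T]$ for every $k$, and that $A=(a^{ij})$ is symmetric with $(A(x,t)y,y)\ge0$ for all $(x,t)\in D\times[0,T]$, $y\in\mathbb{R}^d$ (degeneracy allowed). Then for every Borel probability measure $\nu$ on $D$ the class $\mathcal{M}_\nu$ is nonempty.
   Context: $T>0$; $D\subset\mathbb{R}^d$ is an arbitrary open set, and $(D_k)_{k\ge1}$ is a fixed increasing sequence of bounded open sets with $\overline{D_k}\subset D_{k+1}$ and $\bigcup_k D_k=D$. Summation over repeated indices. $L\varphi=a^{ij}\partial_{x_i}\partial_{x_j}\varphi+b^i\partial_{x_i}\varphi+c\varphi$. A locally finite Borel measure $\mu$ on $D\times(0,T)$ is given by a flow $(\mu_t)_{t\in(0,T)}$ of Borel measures on $D$ if $t\mapsto\mu_t(B)$ is measurable for every Borel $B\subset D$ and $\int u\,d\mu=\int_0^T\int_D u\,d\mu_t\,dt$ for all $u\in C_0^\infty(D\times(0,T))$. Such $\mu$ solves the Cauchy problem $\partial_t\mu=\partial_{x_i}\partial_{x_j}(a^{ij}\mu)-\partial_{x_i}(b^i\mu)+c\mu$, $\mu|_{t=0}=\nu$, if $a^{ij},b^i,c\in L^1(\overline{D_k}\times J,|\mu|)$ for all $k$ and compact intervals $J\subset(0,T)$, and for every $\varphi\in C_0^\infty(D)$ and a.e. $t$: $\int_D\varphi\,d\mu_t-\int_D\varphi\,d\nu=\lim_{\varepsilon\to0+}\int_\varepsilon^t\int_DL\varphi\,d\mu_s\,ds$.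 $\mathcal{M}_\nu$ is the class of such solutions given by flows of nonnegative measures with $|c|\in L^1(D\times(0,T),\mu)$ and, for a.e. $t$, $\mu_t(D)\le\nu(D)+\int_0^t\int_Dc\,d\mu_s\,ds$. *)

theory Defs
  imports "HOL-Probability.Probability"
begin

text \<open>Directional derivative of a real function along the vector v
  (defined via deriv; its existence is asserted separately where needed).\<close>
definition dirderiv :: "'a::real_normed_vector \<Rightarrow> ('a \<Rightarrow> real) \<Rightarrow> 'a \<Rightarrow> real" where
  "dirderiv v f x = deriv (\<lambda>h::real. f (x + h *\<^sub>R v)) 0"

fun iter_deriv :: "'a::real_normed_vector list \<Rightarrow> ('a \<Rightarrow> real) \<Rightarrow> 'a \<Rightarrow> real" where
  "iter_deriv [] f = f"
| "iter_deriv (v # vs) f = dirderiv v (iter_deriv vs f)"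

definition smooth_fun :: "('a::euclidean_space \<Rightarrow> real) \<Rightarrow> bool" where
  "smooth_fun f \<longleftrightarrow>
     (\<forall>vs. set vs \<subseteq> Basis \<longrightarrow>
        continuous_on UNIV (iter_deriv vs f) \<and>
        (\<forall>v\<in>Basis. \<forall>x. (\<lambda>h::real. iter_deriv vs f (x + h *\<^sub>R v)) differentiable (at 0)))"

text \<open>C_0^infinity(U): smooth functions whose support is compact and contained in U
  (functions on U are identified with their extension by zero).\<close>
definition test_fun :: "'a::euclidean_space set \<Rightarrow> ('a \<Rightarrow> real) \<Rightarrow> bool" where
  "test_fun U f \<longleftrightarrow> smooth_fun f \<and> compact (closure {x. f x \<noteq> 0}) \<and> closure {x. f x \<noteq> 0} \<subseteq> U"

definition pd :: "'n::finite \<Rightarrow> (real^'n \<Rightarrow> real) \<Rightarrow> real^'n \<Rightarrow> real" where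
  "pd i f = dirderiv (axis i 1) f"

definition Lop :: "('n::finite \<Rightarrow> 'n \<Rightarrow> real^'n \<Rightarrow> real \<Rightarrow> real) \<Rightarrow> ('n \<Rightarrow> real^'n \<Rightarrow> real \<Rightarrow> real)
   \<Rightarrow> (real^'n \<Rightarrow> real \<Rightarrow> real) \<Rightarrow> (real^'n \<Rightarrow> real) \<Rightarrow> real^'n \<Rightarrow> real \<Rightarrow> real" where
  "Lop a b c \<phi> x t =
     (\<Sum>i\<in>UNIV. \<Sum>j\<in>UNIV. a i j x t * pd i (pd j \<phi>) x)
     + (\<Sum>i\<in>UNIV. b i x t * pd i \<phi> x) + c x t * \<phi> x"

text \<open>Measures on subsets of a space are represented as Borel measures on the whole
  space that vanish outside the subset.\<close>

definition given_by_flow ::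
  "(real^'n::finite) set \<Rightarrow> real \<Rightarrow> ((real^'n) \<times> real) measure \<Rightarrow> (real \<Rightarrow> (real^'n) measure) \<Rightarrow> bool" where
  "given_by_flow D T \<mu> mt \<longleftrightarrow>
     sets \<mu> = sets borel \<and>
     emeasure \<mu> (UNIV - D \<times> {0<..<T}) = 0 \<and>
     (\<forall>K. compact K \<and> K \<subseteq> D \<times> {0<..<T} \<longrightarrow> emeasure \<mu> K < \<infinity>) \<and>
     (\<forall>t\<in>{0<..<T}. sets (mt t) = sets borel \<and> emeasure (mt t) (UNIV - D) = 0) \<and>
     (\<forall>B\<in>sets borel. (\<lambda>t. emeasure (mt t) B) \<in> borel_measurable (restrict_space lborel {0<..<T})) \<and>
     (\<forall>u. test_fun (D \<times> {0<..<T}) u \<longrightarrow>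
        integrable \<mu> u \<and>
        set_integrable lborel {0<..<T} (\<lambda>t. LINT x:D|mt t. u (x, t)) \<and>
        (LINT p|\<mu>. u p) = (LINT t:{0<..<T}|lborel. LINT x:D|mt t. u (x, t)))"

definition solves_cauchy ::
  "(real^'n::finite) set \<Rightarrow> (nat \<Rightarrow> (real^'n) set) \<Rightarrow> real
   \<Rightarrow> ('n \<Rightarrow> 'n \<Rightarrow> real^'n \<Rightarrow> real \<Rightarrow> real) \<Rightarrow> ('n \<Rightarrow> real^'n \<Rightarrow> real \<Rightarrow> real) \<Rightarrow> (real^'n \<Rightarrow> real \<Rightarrow> real)
   \<Rightarrow> (real^'n) measure \<Rightarrow> ((real^'n) \<times> real) measure \<Rightarrow> (real \<Rightarrow> (real^'n) measure) \<Rightarrow> bool" where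
  "solves_cauchy D Dk T a b c \<nu> \<mu> mt \<longleftrightarrow>
     (\<forall>k \<alpha> \<beta>. 0 < \<alpha> \<and> \<alpha> \<le> \<beta> \<and> \<beta> < T \<longrightarrow>
        (\<forall>i j. set_integrable \<mu> (closure (Dk k) \<times> {\<alpha>..\<beta>}) (\<lambda>p. a i j (fst p) (snd p))) \<and>
        (\<forall>i. set_integrable \<mu> (closure (Dk k) \<times> {\<alpha>..\<beta>}) (\<lambda>p. b i (fst p) (snd p))) \<and>
        set_integrable \<mu> (closure (Dk k) \<times> {\<alpha>..\<beta>}) (\<lambda>p. c (fst p) (snd p))) \<and>
     (\<forall>\<phi>. test_fun D \<phi> \<longrightarrow>
        (AE t in lborel. t \<in> {0<..<T} \<longrightarrow>
           ((\<lambda>\<epsilon>. LINT s:{\<epsilon>..t}|lborel. LINT x:D|mt s. Lop a b c \<phi> x s)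
              \<longlongrightarrow> (LINT x:D|mt t. \<phi> x) - (LINT x:D|\<nu>. \<phi> x)) (at_right 0)))"

definition M_class ::
  "(real^'n::finite) set \<Rightarrow> (nat \<Rightarrow> (real^'n) set) \<Rightarrow> real
   \<Rightarrow> ('n \<Rightarrow> 'n \<Rightarrow> real^'n \<Rightarrow> real \<Rightarrow> real) \<Rightarrow> ('n \<Rightarrow> real^'n \<Rightarrow> real \<Rightarrow> real) \<Rightarrow> (real^'n \<Rightarrow> real \<Rightarrow> real)
   \<Rightarrow> (real^'n) measure \<Rightarrow> (((real^'n) \<times> real) measure \<times> (real \<Rightarrow> (real^'n) measure)) set" where
  "M_class D Dk T a b c \<nu> =
     {(\<mu>, mt). given_by_flow D T \<mu> mt \<and> solves_cauchy D Dk T a b c \<nu> \<mu> mt \<and>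
        set_integrable \<mu> (D \<times> {0<..<T}) (\<lambda>p. \<bar>c (fst p) (snd p)\<bar>) \<and>
        (AE t in lborel. t \<in> {0<..<T} \<longrightarrow>
           emeasure (mt t) D < \<infinity> \<and>
           measure (mt t) D \<le> measure \<nu> D + (LINT s:{0<..<t}|lborel. LINT x:D|mt s. c x s))}"

end

(* The solution is obtained as a limit of Euler chains. From a point x of Dk n the chain jumps
   by h b +- sqrt (2 h d) v_k, where the coefficients are averaged over a time cell of length h
   and v_1, ..., v_d are vectors with a = sum_k v_k v_k^T, and it is killed at rate -c; outside
   Dk n it stays put. Started from finitely supported approximations of nu, all laws of the chain
   have finite support, so the vectors v_k need not depend measurably on x. A second-order Taylor
   expansion shows that the chain satisfies the equation up to o(1) against every test function
   and that its laws are equicontinuous in time against a countable dense family of C^{1,1}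
   functions, hence converge vaguely on D, for all times, along a subsequence. Since the
   coefficients are continuous in x and locally bounded, dominated convergence in time carries the
   equation to the limit; as c <= 0, so does the mass inequality. *)
theory Submission
  imports Defs
begin

section \<open>Compactly supported continuous functions\<close>

text \<open>The coefficients are only measurable in time, so sampling them at grid times would mean
  nothing in the limit; with cell integrals the one-step terms add up exactly to the time integral
  of a path that is constant on cells. \<open>bound n\<close> may grow without control as
  \<open>Dk n\<close> exhausts \<open>D\<close>, so the mesh is tied to n: the squared jump length
  in \<open>Dk n\<close> is at most 1/(n+1). For large n the chain therefore cannot enter the
  support of a test function from outside a fixed \<open>Dk k\<close>, and every estimate uses
  constants of that \<open>Dk k\<close> only. Nothing keeps mass from drifting to the boundary of
  \<open>D\<close> or to infinity: only vague limits are available, the limit measures are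
  subprobabilities, and the mass relation survives as an inequality, reached through cutoffs below 1
  and c \<le> 0. The dense family is C^{1,1} because squared positive parts of quadratics and their
  products satisfy the second-order bound by elementary algebra, and Stone-Weierstrass makes their
  span dense. The limit functionals become measures by a Riesz theorem on the open set
  \<open>D\<close>.\<close>

definition Cc :: "'a::euclidean_space set \<Rightarrow> ('a \<Rightarrow> real) set" where
  "Cc D = {f. continuous_on UNIV f \<and> (\<exists>K. compact K \<and> K \<subseteq> D \<and> (\<forall>x. x \<notin> K \<longrightarrow> f x = 0))}"

lemma CcI: "continuous_on UNIV f \<Longrightarrow> compact K \<Longrightarrow> K \<subseteq> D \<Longrightarrow> (\<And>x. x \<notin> K \<Longrightarrow> f x = 0) \<Longrightarrow> f \<in> Cc D"
  by (auto simp: Cc_def)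

lemma Cc_support: "f \<in> Cc D \<Longrightarrow> \<exists>K. compact K \<and> K \<subseteq> D \<and> (\<forall>x. x \<notin> K \<longrightarrow> f x = 0)"
  by (simp add: Cc_def)

lemma Cc_continuous: "f \<in> Cc D \<Longrightarrow> continuous_on S f"
  by (auto simp: Cc_def intro: continuous_on_subset)

lemma Cc_measurable [measurable_dest]: "f \<in> Cc D \<Longrightarrow> f \<in> borel_measurable borel"
  by (auto intro: borel_measurable_continuous_onI Cc_continuous)

lemma Cc_outside: "f \<in> Cc D \<Longrightarrow> x \<notin> D \<Longrightarrow> f x = 0"
  by (auto simp: Cc_def)

lemma Cc_mono: "D \<subseteq> E \<Longrightarrow> f \<in> Cc D \<Longrightarrow> f \<in> Cc E"
  unfolding Cc_def by blast

lemma Cc_combine: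
  assumes "f \<in> Cc D" "g \<in> Cc D" "h 0 0 = 0" "continuous_on UNIV (\<lambda>x. h (f x) (g x))"
  shows "(\<lambda>x. h (f x) (g x)) \<in> Cc D"
proof -
  from assms(1) obtain K where K: "compact K" "K \<subseteq> D" "\<And>x. x \<notin> K \<Longrightarrow> f x = 0"
    using Cc_support[OF assms(1)] by blast
  from assms(2) obtain K' where K': "compact K'" "K' \<subseteq> D" "\<And>x. x \<notin> K' \<Longrightarrow> g x = 0"
    using Cc_support[OF assms(2)] by blast
  show ?thesis
    by (rule CcI[of _ "K \<union> K'"]) (use K K' assms(3,4) in auto)
qed

lemma Cc_zero: "(\<lambda>x. 0) \<in> Cc D"
  by (rule CcI[of _ "{}"]) auto

lemma Cc_add: "f \<in> Cc D \<Longrightarrow> g \<in> Cc D \<Longrightarrow> (\<lambda>x. f x + g x) \<in> Cc D"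
  by (rule Cc_combine) (auto intro!: continuous_intros intro: Cc_continuous)

lemma Cc_diff: "f \<in> Cc D \<Longrightarrow> g \<in> Cc D \<Longrightarrow> (\<lambda>x. f x - g x) \<in> Cc D"
  by (rule Cc_combine[where h="(-)"]) (auto intro!: continuous_intros intro: Cc_continuous)

lemma Cc_max: "f \<in> Cc D \<Longrightarrow> g \<in> Cc D \<Longrightarrow> (\<lambda>x. max (f x) (g x)) \<in> Cc D"
  by (rule Cc_combine[where h=max]) (auto intro!: continuous_intros intro: Cc_continuous)

lemma Cc_min: "f \<in> Cc D \<Longrightarrow> g \<in> Cc D \<Longrightarrow> (\<lambda>x. min (f x) (g x)) \<in> Cc D"
  by (rule Cc_combine[where h=min]) (auto intro!: continuous_intros intro: Cc_continuous)

lemma Cc_scale: "f \<in> Cc D \<Longrightarrow> (\<lambda>x. c * f x) \<in> Cc D"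
  by (rule Cc_combine[where h="\<lambda>x y. c * x"]) (auto intro!: continuous_intros intro: Cc_continuous)

lemma Cc_sum: "(\<And>i. i \<in> S \<Longrightarrow> f i \<in> Cc D) \<Longrightarrow> (\<lambda>x. \<Sum>i\<in>S. f i x) \<in> Cc D"
  by (induction S rule: infinite_finite_induct) (auto intro: Cc_zero Cc_add)

lemma Cc_bounded:
  assumes "f \<in> Cc D"
  obtains B where "B > 0" "\<And>x. \<bar>f x\<bar> \<le> B"
proof -
  obtain K where K: "compact K" "\<And>x. x \<notin> K \<Longrightarrow> f x = 0"
    using Cc_support[OF assms] by blast
  have "compact (f ` K)"
    by (rule compact_continuous_image) (use K Cc_continuous[OF assms] in auto)
  then obtain B where B: "\<And>x. x \<in> K \<Longrightarrow> \<bar>f x\<bar> \<le> B"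
    using compact_imp_bounded[of "f ` K"] unfolding bounded_iff by auto
  show ?thesis
  proof (rule that[of "max B 1"])
    show "\<bar>f x\<bar> \<le> max B 1" for x
      by (cases "x \<in> K") (use B[of x] K(2)[of x] in auto)
  qed auto
qed

lemma Cc_cutoff:
  fixes K :: "'a::euclidean_space set"
  assumes "compact K" "open U" "K \<subseteq> U"
  obtains \<psi> where "\<psi> \<in> Cc U" "\<And>x. 0 \<le> \<psi> x" "\<And>x. \<psi> x \<le> 1" "\<And>x. x \<in> K \<Longrightarrow> \<psi> x = 1"
proof (cases "K = {}")
  case True
  then show ?thesis
    by (intro that[of "\<lambda>x. 0"]) (auto intro: Cc_zero)
next
  case False
  obtain e where e: "e > 0" "(\<Union>x\<in>K. cball x e) \<subseteq> U"
    using compact_subset_open_imp_cball_epsilon_subset[OF assms] by metis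
  define \<psi> where "\<psi> x = max 0 (1 - infdist x K / e)" for x
  have cp: "compact {x. infdist x K \<le> e}"
    using False assms(1) e(1) by (intro compact_infdist_le) auto
  have sub: "{x. infdist x K \<le> e} \<subseteq> U"
  proof
    fix x assume x: "x \<in> {x. infdist x K \<le> e}"
    obtain y where "y \<in> K" "infdist x K = dist x y"
      using infdist_attains_inf[OF compact_imp_closed[OF assms(1)] False] by metis
    then show "x \<in> U"
      using x e(2) by (force simp: dist_commute)
  qed
  show ?thesis
  proof (rule that[of \<psi>])
    show "\<psi> \<in> Cc U"
    proof (rule CcI[OF _ cp sub])
      show "continuous_on UNIV \<psi>"
        unfolding \<psi>_def using e(1) by (auto intro!: continuous_intros)
      show "\<psi> x = 0" if "x \<notin> {x. infdist x K \<le> e}" for x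
        using that e(1) by (auto simp: \<psi>_def field_simps)
    qed
  qed (use e in \<open>auto simp: \<psi>_def infdist_nonneg\<close>)
qed

text \<open>Each cutoff is supported in the interior of the next compact set, on which the next
  cutoff is already 1; this makes the sequence increasing.\<close>

lemma open_exhaustion_Cc:
  fixes U :: "'a::euclidean_space set"
  assumes "open U"
  obtains \<psi> :: "nat \<Rightarrow> 'a \<Rightarrow> real" where
    "\<And>n. \<psi> n \<in> Cc U" "\<And>n x. 0 \<le> \<psi> n x" "\<And>n x. \<psi> n x \<le> 1" "\<And>x. incseq (\<lambda>n. \<psi> n x)"
    "\<And>x. (\<lambda>n. \<psi> n x) \<longlonglongrightarrow> indicator U x"
    "\<And>K. compact K \<Longrightarrow> K \<subseteq> U \<Longrightarrow> \<exists>n. \<forall>x\<in>K. \<psi> n x = 1"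
proof -
  obtain C where C: "\<And>n. compact (C n)" "\<And>n. C n \<subseteq> U" "\<And>n. C n \<subseteq> interior (C (Suc n))"
     "\<Union>(range C) = U" "\<And>K. compact K \<Longrightarrow> K \<subseteq> U \<Longrightarrow> \<exists>N. \<forall>n\<ge>N. K \<subseteq> C n"
    using open_Union_compact_subsets[OF assms] by metis
  have "\<exists>\<psi>. \<psi> \<in> Cc (interior (C (Suc n))) \<and> (\<forall>x. 0 \<le> \<psi> x) \<and> (\<forall>x. \<psi> x \<le> 1) \<and> (\<forall>x\<in>C n. \<psi> x = 1)" for n
    using Cc_cutoff[OF C(1) open_interior C(3)] by metis
  then obtain \<psi> where \<psi>: "\<And>n. \<psi> n \<in> Cc (interior (C (Suc n)))" "\<And>n x. 0 \<le> \<psi> n x"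
    "\<And>n x. \<psi> n x \<le> 1" "\<And>n x. x \<in> C n \<Longrightarrow> \<psi> n x = 1" by metis
  have intC: "interior (C n) \<subseteq> U" for n
    using C(2) interior_subset by blast
  have le: "\<psi> n x \<le> \<psi> (Suc n) x" for n x
  proof (cases "x \<in> C (Suc n)")
    case True then show ?thesis using \<psi>(3,4) by metis
  next
    case False
    then have "x \<notin> interior (C (Suc n))" using interior_subset by blast
    then have "\<psi> n x = 0" using Cc_outside[OF \<psi>(1)] by blast
    then show ?thesis using \<psi>(2) by simp
  qed
  show ?thesis
  proof (rule that[of \<psi>])
    show "\<psi> n \<in> Cc U" for n
      using Cc_mono[OF intC \<psi>(1)] .
    show "incseq (\<lambda>n. \<psi> n x)" for x
      using le by (rule incseq_SucI)
    show one: "\<exists>n. \<forall>x\<in>K. \<psi> n x = 1" if "compact K" "K \<subseteq> U" for K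
      using C(5)[OF that] \<psi>(4) by (meson order_refl subsetD)
    show "(\<lambda>n. \<psi> n x) \<longlonglongrightarrow> indicator U x" for x
    proof (cases "x \<in> U")
      case True
      then obtain N where "\<forall>n\<ge>N. {x} \<subseteq> C n" using C(5)[of "{x}"] by auto
      then have "eventually (\<lambda>n. \<psi> n x = 1) sequentially"
        using \<psi>(4) by (auto simp: eventually_sequentially)
      then show ?thesis using True by (auto intro: tendsto_eventually)
    next
      case False
      then have "\<psi> n x = 0" for n using Cc_outside[OF Cc_mono[OF intC \<psi>(1)]] by blast
      then show ?thesis using False by simp
    qed
  qed (use \<psi> in auto)
qed

text \<open>Dini's argument on the compact support of \<open>f 0\<close>: the open sets {f n < e}
  cover it, finitely many suffice, and by monotonicity the largest index serves. Off the support
  \<open>f n\<close> \<le> \<open>f 0\<close> = 0.\<close>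

lemma Cc_Dini:
  fixes f :: "nat \<Rightarrow> 'a::euclidean_space \<Rightarrow> real"
  assumes f: "\<And>n. f n \<in> Cc D" and dec: "\<And>n x. f (Suc n) x \<le> f n x"
    and lim: "\<And>x. (\<lambda>n. f n x) \<longlonglongrightarrow> 0" and "e > 0"
  shows "\<exists>N. \<forall>n\<ge>N. \<forall>x. f n x \<le> e"
proof -
  obtain K where K: "compact K" "\<And>x. x \<notin> K \<Longrightarrow> f 0 x = 0"
    using Cc_support[OF f[of 0]] by blast
  have mono: "f n x \<le> f m x" if "m \<le> n" for m n x
    using that by (induction rule: dec_induct) (use dec order_trans in blast)+
  define V where "V n = {x. f n x < e}" for n
  have op: "open (V n)" for n
    unfolding V_def using Cc_continuous[OF f] by (intro open_Collect_less) auto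
  have "\<exists>n. x \<in> V n" for x
    using order_tendstoD(2)[OF lim[of x] \<open>e > 0\<close>] by (auto simp: V_def eventually_sequentially)
  then have "K \<subseteq> (\<Union>n. V n)" by auto
  then obtain S where S: "finite S" "K \<subseteq> (\<Union>n\<in>S. V n)"
    using compactE_image[OF K(1), of UNIV V] op by auto
  obtain N where N: "\<And>n. n \<in> S \<Longrightarrow> n \<le> N"
    using S(1) unfolding finite_nat_set_iff_bounded_le by auto
  have "f n x \<le> e" if "n \<ge> N" for n x
  proof (cases "x \<in> K")
    case True
    then obtain m where "m \<in> S" "f m x < e" using S(2) by (auto simp: V_def)
    then show ?thesis using mono[of m n x] N[of m] that by linarith
  next
    case False
    then show ?thesis using K(2) mono[of 0 n x] \<open>e > 0\<close> by auto
  qed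
  then show ?thesis by blast
qed

section \<open>Riesz representation on an open set\<close>

text \<open>\<open>I_le_1\<close> bounds the total mass by 1. Applied to multiples it turns a
  uniform upper bound on f into a bound on \<open>I f\<close>, which together with Dini's theorem
  gives continuity along decreasing sequences.\<close>

locale Cc_functional =
  fixes D :: "'a::euclidean_space set" and I :: "('a \<Rightarrow> real) \<Rightarrow> real"
  assumes D_open: "open D"
    and I_add: "\<And>f g. f \<in> Cc D \<Longrightarrow> g \<in> Cc D \<Longrightarrow> I (\<lambda>x. f x + g x) = I f + I g"
    and I_scale: "\<And>f c. f \<in> Cc D \<Longrightarrow> I (\<lambda>x. c * f x) = c * I f"
    and I_nonneg: "\<And>f. f \<in> Cc D \<Longrightarrow> (\<And>x. 0 \<le> f x) \<Longrightarrow> 0 \<le> I f"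
    and I_le_1: "\<And>f. f \<in> Cc D \<Longrightarrow> (\<And>x. f x \<le> 1) \<Longrightarrow> I f \<le> 1"
begin

lemma I_diff: "f \<in> Cc D \<Longrightarrow> g \<in> Cc D \<Longrightarrow> I (\<lambda>x. f x - g x) = I f - I g"
  using I_add[of f "\<lambda>x. (-1) * g x"] I_scale[of g "-1"] Cc_scale[of g D "-1"] by simp

lemma I_zero: "I (\<lambda>x. 0) = 0"
  using I_scale[OF Cc_zero, of 0] by simp

lemma I_sum: "(\<And>i. i \<in> S \<Longrightarrow> f i \<in> Cc D) \<Longrightarrow> I (\<lambda>x. \<Sum>i\<in>S. f i x) = (\<Sum>i\<in>S. I (f i))"
  by (induction S rule: infinite_finite_induct) (simp_all add: I_zero I_add Cc_sum)

text \<open>Daniell's construction: the band between the graphs of \<open>f \<le> g\<close> receives the mass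
  \<open>I (g - f)\<close>, and \<open>B\<close> will receive the mass of the cylinder \<open>(B \<inter> D) \<times> {0..<1}\<close>.\<close>
definition band :: "('a \<Rightarrow> real) \<times> ('a \<Rightarrow> real) \<Rightarrow> ('a \<times> real) set" where
  "band p = {(x, t). fst p x \<le> t \<and> t < snd p x}"

definition bands :: "(('a \<Rightarrow> real) \<times> ('a \<Rightarrow> real)) set" where
  "bands = {p. fst p \<in> Cc D \<and> snd p \<in> Cc D \<and> (\<forall>x. fst p x \<le> snd p x)}"

definition band_mass :: "('a \<Rightarrow> real) \<times> ('a \<Rightarrow> real) \<Rightarrow> ennreal" where
  "band_mass p = ennreal (I (\<lambda>x. snd p x - fst p x))"

text \<open>Over each x the bands are disjoint half-open intervals, so additivity of Lebesgue
  measure on the line gives a pointwise series. Its remainders \<open>R n\<close> lie in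
  \<open>Cc D\<close> and decrease to 0, hence uniformly by Dini, and \<open>I_le_1\<close> carries
  this over to \<open>I (R n)\<close>.\<close>

lemma band_mass_sums:
  assumes A: "\<And>n. A n \<in> bands" and p: "p \<in> bands"
    and disj: "disjoint_family (\<lambda>n. band (A n))" and un: "(\<Union>n. band (A n)) = band p"
  shows "(\<Sum>n. band_mass (A n)) = band_mass p"
proof -
  define f g where "f n = fst (A n)" and "g n = snd (A n)" for n
  have fg: "f n \<in> Cc D" "g n \<in> Cc D" "f n x \<le> g n x" for n x
    using A[of n] by (auto simp: f_def g_def bands_def)
  have p': "fst p \<in> Cc D" "snd p \<in> Cc D" "fst p x \<le> snd p x" for x
    using p by (auto simp: bands_def)
  have sec: "(\<lambda>n. g n x - f n x) sums (snd p x - fst p x)" for x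
  proof -
    have "(\<lambda>n. emeasure lborel {f n x..<g n x}) sums emeasure lborel (\<Union>n. {f n x..<g n x})"
    proof (rule sums_emeasure)
      show "disjoint_family (\<lambda>n. {f n x..<g n x})"
        unfolding disjoint_family_on_def
      proof (intro ballI impI)
        fix m n :: nat assume "m \<noteq> n"
        then have "band (A m) \<inter> band (A n) = {}"
          using disj by (auto simp: disjoint_family_on_def)
        then have "t \<notin> {f m x..<g m x} \<inter> {f n x..<g n x}" for t
          by (auto simp: band_def f_def g_def)
        then show "{f m x..<g m x} \<inter> {f n x..<g n x} = {}" by blast
      qed
    qed auto
    moreover have "(\<Union>n. {f n x..<g n x}) = {fst p x..<snd p x}"
    proof -
      have "t \<in> (\<Union>n. {f n x..<g n x}) \<longleftrightarrow> (x, t) \<in> (\<Union>n. band (A n))" for t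
        by (auto simp: band_def f_def g_def)
      then have "t \<in> (\<Union>n. {f n x..<g n x}) \<longleftrightarrow> t \<in> {fst p x..<snd p x}" for t
        unfolding un by (simp add: band_def)
      then show ?thesis by blast
    qed
    ultimately have "(\<lambda>n. ennreal (g n x - f n x)) sums ennreal (snd p x - fst p x)"
      using fg p' by simp
    then show ?thesis
      using fg p' by (subst (asm) sums_ennreal) auto
  qed
  define R where "R n x = (snd p x - fst p x) - (\<Sum>i<n. g i x - f i x)" for n x
  have R_Cc: "R n \<in> Cc D" for n
    unfolding R_def using fg p' by (intro Cc_diff Cc_sum)
  have R_lim: "(\<lambda>n. R n x) \<longlonglongrightarrow> 0" for x
    using tendsto_diff[OF tendsto_const sec[of x, unfolded sums_def], of "snd p x - fst p x"]
    unfolding R_def by simp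
  have R_dec: "R (Suc n) x \<le> R n x" for n x
    using fg(3)[of n x] by (simp add: R_def)
  have R_nonneg: "0 \<le> R n x" for n x
    using R_lim[of x] R_dec[of _ x] by (metis decseq_SucI decseq_ge)
  have R_I: "I (R n) = I (\<lambda>x. snd p x - fst p x) - (\<Sum>i<n. I (\<lambda>x. g i x - f i x))" for n
    unfolding R_def using fg p'
    by (simp add: I_diff Cc_diff Cc_sum I_sum)
  have "(\<lambda>n. I (R n)) \<longlonglongrightarrow> 0"
  proof (rule LIMSEQ_I)
    fix e :: real assume "e > 0"
    obtain N where N: "\<And>n x. n \<ge> N \<Longrightarrow> R n x \<le> e / 2"
      using Cc_Dini[of R D "e/2", OF R_Cc R_dec R_lim] \<open>e > 0\<close> half_gt_zero by blast
    have "norm (I (R n) - 0) < e" if "n \<ge> N" for n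
    proof -
      have "I (\<lambda>x. (2 / e) * R n x) \<le> 1"
        using N[OF that] \<open>e > 0\<close> by (intro I_le_1 Cc_scale R_Cc) (simp add: field_simps)
      then have "I (R n) \<le> e / 2"
        unfolding I_scale[OF R_Cc] using \<open>e > 0\<close> by (simp add: field_simps)
      then show ?thesis using I_nonneg[OF R_Cc R_nonneg] \<open>e > 0\<close> by simp
    qed
    then show "\<exists>N. \<forall>n\<ge>N. norm (I (R n) - 0) < e" by blast
  qed
  then have "(\<lambda>n. I (\<lambda>x. snd p x - fst p x) - I (R n)) \<longlonglongrightarrow> I (\<lambda>x. snd p x - fst p x) - 0"
    by (intro tendsto_intros)
  then have "(\<lambda>i. I (\<lambda>x. g i x - f i x)) sums I (\<lambda>x. snd p x - fst p x)"
    unfolding sums_def R_I by simp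
  then have "(\<lambda>i. ennreal (I (\<lambda>x. g i x - f i x))) sums ennreal (I (\<lambda>x. snd p x - fst p x))"
    using fg p' by (subst sums_ennreal) (auto intro!: I_nonneg Cc_diff)
  then show ?thesis
    by (simp add: band_mass_def f_def g_def sums_iff)
qed

lemma band_in_bands_empty: "\<exists>p\<in>bands. band p = {}"
  by (rule bexI[of _ "(\<lambda>x. 0, \<lambda>x. 0)"]) (auto simp: band_def bands_def Cc_zero)

lemma semiring_bands: "semiring_of_sets UNIV (band ` bands)"
proof (unfold_locales)
  show "{} \<in> band ` bands" using band_in_bands_empty by (metis imageI)
next
  fix a b assume "a \<in> band ` bands" "b \<in> band ` bands"
  then obtain p q where pq: "a = band p" "b = band q" "p \<in> bands" "q \<in> bands" by auto
  note Cc = pq(3,4)[unfolded bands_def mem_Collect_eq]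
  have "a \<inter> b = band (\<lambda>x. max (fst p x) (fst q x), \<lambda>x. max (max (fst p x) (fst q x)) (min (snd p x) (snd q x)))"
    by (auto simp: pq band_def)
  moreover have "(\<lambda>x. max (fst p x) (fst q x), \<lambda>x. max (max (fst p x) (fst q x)) (min (snd p x) (snd q x))) \<in> bands"
    using Cc by (auto simp: bands_def intro!: Cc_max Cc_min)
  ultimately show "a \<inter> b \<in> band ` bands" by blast
  \<comment> \<open>\<open>r\<close> is the part of \<open>p\<close> below \<open>q\<close>, and
    \<open>s\<close> the part above it; the outer \<open>max\<close> keeps the upper graph over the
    lower one, so that a piece is empty over x where nothing remains.\<close>
  define r where "r = (fst p, \<lambda>x. max (fst p x) (min (snd p x) (fst q x)))"
  define s where "s = (\<lambda>x. max (fst p x) (snd q x), \<lambda>x. max (snd p x) (max (fst p x) (snd q x)))"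
  have rs: "r \<in> bands" "s \<in> bands"
    using Cc by (auto simp: bands_def r_def s_def intro!: Cc_max Cc_min)
  have "a - b = band r \<union> band s"
    using Cc by (auto simp: pq band_def r_def s_def less_max_iff_disj)
  moreover have "band r \<inter> band s = {}"
  proof -
    have "fst q x \<le> snd q x" for x using Cc by blast
    then show ?thesis by (fastforce simp: band_def r_def s_def less_max_iff_disj dest: order_less_le_trans)
  qed
  ultimately show "\<exists>C\<subseteq>band ` bands. finite C \<and> disjoint C \<and> a - b = \<Union>C"
    using rs by (intro exI[of _ "{band r, band s}"]) (auto simp: disjoint_def)
qed auto

definition graph_measure :: "('a \<times> real) measure" where
  "graph_measure = extend_measure UNIV bands band band_mass"

lemma emeasure_band:
  assumes "p \<in> bands"
  shows "emeasure graph_measure (band p) = band_mass p"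
proof (rule extend_measure_caratheodory[OF graph_measure_def assms semiring_bands])
  \<comment> \<open>Different pairs may describe the same band, as all pairs (f, f) do. Padding with
    empty bands turns countable additivity into independence of the chosen pair.\<close>
  have eq: "band_mass q = band_mass r" if "q \<in> bands" "r \<in> bands" "band q = band r" for q r
  proof -
    obtain z where z: "z \<in> bands" "band z = {}" using band_in_bands_empty by blast
    define A where "A n = (if n = 0 then q else z)" for n :: nat
    have A: "A n \<in> bands" for n using that z by (simp add: A_def)
    have d: "disjoint_family (\<lambda>n. band (A n))"
      using z by (auto simp: disjoint_family_on_def A_def)
    have u: "(\<Union>n. band (A n)) = band q" using z by (auto simp: A_def split: if_splits)
    show ?thesis
      using band_mass_sums[of A, OF A that(1) d u] band_mass_sums[of A, OF A that(2) d] u that(3) by simp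
  qed
  show "band_mass q = band_mass r" if "q \<in> bands" "r \<in> bands" "band q = band r" for q r
    using eq that .
  show "band_mass q = 0" if "q \<in> bands" "band q = {}" for q
  proof -
    have "(\<lambda>x. 0, \<lambda>x. 0) \<in> bands" "band (\<lambda>x. 0, \<lambda>x. 0) = {}"
      by (auto simp: band_def bands_def Cc_zero)
    then have "band_mass q = band_mass (\<lambda>x. 0, \<lambda>x. 0)" using eq that by metis
    then show ?thesis by (simp add: band_mass_def I_zero)
  qed
  show "(\<Sum>n. band_mass (A n)) = band_mass j"
    if "A \<in> UNIV \<rightarrow> bands" "j \<in> bands" "disjoint_family (band \<circ> A)" "(\<Union>i. band (A i)) = band j"
    for A :: "nat \<Rightarrow> _" and j
    using that by (intro band_mass_sums) (auto simp: comp_def)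
qed auto

lemma space_graph_measure [simp]: "space graph_measure = UNIV"
  by (simp add: graph_measure_def space_extend_measure)

lemma band_sets [measurable]: "p \<in> bands \<Longrightarrow> band p \<in> sets graph_measure"
  by (auto simp: graph_measure_def sets_extend_measure)

text \<open>The subgraphs of exhausting cutoffs increase to the cylinder. The half-open interval
  \<open>{0..<1}\<close> matters: a cutoff never exceeds 1 and a band excludes its upper
  graph.\<close>

lemma open_times_sets:
  assumes "open U" "U \<subseteq> D"
  shows "U \<times> {0..<1} \<in> sets graph_measure" "emeasure graph_measure (U \<times> {0..<1}) \<le> 1"
proof -
  obtain \<psi> :: "nat \<Rightarrow> 'a \<Rightarrow> real" where \<psi>: "\<And>n. \<psi> n \<in> Cc U" "\<And>n x. 0 \<le> \<psi> n x" "\<And>n x. \<psi> n x \<le> 1"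
    "\<And>x. incseq (\<lambda>n. \<psi> n x)" "\<And>x. (\<lambda>n. \<psi> n x) \<longlonglongrightarrow> indicator U x"
    using open_exhaustion_Cc[OF assms(1)] by metis
  have B: "(\<lambda>x. 0, \<psi> n) \<in> bands" for n
    using \<psi> Cc_mono[OF assms(2) \<psi>(1)] by (auto simp: bands_def Cc_zero)
  have eq: "U \<times> {0..<1} = (\<Union>n. band (\<lambda>x. 0, \<psi> n))"
  proof (intro equalityI subsetI)
    fix z assume "z \<in> U \<times> {0..<1::real}"
    then obtain x t where z: "z = (x, t)" "x \<in> U" "0 \<le> t" "t < 1" by auto
    then have "\<exists>n. t < \<psi> n x"
      using order_tendstoD(1)[OF \<psi>(5), of t x] by (auto simp: eventually_sequentially)
    then show "z \<in> (\<Union>n. band (\<lambda>x. 0, \<psi> n))" using z by (auto simp: band_def)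
  next
    fix z assume "z \<in> (\<Union>n. band (\<lambda>x. 0, \<psi> n))"
    then obtain n x t where z: "z = (x, t)" "0 \<le> t" "t < \<psi> n x" by (auto simp: band_def)
    then have "x \<in> U" using Cc_outside[OF \<psi>(1), of x] by (metis not_le)
    then show "z \<in> U \<times> {0..<1}" using z \<psi>(3)[of n x] by auto
  qed
  show "U \<times> {0..<1} \<in> sets graph_measure" unfolding eq using B by measurable
  have "emeasure graph_measure (\<Union>n. band (\<lambda>x. 0, \<psi> n)) = (SUP n. emeasure graph_measure (band (\<lambda>x. 0, \<psi> n)))"
  proof (rule SUP_emeasure_incseq[symmetric])
    show "incseq (\<lambda>n. band (\<lambda>x. 0, \<psi> n))"
      using \<psi>(4) by (force simp: incseq_def band_def le_fun_def intro: less_le_trans)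
  qed (use B in auto)
  also have "\<dots> \<le> 1"
    using B Cc_mono[OF assms(2) \<psi>(1)] \<psi>(3)
    by (intro SUP_least) (auto simp: emeasure_band band_mass_def intro!: I_le_1)
  finally show "emeasure graph_measure (U \<times> {0..<1}) \<le> 1" unfolding eq .
qed

definition repr_measure :: "'a measure" where
  "repr_measure = distr (restrict_space graph_measure (D \<times> {0..<1})) borel fst"

lemma sets_repr_measure [simp, measurable_cong]: "sets repr_measure = sets borel"
  by (simp add: repr_measure_def)

lemma space_repr_measure [simp]: "space repr_measure = UNIV"
  by (simp add: repr_measure_def)

lemma
  assumes "B \<in> sets borel"
  shows repr_times_sets: "(B \<inter> D) \<times> {0..<1} \<in> sets graph_measure"
    and emeasure_repr: "emeasure repr_measure B = emeasure graph_measure ((B \<inter> D) \<times> {0..<1})"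
proof -
  let ?R = "restrict_space graph_measure (D \<times> {0..<1})"
  have D: "D \<times> {0..<1} \<in> sets graph_measure" using open_times_sets D_open by blast
  have sp: "space ?R = D \<times> {0..<1}" by (simp add: space_restrict_space)
  have meas: "fst \<in> borel_measurable ?R"
  proof (rule borel_measurableI)
    fix S :: "'a set" assume "open S"
    then have "(S \<inter> D) \<times> {0..<1} \<in> sets graph_measure" using open_times_sets D_open by blast
    moreover have "fst -` S \<inter> space ?R = (S \<inter> D) \<times> {0..<1}" by (auto simp: sp)
    ultimately show "fst -` S \<inter> space ?R \<in> sets ?R"
      using D by (auto simp: sets_restrict_space_iff)
  qed
  have eq: "fst -` B \<inter> space ?R = (B \<inter> D) \<times> {0..<1}" by (auto simp: sp)
  show "(B \<inter> D) \<times> {0..<1} \<in> sets graph_measure"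
    using measurable_sets[OF meas assms] D unfolding eq by (subst (asm) sets_restrict_space_iff) auto
  show "emeasure repr_measure B = emeasure graph_measure ((B \<inter> D) \<times> {0..<1})"
    unfolding repr_measure_def using meas assms D
    by (subst emeasure_distr[OF meas assms], subst eq, subst emeasure_restrict_space) auto
qed

lemma emeasure_repr_outside: "emeasure repr_measure (UNIV - D) = 0"
  using D_open emeasure_repr[of "UNIV - D"] by (simp add: Diff_Int_distrib2)

lemma emeasure_repr_le_1: "emeasure repr_measure UNIV \<le> 1"
  using open_times_sets[OF D_open] by (simp add: emeasure_repr)

lemma finite_repr_measure: "finite_measure repr_measure"
  using emeasure_repr_le_1 by (intro finite_measureI) (auto simp: top_unique)

text \<open>The subgraph of \<open>h\<close> lies inside the cylinder over \<open>B\<close>; in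
  \<open>repr_ge\<close> the inclusion is reversed. These two comparisons are the only access to the
  measure of a set.\<close>

lemma repr_le:
  assumes "h \<in> Cc D" "\<And>x. 0 \<le> h x" "\<And>x. h x \<le> 1" "B \<in> sets borel" "\<And>x. x \<notin> B \<Longrightarrow> h x = 0"
  shows "I h \<le> measure repr_measure B"
proof -
  interpret finite_measure repr_measure by (rule finite_repr_measure)
  have b: "(\<lambda>x. 0, h) \<in> bands" using assms by (auto simp: bands_def Cc_zero)
  have "ennreal (I h) = emeasure graph_measure (band (\<lambda>x. 0, h))"
    using b by (simp add: emeasure_band band_mass_def)
  also have "\<dots> \<le> emeasure graph_measure ((B \<inter> D) \<times> {0..<1})"
  proof (rule emeasure_mono[OF _ repr_times_sets[OF assms(4)]], safe)
    fix x t assume xt: "(x, t) \<in> band (\<lambda>x. 0, h)"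
    then have "0 \<le> t" "t < h x" by (auto simp: band_def)
    then show "x \<in> B" "x \<in> D" "t \<in> {0..<1}"
      using assms(3)[of x] assms(5)[of x] Cc_outside[OF assms(1), of x] by fastforce+
  qed
  also have "\<dots> = ennreal (measure repr_measure B)"
    using assms(4) by (simp add: emeasure_repr[symmetric] emeasure_eq_measure)
  finally show ?thesis by simp
qed

lemma repr_ge:
  assumes "h \<in> Cc D" "\<And>x. 0 \<le> h x" "B \<in> sets borel" "\<And>x. x \<in> B \<Longrightarrow> h x = 1"
  shows "measure repr_measure B \<le> I h"
proof -
  interpret finite_measure repr_measure by (rule finite_repr_measure)
  have b: "(\<lambda>x. 0, h) \<in> bands" using assms by (auto simp: bands_def Cc_zero)
  have "ennreal (measure repr_measure B) = emeasure graph_measure ((B \<inter> D) \<times> {0..<1})"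
    using assms(3) by (simp add: emeasure_repr[symmetric] emeasure_eq_measure)
  also have "\<dots> \<le> emeasure graph_measure (band (\<lambda>x. 0, h))"
    using assms(4) by (intro emeasure_mono band_sets[OF b]) (auto simp: band_def)
  also have "\<dots> = ennreal (I h)"
    using b by (simp add: emeasure_band band_mass_def)
  finally show ?thesis using I_nonneg[OF assms(1,2)] by simp
qed

lemma integrable_repr: "f \<in> Cc D \<Longrightarrow> integrable repr_measure f"
proof -
  interpret finite_measure repr_measure by (rule finite_repr_measure)
  assume f: "f \<in> Cc D"
  then obtain B where "\<And>x. \<bar>f x\<bar> \<le> B" using Cc_bounded by blast
  then show ?thesis
    using Cc_measurable[OF f] by (intro integrable_const_bound[of _ B]) auto
qed

lemma sum_unit_slices:
  fixes y :: real
  assumes "0 \<le> y"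
  shows "(\<Sum>k<n. min 1 (max 0 (y - real k))) = min (real n) y"
  using assms by (induction n) auto

text \<open>Slicing \<open>f\<close> horizontally at the heights \<open>k/n\<close> squeezes both sides between
  the same Riemann sums of the level sets.\<close>
lemma integral_repr_unit:
  assumes f: "f \<in> Cc D" "\<And>x. 0 \<le> f x" "\<And>x. f x \<le> 1"
  shows "integral\<^sup>L repr_measure f = I f"
proof -
  interpret finite_measure repr_measure by (rule finite_repr_measure)
  let ?J = "integral\<^sup>L repr_measure"
  \<comment> \<open>Cutting n f into n slices puts both functionals of slice k between the masses of
    \<open>S (Suc k)\<close> and \<open>S k\<close>. These errors telescope, so the bound 1 is free
    of n and the difference has to vanish.\<close>
  have key: "real n * \<bar>I f - ?J f\<bar> \<le> 1" for n
  proof -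
    define h where "h k x = min 1 (max 0 (real n * f x - real k))" for k :: nat and x
    define S where "S k = {x. real k < real n * f x}" for k :: nat
    have S: "S k \<in> sets borel" for k
      unfolding S_def using Cc_measurable[OF f(1)] by measurable
    have h_Cc: "h k \<in> Cc D" for k
      unfolding h_def using Cc_continuous[OF f(1)]
      by (rule_tac Cc_combine[OF f(1) f(1), of "\<lambda>y z. min 1 (max 0 (real n * y - real k))"])
         (auto intro!: continuous_intros)
    have h01: "0 \<le> h k x" "h k x \<le> 1" for k x by (auto simp: h_def)
    have h_out: "h k x = 0" if "x \<notin> S k" for k x using that by (auto simp: h_def S_def)
    have h_in: "h k x = 1" if "x \<in> S (Suc k)" for k x using that by (auto simp: h_def S_def)
    have I1: "measure repr_measure (S (Suc k)) \<le> I (h k)" "I (h k) \<le> measure repr_measure (S k)" for k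
      using repr_ge[OF h_Cc h01(1) S h_in] repr_le[OF h_Cc h01 S h_out] by auto
    have J1: "measure repr_measure (S (Suc k)) \<le> ?J (h k)" for k
    proof -
      have "?J (indicator (S (Suc k))) \<le> ?J (h k)"
        using S by (intro integral_mono integrable_repr h_Cc integrable_real_indicator)
          (auto simp: h_in h01 split: split_indicator simp: emeasure_eq_measure)
      then show ?thesis using S by simp
    qed
    have J2: "?J (h k) \<le> measure repr_measure (S k)" for k
    proof -
      have "?J (h k) \<le> ?J (indicator (S k))"
        using S by (intro integral_mono integrable_repr h_Cc integrable_real_indicator)
          (auto simp: h_out h01 split: split_indicator simp: emeasure_eq_measure)
      then show ?thesis using S by simp
    qed
    have sum: "(\<Sum>k<n. h k x) = real n * f x" for x
      using sum_unit_slices[of "real n * f x" n] f(2,3)[of x] unfolding h_def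
      by (simp add: mult_left_le min_absorb2)
    have If: "real n * I f = (\<Sum>k<n. I (h k))"
      using I_sum[of "{..<n}" h, OF h_Cc] I_scale[OF f(1), of "real n"] by (simp add: sum)
    have Jf: "real n * ?J f = (\<Sum>k<n. ?J (h k))"
      using Bochner_Integration.integral_sum[of "{..<n}" repr_measure h, OF integrable_repr[OF h_Cc]]
      by (simp add: sum)
    have "real n * \<bar>I f - ?J f\<bar> = \<bar>real n * I f - real n * ?J f\<bar>"
      by (simp add: abs_mult flip: right_diff_distrib)
    also have "\<dots> = \<bar>\<Sum>k<n. I (h k) - ?J (h k)\<bar>"
      unfolding If Jf by (simp add: sum_subtractf)
    also have "\<dots> \<le> (\<Sum>k<n. \<bar>I (h k) - ?J (h k)\<bar>)" by (rule sum_abs)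
    also have "\<dots> \<le> (\<Sum>k<n. measure repr_measure (S k) - measure repr_measure (S (Suc k)))"
      using I1 J1 J2 by (intro sum_mono) (smt (verit))
    also have "\<dots> = measure repr_measure (S 0) - measure repr_measure (S n)"
      by (rule sum_lessThan_telescope')
    also have "\<dots> \<le> measure repr_measure UNIV"
      using finite_measure_mono[of "S 0" UNIV] measure_nonneg[of repr_measure "S n"] by (simp del: measure_nonneg)
    also have "\<dots> \<le> 1" using emeasure_repr_le_1 by (simp add: emeasure_eq_measure)
    finally show ?thesis .
  qed
  show ?thesis
  proof (rule ccontr)
    assume "?J f \<noteq> I f"
    then have pos: "\<bar>I f - ?J f\<bar> > 0" by simp
    obtain n :: nat where "real n * \<bar>I f - ?J f\<bar> > 1"
      using ex_less_of_nat_mult[OF pos] by blast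
    then show False using key[of n] by simp
  qed
qed

theorem integral_repr_measure:
  assumes f: "f \<in> Cc D"
  shows "integral\<^sup>L repr_measure f = I f"
proof -
  obtain B where B: "B > 0" "\<And>x. \<bar>f x\<bar> \<le> B" using Cc_bounded[OF f] by metis
  define u where "u s x = (1 / B) * max 0 (s * f x)" for s x
  have Cc: "u s \<in> Cc D" for s
    unfolding u_def by (intro Cc_scale Cc_max Cc_zero f)
  have rng: "0 \<le> u s x \<and> u s x \<le> 1" if "s = 1 \<or> s = -1" for s x
    using that B(1) B(2)[of x] by (auto simp: u_def max_def field_simps)
  have f_eq: "f x = B * u 1 x - B * u (-1) x" for x
    using B(1) by (simp add: u_def max_def field_simps)
  have "integral\<^sup>L repr_measure f = B * integral\<^sup>L repr_measure (u 1) - B * integral\<^sup>L repr_measure (u (-1))"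
    unfolding f_eq[abs_def] using integrable_repr[OF Cc] by simp
  also have "\<dots> = B * I (u 1) - B * I (u (-1))"
    using rng by (simp add: integral_repr_unit[OF Cc])
  also have "\<dots> = I f"
    unfolding f_eq[abs_def] using Cc by (simp add: I_diff I_scale Cc_scale)
  finally show ?thesis .
qed

end

section \<open>Functionals of finite support and one Euler step\<close>

text \<open>\<open>finsupp S L\<close>: the functional \<open>L\<close> is integration against a nonnegative
  measure with finite support in \<open>S\<close>; it is defined on all functions, measurable or not.\<close>
inductive finsupp :: "'a set \<Rightarrow> (('a \<Rightarrow> real) \<Rightarrow> real) \<Rightarrow> bool" for S where
  zero: "finsupp S (\<lambda>f. 0)"
| insert: "finsupp S L \<Longrightarrow> 0 \<le> w \<Longrightarrow> y \<in> S \<Longrightarrow> finsupp S (\<lambda>f. L f + w * f y)"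

lemma finsupp_point: "0 \<le> w \<Longrightarrow> y \<in> S \<Longrightarrow> finsupp S (\<lambda>f. w * f y)"
  using finsupp.insert[OF finsupp.zero] by simp

lemma finsupp_plus:
  assumes "finsupp S L" "finsupp S L'"
  shows "finsupp S (\<lambda>f. L f + L' f)"
  using assms(2)
proof induction
  case zero
  then show ?case using assms(1) by simp
next
  case (insert L' w y)
  then show ?case
    using finsupp.insert[of S "\<lambda>f. L f + L' f" w y] by (simp add: add.assoc)
qed

lemma finsupp_times: "finsupp S L \<Longrightarrow> 0 \<le> c \<Longrightarrow> finsupp S (\<lambda>f. c * L f)"
proof (induction rule: finsupp.induct)
  case zero
  then show ?case by (simp add: finsupp.zero)
next
  case (insert L w y)
  then show ?case
    using finsupp.insert[of S "\<lambda>f. c * L f" "c * w" y] by (simp add: algebra_simps)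
qed

lemma finsupp_sum: "(\<And>i. i \<in> J \<Longrightarrow> finsupp S (L i)) \<Longrightarrow> finsupp S (\<lambda>f. \<Sum>i\<in>J. L i f)"
  by (induction J rule: infinite_finite_induct) (simp_all add: finsupp.zero finsupp_plus)

lemma finsupp_fun_add: "finsupp S L \<Longrightarrow> L (\<lambda>x. f x + g x) = L f + L g"
  by (induction rule: finsupp.induct) (auto simp: algebra_simps)

lemma finsupp_fun_cmult: "finsupp S L \<Longrightarrow> L (\<lambda>x. c * f x) = c * L f"
  by (induction rule: finsupp.induct) (auto simp: algebra_simps)

lemma finsupp_fun_diff: "finsupp S L \<Longrightarrow> L (\<lambda>x. f x - g x) = L f - L g"
  by (induction rule: finsupp.induct) (auto simp: algebra_simps)

lemma finsupp_fun_zero: "finsupp S L \<Longrightarrow> L (\<lambda>x. 0) = 0"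
  by (induction rule: finsupp.induct) auto

lemma finsupp_fun_const: "finsupp S L \<Longrightarrow> L (\<lambda>x. c) = c * L (\<lambda>x. 1)"
  using finsupp_fun_cmult[of S L c "\<lambda>x. 1"] by simp

lemma finsupp_fun_sum: "finsupp S L \<Longrightarrow> L (\<lambda>x. \<Sum>i\<in>J. f i x) = (\<Sum>i\<in>J. L (f i))"
  by (induction J rule: infinite_finite_induct) (simp_all add: finsupp_fun_zero finsupp_fun_add[of S L])

lemma finsupp_mono: "finsupp S L \<Longrightarrow> (\<And>y. y \<in> S \<Longrightarrow> f y \<le> g y) \<Longrightarrow> L f \<le> L g"
  by (induction rule: finsupp.induct) (auto intro!: add_mono mult_left_mono)

lemma finsupp_cong: "finsupp S L \<Longrightarrow> (\<And>y. y \<in> S \<Longrightarrow> f y = g y) \<Longrightarrow> L f = L g"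
  by (induction rule: finsupp.induct) auto

lemma finsupp_abs:
  assumes "finsupp S L" "\<And>y. y \<in> S \<Longrightarrow> \<bar>f y\<bar> \<le> g y"
  shows "\<bar>L f\<bar> \<le> L g"
proof -
  have "L f \<le> L g"
    using assms(2) by (intro finsupp_mono[OF assms(1)]) force
  moreover have "L (\<lambda>x. (-1) * f x) \<le> L g"
    using assms(2) by (intro finsupp_mono[OF assms(1)]) force
  ultimately show ?thesis
    unfolding finsupp_fun_cmult[OF assms(1)] by linarith
qed

lemma finsupp_abs_const:
  assumes "finsupp S L" "L (\<lambda>x. 1) \<le> 1" "0 \<le> B" "\<And>y. y \<in> S \<Longrightarrow> \<bar>f y\<bar> \<le> B"
  shows "\<bar>L f\<bar> \<le> B"
proof -
  have "\<bar>L f\<bar> \<le> L (\<lambda>x. B)" using finsupp_abs[OF assms(1), of f "\<lambda>x. B"] assms(4) by blast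
  also have "\<dots> \<le> B"
    unfolding finsupp_fun_const[OF assms(1), of B] using assms(2,3) by (simp add: mult_left_le)
  finally show ?thesis .
qed

lemma finsupp_bind:
  assumes "finsupp S L" "\<And>x. finsupp S' (K x)"
  shows "finsupp S' (\<lambda>f. L (\<lambda>x. K x f))"
  using assms(1)
proof induction
  case zero
  show ?case by (rule finsupp.zero)
next
  case (insert L w y)
  show ?case
    using finsupp_plus[OF insert.IH finsupp_times[OF assms(2) insert.hyps(2)], of y] .
qed

lemma finsupp_map:
  assumes "finsupp S L" "\<And>v. v \<in> S \<Longrightarrow> g v \<in> S'"
  shows "finsupp S' (\<lambda>f. L (\<lambda>v. f (g v)))"
  using assms(1)
proof induction
  case zero
  show ?case by (rule finsupp.zero)
next
  case (insert L w y)
  show ?case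
    using finsupp.insert[OF insert.IH insert.hyps(2) assms(2)[OF insert.hyps(3)]] .
qed

text \<open>With finite support the exchange is plain linearity. Sectionwise integrability therefore
  suffices, even when the step laws depend on x in a nonmeasurable way.\<close>

lemma
  assumes "finsupp S L" "\<And>x. integrable M (F x)"
  shows finsupp_integrable: "integrable M (\<lambda>s. L (\<lambda>x. F x s))"
    and finsupp_integral: "(\<integral>s. L (\<lambda>x. F x s) \<partial>M) = L (\<lambda>x. \<integral>s. F x s \<partial>M)"
proof -
  have "integrable M (\<lambda>s. L (\<lambda>x. F x s)) \<and> (\<integral>s. L (\<lambda>x. F x s) \<partial>M) = L (\<lambda>x. \<integral>s. F x s \<partial>M)"
    using assms(1) by induction (simp_all add: assms(2))
  then show "integrable M (\<lambda>s. L (\<lambda>x. F x s))"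
    "(\<integral>s. L (\<lambda>x. F x s) \<partial>M) = L (\<lambda>x. \<integral>s. F x s \<partial>M)" by auto
qed

text \<open>\<open>L n\<close> is the image of \<nu> under a simple function \<open>F n\<close>. As
  \<open>F n\<close> tends pointwise to the identity, dominated convergence gives weak convergence
  to \<nu>.\<close>

lemma prob_finsupp_approx:
  fixes \<nu> :: "'a::{metric_space, second_countable_topology} measure"
  assumes "prob_space \<nu>" "sets \<nu> = sets borel"
  shows "\<exists>L :: nat \<Rightarrow> ('a \<Rightarrow> real) \<Rightarrow> real. (\<forall>n. finsupp UNIV (L n)) \<and> (\<forall>n. L n (\<lambda>x. 1) = 1) \<and>
    (\<forall>f B. continuous_on UNIV f \<longrightarrow> (\<forall>x. \<bar>f x\<bar> \<le> B) \<longrightarrow> (\<lambda>n. L n f) \<longlonglongrightarrow> integral\<^sup>L \<nu> f)"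
proof -
  interpret prob_space \<nu> by fact
  have sp: "space \<nu> = UNIV" using sets_eq_imp_space_eq[OF assms(2)] by simp
  have "(\<lambda>x. x) \<in> borel_measurable \<nu>"
    by (rule measurable_ident_sets[OF assms(2)])
  then obtain F where F: "\<And>i. simple_function \<nu> (F i)" "\<And>x. (\<lambda>i. F i x) \<longlonglongrightarrow> x"
    using borel_measurable_implies_sequence_metric[of "\<lambda>x. x" \<nu> undefined] sp by fastforce
  define L where "L n f = (\<Sum>y\<in>range (F n). prob (F n -` {y}) * f y)" for n and f :: "'a \<Rightarrow> real"
  have fin: "finite (range (F n))" for n
    using F(1)[of n] by (simp add: simple_function_def sp)
  have ms: "F n -` {y} \<in> events" for n y
    using simple_functionD(2)[OF F(1), of n "{y}"] by (simp add: sp)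
  have L_eq: "L n f = (\<integral>x. f (F n x) \<partial>\<nu>)" and L_int: "integrable \<nu> (\<lambda>x. f (F n x))" for n f
  proof -
    have eq: "f (F n x) = (\<Sum>y\<in>range (F n). f y * indicator (F n -` {y}) x)" for x
    proof -
      have "(\<Sum>y\<in>range (F n). f y * indicator (F n -` {y}) x) = (\<Sum>y\<in>{F n x}. f y * indicator (F n -` {y}) x)"
        using fin by (intro sum.mono_neutral_right) (auto simp: indicator_def)
      then show ?thesis by simp
    qed
    show "integrable \<nu> (\<lambda>x. f (F n x))"
      unfolding eq using ms by (auto intro!: Bochner_Integration.integrable_sum simp: emeasure_eq_measure)
    have "(\<integral>x. f (F n x) \<partial>\<nu>) = (\<Sum>y\<in>range (F n). f y * prob (F n -` {y}))"
      unfolding eq using ms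
      by (subst Bochner_Integration.integral_sum) (auto simp: emeasure_eq_measure sp)
    then show "L n f = (\<integral>x. f (F n x) \<partial>\<nu>)" by (simp add: L_def mult.commute)
  qed
  show ?thesis
  proof (intro exI[of _ L] conjI allI impI)
    show "finsupp UNIV (L n)" for n
      unfolding L_def[abs_def] by (intro finsupp_sum finsupp_point) auto
    show "L n (\<lambda>x. 1) = 1" for n
      unfolding L_eq by (simp add: prob_space)
    show "(\<lambda>n. L n f) \<longlonglongrightarrow> integral\<^sup>L \<nu> f" if f: "continuous_on UNIV f" "\<forall>x. \<bar>f x\<bar> \<le> B" for f B
      unfolding L_eq
    proof (rule integral_dominated_convergence[where w="\<lambda>x. B"])
      show "f \<in> borel_measurable \<nu>"
        using borel_measurable_continuous_onI[OF f(1)] measurable_cong_sets[OF assms(2) refl] by blast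
      show "(\<lambda>x. f (F n x)) \<in> borel_measurable \<nu>" for n
        using L_int by blast
      show "AE x in \<nu>. (\<lambda>n. f (F n x)) \<longlonglongrightarrow> f x"
        using f(1) F(2) by (auto intro!: continuous_on_tendsto_compose[OF f(1)])
    qed (use f in auto)
  qed
qed

section \<open>Positive semidefinite matrices as sums of squares, and the law of one jump\<close>

lemma quadratic_form_shift:
  fixes A :: "'n::finite \<Rightarrow> 'n \<Rightarrow> real"
  assumes sym: "\<And>i j. A i j = A j i"
  shows "(\<Sum>i\<in>UNIV. \<Sum>j\<in>UNIV. A i j * (y j + t * of_bool (j = s)) * (y i + t * of_bool (i = s))) =
    (\<Sum>i\<in>UNIV. \<Sum>j\<in>UNIV. A i j * y j * y i) + 2 * t * (\<Sum>j\<in>UNIV. A s j * y j) + t\<^sup>2 * A s s"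
proof -
  define r where "r i = (\<Sum>j\<in>UNIV. A i j * y j)" for i
  have pick: "(\<Sum>j\<in>UNIV. g j * (t * of_bool (j = s))) = t * g s" for g :: "'n \<Rightarrow> real"
    by (simp add: of_bool_def if_distrib[where f="\<lambda>x. _ * x"] cong: if_cong)
  have "(\<Sum>i\<in>UNIV. \<Sum>j\<in>UNIV. A i j * (y j + t * of_bool (j = s)) * (y i + t * of_bool (i = s))) =
      (\<Sum>i\<in>UNIV. (r i + t * A i s) * (y i + t * of_bool (i = s)))"
    unfolding r_def using pick[of "A _"]
    by (simp add: sum_distrib_right[symmetric] distrib_left sum.distrib)
  also have "\<dots> = (\<Sum>i\<in>UNIV. (r i + t * A i s) * y i) + t * (r s + t * A s s)"
    using pick[of "\<lambda>i. r i + t * A i s"] by (simp add: distrib_left sum.distrib)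
  also have "(\<Sum>i\<in>UNIV. (r i + t * A i s) * y i) = (\<Sum>i\<in>UNIV. r i * y i) + t * r s"
    unfolding r_def[of s] using sym[of _ s]
    by (simp add: distrib_right sum.distrib sum_distrib_left mult.assoc)
  also have "(\<Sum>i\<in>UNIV. r i * y i) = (\<Sum>i\<in>UNIV. \<Sum>j\<in>UNIV. A i j * y j * y i)"
    by (simp add: r_def sum_distrib_right)
  finally show ?thesis by (simp add: r_def algebra_simps power2_eq_square)
qed

text \<open>Cholesky elimination, by induction on a set \<open>S\<close> outside which all rows
  vanish. A positive pivot \<open>A s s\<close> is removed by passing to the Schur complement; a
  zero pivot forces its whole row to vanish.\<close>

lemma psd_sum_of_squares:
  fixes A :: "'n::finite \<Rightarrow> 'n \<Rightarrow> real"
  assumes sym: "\<And>i j. A i j = A j i"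
    and psd: "\<And>y. 0 \<le> (\<Sum>i\<in>UNIV. \<Sum>j\<in>UNIV. A i j * y j * y i)"
    and out: "\<And>i j. i \<notin> S \<Longrightarrow> A i j = 0"
  shows "\<exists>v :: 'n \<Rightarrow> 'n \<Rightarrow> real. \<forall>i j. A i j = (\<Sum>k\<in>S. v k i * v k j)"
  using finite[of S] sym psd out
proof (induction S arbitrary: A rule: finite_induct)
  case empty
  then show ?case by simp
next
  case (insert s S)
  note sym = insert.prems(1) and psd = insert.prems(2) and out = insert.prems(3)
  have shift: "0 \<le> (\<Sum>i\<in>UNIV. \<Sum>j\<in>UNIV. A i j * y j * y i) + 2 * t * (\<Sum>j\<in>UNIV. A s j * y j) + t\<^sup>2 * A s s" for y t
    using psd[of "\<lambda>i. y i + t * of_bool (i = s)"] unfolding quadratic_form_shift[of A, OF sym] .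
  have "0 \<le> A s s" using shift[of "\<lambda>i. 0" 1] by simp
  then consider "A s s = 0" | "A s s > 0" by linarith
  then show ?case
  proof cases
    case 1
    have row: "A s j = 0" for j
    proof (rule ccontr)
      assume nz: "A s j \<noteq> 0"
      define q where "q = (\<Sum>i\<in>UNIV. \<Sum>k\<in>UNIV. A i k * of_bool (k = j) * of_bool (i = j))"
      have lin: "(\<Sum>k\<in>UNIV. A s k * of_bool (k = j)) = A s j"
        by (simp add: of_bool_def if_distrib[where f="\<lambda>x. _ * x"] cong: if_cong)
      \<comment> \<open>With zero pivot the form along e_j + t e_s is affine in t with slope
        \<open>2 * A s j\<close>; this choice of t gives it the value -1.\<close>
      have "0 \<le> q + 2 * (- (q + 1) / (2 * A s j)) * A s j"
        using shift[of "\<lambda>i. of_bool (i = j)" "- (q + 1) / (2 * A s j)"] 1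
        unfolding lin q_def[symmetric] by simp
      then show False using nz by (simp add: field_simps)
    qed
    have "A i j = 0" if "i \<notin> S" for i j
      using that row out[of i j] by (cases "i = s") auto
    then obtain v where v: "\<And>i j. A i j = (\<Sum>k\<in>S. v k i * v k j)"
      using insert.IH[of A] sym psd by blast
    show ?thesis
    proof (intro exI[of _ "v(s := \<lambda>i. 0)"] allI)
      fix i j
      have "(\<Sum>k\<in>S. (v(s := \<lambda>i. 0)) k i * (v(s := \<lambda>i. 0)) k j) = (\<Sum>k\<in>S. v k i * v k j)"
        using insert.hyps by (intro sum.cong) auto
      then show "A i j = (\<Sum>k\<in>insert s S. (v(s := \<lambda>i. 0)) k i * (v(s := \<lambda>i. 0)) k j)"
        using v[of i j] unfolding sum.insert[OF insert.hyps(1,2)] by simp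
    qed
  next
    case 2
    \<comment> \<open>Schur complement of the pivot. Its form at y is the minimum over t of the form
      of \<open>A\<close> at y + t e_s, attained at t = -(A y)_s / \<open>A s s\<close>.\<close>
    define B where "B i j = A i j - A s i * A s j / A s s" for i j
    have "0 \<le> (\<Sum>i\<in>UNIV. \<Sum>j\<in>UNIV. B i j * y j * y i)" for y
    proof -
      define l where "l = (\<Sum>j\<in>UNIV. A s j * y j)"
      have "(\<Sum>i\<in>UNIV. \<Sum>j\<in>UNIV. B i j * y j * y i) =
          (\<Sum>i\<in>UNIV. \<Sum>j\<in>UNIV. A i j * y j * y i) - (\<Sum>i\<in>UNIV. \<Sum>j\<in>UNIV. (A s i * y i) * (A s j * y j)) / A s s"
        by (simp add: B_def sum_divide_distrib sum_subtractf[symmetric] algebra_simps)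
      also have "(\<Sum>i\<in>UNIV. \<Sum>j\<in>UNIV. (A s i * y i) * (A s j * y j)) = l\<^sup>2"
        by (simp add: l_def power2_eq_square sum_product)
      finally have "(\<Sum>i\<in>UNIV. \<Sum>j\<in>UNIV. B i j * y j * y i) = (\<Sum>i\<in>UNIV. \<Sum>j\<in>UNIV. A i j * y j * y i) - l\<^sup>2 / A s s" .
      moreover have "0 \<le> (\<Sum>i\<in>UNIV. \<Sum>j\<in>UNIV. A i j * y j * y i) - l\<^sup>2 / A s s"
        using shift[of y "- l / A s s"] 2 unfolding l_def[symmetric]
        by (simp add: field_simps power2_eq_square)
      ultimately show ?thesis by simp
    qed
    moreover have "B i j = B j i" for i j
      using sym[of i j] by (simp add: B_def mult.commute)
    moreover have "B i j = 0" if "i \<notin> S" for i j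
      using that out[of i j] out[of i s] sym[of i s] 2 by (cases "i = s") (auto simp: B_def)
    ultimately obtain v where v: "\<And>i j. B i j = (\<Sum>k\<in>S. v k i * v k j)"
      using insert.IH[of B] by blast
    show ?thesis
    proof (intro exI[of _ "v(s := \<lambda>i. A s i / sqrt (A s s))"] allI)
      fix i j
      let ?v = "v(s := \<lambda>i. A s i / sqrt (A s s))"
      have "(\<Sum>k\<in>S. ?v k i * ?v k j) = (\<Sum>k\<in>S. v k i * v k j)"
        using insert.hyps by (intro sum.cong) auto
      moreover have "?v s i * ?v s j = A s i * A s j / A s s"
        using 2 by (simp add: field_simps)
      ultimately show "A i j = (\<Sum>k\<in>insert s S. ?v k i * ?v k j)"
        using v[of i j] unfolding sum.insert[OF insert.hyps(1,2)] B_def by linarith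
    qed
  qed
qed

lemma norm_add_square_le: "(norm (x + y))\<^sup>2 \<le> 2 * (norm x)\<^sup>2 + 2 * (norm y)\<^sup>2"
proof -
  have "(norm (x + y))\<^sup>2 \<le> (norm x + norm y)\<^sup>2"
    by (intro power_mono norm_triangle_ineq) auto
  also have "\<dots> \<le> 2 * (norm x)\<^sup>2 + 2 * (norm y)\<^sup>2"
    using zero_le_power2[of "norm x - norm y"] by (simp add: power2_eq_square algebra_simps)
  finally show ?thesis .
qed

text \<open>One step of the Euler scheme: jump by \<open>h b \<plusminus> sqrt (2 h d) v\<^sub>k\<close> with equal
  probabilities, where \<open>A = \<Sum>\<^sub>k v\<^sub>k v\<^sub>k\<^sup>T\<close>.\<close>
lemma step_functional:
  fixes A :: "'n::finite \<Rightarrow> 'n \<Rightarrow> real" and b :: "real^'n"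
  assumes sym: "\<And>i j. A i j = A j i"
    and psd: "\<And>y. 0 \<le> (\<Sum>i\<in>UNIV. \<Sum>j\<in>UNIV. A i j * y j * y i)"
    and h: "0 \<le> h"
  obtains E where
    "finsupp {v. (norm v)\<^sup>2 \<le> 2 * h\<^sup>2 * (norm b)\<^sup>2 + 4 * h * real CARD('n) * (\<Sum>i\<in>UNIV. A i i)} E"
    "E (\<lambda>v. 1) = 1" "\<And>i. E (\<lambda>v. v $ i) = h * b $ i"
    "\<And>i j. E (\<lambda>v. v $ i * v $ j) = 2 * h * A i j + h\<^sup>2 * (b $ i * b $ j)"
proof -
  obtain v :: "'n \<Rightarrow> 'n \<Rightarrow> real" where v: "\<And>i j. A i j = (\<Sum>k\<in>UNIV. v k i * v k j)"
    using psd_sum_of_squares[of A UNIV, OF sym psd] by auto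
  define w where "w k = (\<chi> i. v k i)" for k
  define d where "d = real CARD('n)"
  have d: "d > 0" by (simp add: d_def)
  \<comment> \<open>Each direction has probability 1/d, so the squared length factor
    \<open>c * c\<close> = 2 h d averages to the second moment 2 h A.\<close>
  define c where "c = sqrt (2 * h * d)"
  have c2: "c * c = 2 * h * d" using h d by (simp add: c_def)
  define E where "E f = (\<Sum>k\<in>UNIV. 1 / (2 * d) * f (h *\<^sub>R b + c *\<^sub>R w k) + 1 / (2 * d) * f (h *\<^sub>R b - c *\<^sub>R w k))" for f :: "real^'n \<Rightarrow> real"
  \<comment> \<open>The trace of \<open>A\<close> is the sum of the squared norms of all
    \<open>w k\<close>, so jump lengths are bounded by \<open>A\<close> alone, whichever
    decomposition was chosen.\<close>
  have w_le: "(norm (w k))\<^sup>2 \<le> (\<Sum>i\<in>UNIV. A i i)" for k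
  proof -
    have "(norm (w k))\<^sup>2 = (\<Sum>i\<in>UNIV. v k i * v k i)"
      unfolding power2_norm_eq_inner inner_vec_def w_def by simp
    also have "\<dots> \<le> (\<Sum>i\<in>UNIV. \<Sum>k\<in>UNIV. v k i * v k i)"
      by (intro sum_mono member_le_sum) auto
    finally show ?thesis by (simp add: v)
  qed
  have norm_le: "(norm (h *\<^sub>R b + r *\<^sub>R w k))\<^sup>2 \<le> 2 * h\<^sup>2 * (norm b)\<^sup>2 + 4 * h * d * (\<Sum>i\<in>UNIV. A i i)"
    if "r * r = 2 * h * d" for r k
  proof -
    have "(norm (h *\<^sub>R b + r *\<^sub>R w k))\<^sup>2 \<le> 2 * (norm (h *\<^sub>R b))\<^sup>2 + 2 * (norm (r *\<^sub>R w k))\<^sup>2"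
      by (rule norm_add_square_le)
    also have "\<dots> = 2 * h\<^sup>2 * (norm b)\<^sup>2 + 4 * h * d * (norm (w k))\<^sup>2"
      using that by (simp add: power_mult_distrib flip: power2_eq_square)
    also have "\<dots> \<le> 2 * h\<^sup>2 * (norm b)\<^sup>2 + 4 * h * d * (\<Sum>i\<in>UNIV. A i i)"
      using w_le h d by (intro add_left_mono mult_left_mono) auto
    finally show ?thesis .
  qed
  show ?thesis
  proof (rule that[of E])
    show "finsupp {v. (norm v)\<^sup>2 \<le> 2 * h\<^sup>2 * (norm b)\<^sup>2 + 4 * h * real CARD('n) * (\<Sum>i\<in>UNIV. A i i)} E"
    proof -
      let ?S = "{v. (norm v)\<^sup>2 \<le> 2 * h\<^sup>2 * (norm b)\<^sup>2 + 4 * h * real CARD('n) * (\<Sum>i\<in>UNIV. A i i)}"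
      have S: "h *\<^sub>R b + c *\<^sub>R w k \<in> ?S" "h *\<^sub>R b - c *\<^sub>R w k \<in> ?S" for k
        using norm_le[OF c2, of k] norm_le[of "-c" k] c2 by (simp_all add: d_def)
      have "0 \<le> 1 / (2 * d)" using d by simp
      from finsupp_sum[where L="\<lambda>k f. 1 / (2 * d) * f (h *\<^sub>R b + c *\<^sub>R w k) + 1 / (2 * d) * f (h *\<^sub>R b - c *\<^sub>R w k)",
          OF finsupp_plus[OF finsupp_point[OF this S(1)] finsupp_point[OF this S(2)]]]
      show ?thesis unfolding E_def[abs_def] .
    qed
    show "E (\<lambda>v. 1) = 1"
      using d by (simp add: E_def d_def)
    show "E (\<lambda>v. v $ i) = h * b $ i" for i
    proof -
      have "E (\<lambda>v. v $ i) = (\<Sum>k\<in>(UNIV::'n set). h * b $ i / d)"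
        unfolding E_def using d by (intro sum.cong refl) (simp add: field_simps)
      then show ?thesis by (simp add: d_def)
    qed
    show "E (\<lambda>v. v $ i * v $ j) = 2 * h * A i j + h\<^sup>2 * (b $ i * b $ j)" for i j
    proof -
      have "E (\<lambda>v. v $ i * v $ j) = (\<Sum>k\<in>UNIV. (h\<^sup>2 * (b $ i * b $ j) + (c * c) * (v k i * v k j)) / d)"
        unfolding E_def using d
        by (intro sum.cong refl) (simp add: field_simps power2_eq_square w_def)
      also have "\<dots> = (\<Sum>k\<in>(UNIV::'n set). h\<^sup>2 * (b $ i * b $ j) / d) + (\<Sum>k\<in>UNIV. 2 * h * (v k i * v k j))"
        using d by (simp add: c2 sum.distrib add_divide_distrib mult.assoc)
      finally show ?thesis using d by (simp add: v sum_distrib_left d_def)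
    qed
  qed
qed

section \<open>A countable dense family of functions with Lipschitz gradient\<close>

text \<open>Boundedness together with a global second-order Taylor bound: all that an Euler step
  uses, and stable under products by algebra alone.\<close>

definition C11 :: "('a::real_inner \<Rightarrow> real) \<Rightarrow> bool" where
  "C11 f \<longleftrightarrow> (\<exists>g C. \<forall>x v. \<bar>f x\<bar> \<le> C \<and> norm (g x) \<le> C \<and> \<bar>f (x + v) - f x - inner (g x) v\<bar> \<le> C * (norm v)\<^sup>2)"

lemma C11_zero: "C11 (\<lambda>x. 0)"
  unfolding C11_def by (intro exI[of _ "\<lambda>x. 0"] exI[of _ 0]) auto

lemma C11_const: "C11 (\<lambda>x. c)"
  unfolding C11_def by (intro exI[of _ "\<lambda>x. 0"] exI[of _ "\<bar>c\<bar>"]) auto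

lemma C11_mult:
  assumes "C11 f" "C11 g"
  shows "C11 (\<lambda>x. f x * g x)"
proof -
  obtain f' C where f: "\<And>x v. \<bar>f x\<bar> \<le> C" "\<And>x. norm (f' x) \<le> C"
      "\<And>x v. \<bar>f (x + v) - f x - inner (f' x) v\<bar> \<le> C * (norm v)\<^sup>2"
    using assms(1) unfolding C11_def by blast
  obtain g' E where g: "\<And>x v. \<bar>g x\<bar> \<le> E" "\<And>x. norm (g' x) \<le> E"
      "\<And>x v. \<bar>g (x + v) - g x - inner (g' x) v\<bar> \<le> E * (norm v)\<^sup>2"
    using assms(2) unfolding C11_def by blast
  have C: "0 \<le> C" "0 \<le> E" using f(1)[of 0] g(1)[of 0] by linarith+
  \<comment> \<open>For short v this follows from the expansion of \<open>g\<close>, for long v from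
    its boundedness.\<close>
  have lip: "\<bar>g (x + v) - g x\<bar> \<le> 2 * E * norm v" for x v
  proof (cases "norm v \<le> 1")
    case True
    have "\<bar>inner (g' x) v\<bar> \<le> E * norm v"
      using Cauchy_Schwarz_ineq2[of "g' x" v] mult_right_mono[OF g(2)[of x] norm_ge_zero[of v]] by linarith
    moreover have "E * (norm v)\<^sup>2 \<le> E * norm v"
      using True C by (intro mult_left_mono) (auto simp: power2_eq_square mult_left_le)
    ultimately show ?thesis using g(3)[of x v] by linarith
  next
    case False
    then have "2 * E * 1 \<le> 2 * E * norm v" using C by (intro mult_left_mono) auto
    then show ?thesis using g(1)[of "x + v"] g(1)[of x] by linarith
  qed
  define k where "k x = f x *\<^sub>R g' x + g x *\<^sub>R f' x" for x
  have "\<bar>f x * g x\<bar> \<le> 4 * C * E" for x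
    using mult_mono[OF f(1)[of x] g(1)[of x]] C mult_nonneg_nonneg[OF C] unfolding abs_mult by linarith
  moreover have "norm (k x) \<le> 4 * C * E" for x
  proof -
    have "norm (f x *\<^sub>R g' x) \<le> C * E" using mult_mono[OF f(1)[of x] g(2)[of x]] C by simp
    moreover have "norm (g x *\<^sub>R f' x) \<le> C * E" using mult_mono[OF g(1)[of x] f(2)[of x]] C by (simp add: mult.commute)
    moreover have "0 \<le> C * E" using C by simp
    ultimately show ?thesis
      unfolding k_def using norm_triangle_ineq[of "f x *\<^sub>R g' x" "g x *\<^sub>R f' x"] by linarith
  qed
  moreover have "\<bar>f (x + v) * g (x + v) - f x * g x - inner (k x) v\<bar> \<le> 4 * C * E * (norm v)\<^sup>2" for x v
  proof -
    \<comment> \<open>The three terms of the product expansion contribute C E, C E and 2 C E; this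
      is the origin of the constant 4 C E.\<close>
    let ?Rf = "f (x + v) - f x - inner (f' x) v" and ?Rg = "g (x + v) - g x - inner (g' x) v"
    have "f (x + v) * g (x + v) - f x * g x - inner (k x) v
        = ?Rf * g (x + v) + f x * ?Rg + inner (f' x) v * (g (x + v) - g x)"
      by (simp add: k_def inner_add_left algebra_simps)
    moreover have "\<bar>?Rf * g (x + v)\<bar> \<le> (C * (norm v)\<^sup>2) * E"
      unfolding abs_mult using f(3) g(1) C by (intro mult_mono) auto
    moreover have "\<bar>f x * ?Rg\<bar> \<le> C * (E * (norm v)\<^sup>2)"
      unfolding abs_mult using f(1) g(3) C by (intro mult_mono) auto
    moreover have "\<bar>inner (f' x) v * (g (x + v) - g x)\<bar> \<le> (C * norm v) * (2 * E * norm v)"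
    proof -
      have "\<bar>inner (f' x) v\<bar> \<le> C * norm v"
        using Cauchy_Schwarz_ineq2[of "f' x" v] mult_right_mono[OF f(2)[of x] norm_ge_zero[of v]] by linarith
      then show ?thesis unfolding abs_mult using lip C by (intro mult_mono) auto
    qed
    ultimately show ?thesis by (simp add: power2_eq_square algebra_simps)
  qed
  ultimately show ?thesis
    unfolding C11_def by (intro exI[of _ k] exI[of _ "4 * C * E"]) auto
qed

text \<open>Squaring the truncated quadratic makes the gradient Lipschitz across the sphere of
  radius r, so the bump vanishes outside a ball and is still C^{1,1}.\<close>

definition bump :: "'a::real_inner \<Rightarrow> real \<Rightarrow> 'a \<Rightarrow> real" where
  "bump q r x = (max 0 (r\<^sup>2 - (norm (x - q))\<^sup>2))\<^sup>2"

lemma bump_nonneg: "0 \<le> bump q r x"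
  by (simp add: bump_def)

lemma bump_pos: "norm (x - q) < r \<Longrightarrow> 0 < bump q r x"
  using power_strict_mono[of "norm (x - q)" r 2] by (simp add: bump_def)

lemma bump_zero: "0 \<le> r \<Longrightarrow> r \<le> norm (x - q) \<Longrightarrow> bump q r x = 0"
  by (simp add: bump_def power_mono)

lemma bump_continuous: "continuous_on S (bump q r)"
  unfolding bump_def by (intro continuous_intros)

text \<open>The square of the positive part has derivative \<open>2 * max 0 a\<close>, which is
  Lipschitz with constant 2.\<close>

lemma positive_part_square_taylor:
  fixes a a' :: real
  shows "\<bar>(max 0 a')\<^sup>2 - (max 0 a)\<^sup>2 - 2 * max 0 a * (a' - a)\<bar> \<le> (a' - a)\<^sup>2"
proof -
  consider "a \<le> 0" "a' \<le> 0" | "a \<le> 0" "0 < a'" | "0 < a" "0 \<le> a'" | "0 < a" "a' < 0" by linarith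
  then show ?thesis
  proof cases
    case 2
    then have "a'\<^sup>2 \<le> (a' - a)\<^sup>2" by (intro power_mono) auto
    with 2 show ?thesis by simp
  next
    case 3
    then have "a'\<^sup>2 - a\<^sup>2 - 2 * a * (a' - a) = (a' - a)\<^sup>2" by (simp add: power2_eq_square algebra_simps)
    with 3 show ?thesis by simp
  next
    case 4
    then have "a * a' \<le> 0" by (simp add: mult_le_0_iff)
    with 4 show ?thesis by (simp add: power2_eq_square algebra_simps)
  qed simp
qed

text \<open>Chain rule for the squared positive part of a function of the squared distance. The
  increment \<delta> of the squared distance is O(|v|) only near q, hence the cases: long v use
  boundedness of the bump and of its gradient, short v far from q see only zeros.\<close>

lemma C11_bump:
  assumes r: "0 < r"
  shows "C11 (bump q r)"
proof -
  define p where "p x = max 0 (r\<^sup>2 - (norm (x - q))\<^sup>2)" for x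
  define g where "g x = (- 4 * p x) *\<^sub>R (x - q)" for x
  \<comment> \<open>One summand per source: r^4 and 4 r^3 bound the bump and its gradient, the
    others come from \<delta>^2 and from the second-order part of \<delta>.\<close>
  define C where "C = (2 * (r + 1) + 1)\<^sup>2 + 2 * r\<^sup>2 + r^4 + 4 * r^3"
  have b: "bump q r x = (p x)\<^sup>2" for x by (simp add: bump_def p_def)
  have p: "0 \<le> p x" "p x \<le> r\<^sup>2" for x by (auto simp: p_def)
  have p0: "p x = 0" if "r \<le> norm (x - q)" for x
    using that r by (simp add: p_def power_mono)
  have f_le: "\<bar>bump q r x\<bar> \<le> r^4" for x
    using power_mono[OF p(2)[of x] p(1)[of x], of 2] by (simp add: b)
  have g_le: "norm (g x) \<le> 4 * r^3" for x
  proof (cases "r \<le> norm (x - q)")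
    case True
    then show ?thesis using r p0 by (simp add: g_def)
  next
    case False
    then have "4 * p x * norm (x - q) \<le> 4 * r\<^sup>2 * r"
      using p r by (intro mult_mono) auto
    then show ?thesis using p(1)[of x] by (simp add: g_def power2_eq_square power3_eq_cube)
  qed
  have pos: "0 \<le> r^4" "0 \<le> 4 * r^3" "0 \<le> (2 * (r + 1) + 1)\<^sup>2 + 2 * r\<^sup>2" using r by auto
  have "\<bar>bump q r (x + v) - bump q r x - inner (g x) v\<bar> \<le> C * (norm v)\<^sup>2" for x v
  proof (cases "norm v \<le> 1")
    case False
    have "norm v \<le> (norm v)\<^sup>2" "1 \<le> (norm v)\<^sup>2"
      using False mult_left_mono[of 1 "norm v" "norm v"] by (auto simp: power2_eq_square)
    have "\<bar>bump q r (x + v) - bump q r x\<bar> \<le> r^4"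
      using f_le[of x] f_le[of "x + v"] bump_nonneg[of q r x] bump_nonneg[of q r "x + v"] by linarith
    also have "\<dots> \<le> r^4 * (norm v)\<^sup>2"
      using mult_left_mono[OF \<open>1 \<le> (norm v)\<^sup>2\<close> pos(1)] by simp
    finally have 1: "\<bar>bump q r (x + v) - bump q r x\<bar> \<le> r^4 * (norm v)\<^sup>2" .
    have "\<bar>inner (g x) v\<bar> \<le> 4 * r^3 * norm v"
      using Cauchy_Schwarz_ineq2[of "g x" v] mult_right_mono[OF g_le[of x] norm_ge_zero[of v]] by linarith
    also have "\<dots> \<le> 4 * r^3 * (norm v)\<^sup>2"
      using mult_left_mono[OF \<open>norm v \<le> (norm v)\<^sup>2\<close> pos(2)] .
    finally have 2: "\<bar>inner (g x) v\<bar> \<le> 4 * r^3 * (norm v)\<^sup>2" .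
    have "0 \<le> ((2 * (r + 1) + 1)\<^sup>2 + 2 * r\<^sup>2) * (norm v)\<^sup>2" using pos(3) by simp
    with 1 2 show ?thesis unfolding C_def distrib_right by linarith
  next
    case True
    show ?thesis
    proof (cases "norm (x - q) \<le> r + 1")
      case False
      then have "r \<le> norm (x - q)" "r \<le> norm (x + v - q)"
        using True norm_triangle_ineq4[of "x + v - q" v] by auto
      then have "bump q r (x + v) = 0" "bump q r x = 0" "g x = 0"
        using r by (auto simp: bump_zero g_def p0)
      then show ?thesis using r by (simp add: C_def)
    next
      case le: True
      define \<delta> where "\<delta> = (norm (x + v - q))\<^sup>2 - (norm (x - q))\<^sup>2"
      have \<delta>: "\<delta> = 2 * inner (x - q) v + (norm v)\<^sup>2"
        by (simp add: \<delta>_def power2_norm_eq_inner algebra_simps inner_commute)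
      have "\<bar>\<delta>\<bar> \<le> 2 * (norm (x - q) * norm v) + norm v * norm v"
        using Cauchy_Schwarz_ineq2[of "x - q" v] zero_le_power2[of "norm v"] unfolding \<delta> power2_eq_square
        by linarith
      also have "\<dots> \<le> 2 * ((r + 1) * norm v) + 1 * norm v"
        using le True by (intro add_mono mult_left_mono mult_right_mono) auto
      finally have \<delta>_le: "\<bar>\<delta>\<bar> \<le> (2 * (r + 1) + 1) * norm v" by (simp add: algebra_simps)
      have sq: "\<delta>\<^sup>2 \<le> (2 * (r + 1) + 1)\<^sup>2 * (norm v)\<^sup>2"
        using power_mono[OF \<delta>_le, of 2] by (simp add: power_mult_distrib)
      have eq: "bump q r (x + v) - bump q r x - inner (g x) v
          = ((p (x + v))\<^sup>2 - (p x)\<^sup>2 - 2 * p x * (- \<delta>)) - 2 * p x * (norm v)\<^sup>2"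
        unfolding b g_def \<delta> by (simp add: algebra_simps)
      have "\<bar>(p (x + v))\<^sup>2 - (p x)\<^sup>2 - 2 * p x * (- \<delta>)\<bar> \<le> \<delta>\<^sup>2"
        using positive_part_square_taylor[of "r\<^sup>2 - (norm (x + v - q))\<^sup>2" "r\<^sup>2 - (norm (x - q))\<^sup>2"]
        unfolding p_def \<delta>_def by (simp add: power2_commute)
      moreover have "\<bar>2 * p x * (norm v)\<^sup>2\<bar> \<le> 2 * r\<^sup>2 * (norm v)\<^sup>2"
        using p[of x] by (simp add: abs_mult mult_right_mono)
      ultimately have "\<bar>bump q r (x + v) - bump q r x - inner (g x) v\<bar>
          \<le> (2 * (r + 1) + 1)\<^sup>2 * (norm v)\<^sup>2 + 2 * r\<^sup>2 * (norm v)\<^sup>2"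
        unfolding eq using sq by linarith
      moreover have "0 \<le> (r^4 + 4 * r^3) * (norm v)\<^sup>2" using r by simp
      ultimately show ?thesis by (simp add: C_def distrib_right)
    qed
  qed
  moreover have "\<bar>bump q r x\<bar> \<le> C" "norm (g x) \<le> C" for x
    unfolding C_def using f_le[of x] g_le[of x] pos by linarith+
  ultimately show ?thesis
    unfolding C11_def by (intro exI[of _ g] exI[of _ C]) auto
qed

section \<open>Linear spans and uniform density in \<open>Cc D\<close>\<close>

inductive_set fspan :: "('i \<Rightarrow> 'a \<Rightarrow> real) \<Rightarrow> ('a \<Rightarrow> real) set" for \<Phi> where
  zero: "(\<lambda>x. 0) \<in> fspan \<Phi>"
| step: "g \<in> fspan \<Phi> \<Longrightarrow> (\<lambda>x. g x + c * \<Phi> i x) \<in> fspan \<Phi>"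

lemma fspan_base: "\<Phi> i \<in> fspan \<Phi>"
  using fspan.step[OF fspan.zero, where c=1 and i=i and \<Phi>=\<Phi>] by simp

lemma fspan_scale: "g \<in> fspan \<Phi> \<Longrightarrow> (\<lambda>x. c * g x) \<in> fspan \<Phi>"
proof (induction rule: fspan.induct)
  case zero
  then show ?case by (simp add: fspan.zero)
next
  case (step g c' i)
  then show ?case
    using fspan.step[OF step.IH, where c="c * c'" and i=i] by (simp add: algebra_simps)
qed

lemma fspan_add:
  assumes "f \<in> fspan \<Phi>" "g \<in> fspan \<Phi>"
  shows "(\<lambda>x. f x + g x) \<in> fspan \<Phi>"
  using assms(2)
proof (induction rule: fspan.induct)
  case zero
  then show ?case using assms(1) by simp
next
  case (step g c i)
  then show ?case
    using fspan.step[OF step.IH, where c=c and i=i] by (simp add: add.assoc)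
qed

lemma fspan_sum: "(\<And>j. j \<in> J \<Longrightarrow> f j \<in> fspan \<Phi>) \<Longrightarrow> (\<lambda>x. \<Sum>j\<in>J. f j x) \<in> fspan \<Phi>"
  by (induction J rule: infinite_finite_induct) (auto intro: fspan.zero fspan_add)

lemma fspan_linear_image:
  assumes "g \<in> fspan \<Phi>" "\<And>i. (\<lambda>x. w x * \<Phi> i x) \<in> fspan \<Psi>"
  shows "(\<lambda>x. w x * g x) \<in> fspan \<Psi>"
  using assms(1)
proof (induction rule: fspan.induct)
  case zero
  then show ?case by (simp add: fspan.zero)
next
  case (step g c i)
  then show ?case
    using fspan_add[OF step.IH fspan_scale[OF assms(2), of c i]] by (simp add: algebra_simps)
qed

lemma fspan_mult:
  assumes "\<And>i j. (\<lambda>x. \<Phi> i x * \<Phi> j x) \<in> fspan \<Phi>" "f \<in> fspan \<Phi>" "g \<in> fspan \<Phi>"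
  shows "(\<lambda>x. f x * g x) \<in> fspan \<Phi>"
proof (rule fspan_linear_image[OF assms(3)])
  fix i
  have "(\<lambda>x. \<Phi> i x * f x) \<in> fspan \<Phi>"
    by (rule fspan_linear_image[OF assms(2) assms(1)])
  then show "(\<lambda>x. f x * \<Phi> i x) \<in> fspan \<Phi>" by (simp add: mult.commute)
qed

lemma C11_prod_list: "(\<And>i. C11 (\<phi> i)) \<Longrightarrow> C11 (\<lambda>x. \<Prod>i\<leftarrow>l. \<phi> i x)"
  by (induction l) (auto intro: C11_const C11_mult)

text \<open>\<open>Cc D\<close> contains no nonzero constants, so Stone-Weierstrass is applied to a
  quotient: f is divided by \<psi>, a sum of bumps positive on its support, the quotient is
  approximated on a compact set by polynomials in bumps, and multiplication by \<psi> restores the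
  compact support and lands in the span of \<Phi>.\<close>

lemma countable_C11_dense:
  fixes D :: "'a::euclidean_space set"
  assumes D: "open D"
  obtains \<Phi> :: "nat \<Rightarrow> 'a \<Rightarrow> real" where
    "\<And>k. \<Phi> k \<in> Cc D" "\<And>k. C11 (\<Phi> k)"
    "\<And>f e. f \<in> Cc D \<Longrightarrow> 0 < e \<Longrightarrow> \<exists>g\<in>fspan \<Phi>. \<forall>x. \<bar>f x - g x\<bar> \<le> e"
proof -
  obtain Q :: "'a set" where Q: "countable Q" "\<And>X. open X \<Longrightarrow> X \<noteq> {} \<Longrightarrow> \<exists>d\<in>Q. d \<in> X"
    using countable_dense_setE by metis
  have Qne: "Q \<noteq> {}" using Q(2)[of UNIV] by auto
  define d where "d = from_nat_into Q"
  have dense: "\<exists>i. d i \<in> X" if "open X" "X \<noteq> {}" for X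
    using Q(2)[OF that] Q(1) Qne unfolding d_def by (metis from_nat_into_surj)
  define \<rho> where "\<rho> n = 1 / real (Suc n)" for n
  have \<rho>: "0 < \<rho> n" for n by (simp add: \<rho>_def)
  have \<rho>_small: "\<exists>n. \<rho> n < e" if "0 < e" for e
    using nat_approx_posE[OF that] unfolding \<rho>_def by metis
  define \<beta> where "\<beta> = (\<lambda>(i, n). bump (d i) (\<rho> n))"
  define \<Theta> where "\<Theta> l x = (\<Prod>p\<leftarrow>l. \<beta> p x)" for l x
  have \<beta>_C11: "C11 (\<beta> p)" for p by (auto simp: \<beta>_def split: prod.split intro: C11_bump \<rho>)
  have \<beta>_cont: "continuous_on S (\<beta> p)" for S p
    by (auto simp: \<beta>_def split: prod.split intro: bump_continuous)
  have \<Theta>_cont: "continuous_on S (\<Theta> l)" for S l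
    unfolding \<Theta>_def by (induction l) (auto intro!: continuous_intros \<beta>_cont)
  have \<Theta>_mult: "\<Theta> l x * \<Theta> m x = \<Theta> (l @ m) x" for l m x by (simp add: \<Theta>_def)
  \<comment> \<open>Only the first factor of a product must have its ball inside \<open>D\<close>:
    it confines the support, and the remaining factors are free.\<close>
  define P where "P = {l. \<exists>i n l'. l = (i, n) # l' \<and> cball (d i) (\<rho> n) \<subseteq> D}"
  define \<Phi> where "\<Phi> k = (if from_nat k \<in> P then \<Theta> (from_nat k) else (\<lambda>x. 0))" for k
  have \<Phi>_eq: "\<Theta> l \<in> fspan \<Phi>" if "l \<in> P" for l
  proof -
    have "\<Phi> (to_nat l) = \<Theta> l" using that by (simp add: \<Phi>_def)
    then show ?thesis using fspan_base[of \<Phi> "to_nat l"] by simp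
  qed
  show ?thesis
  proof (rule that[of \<Phi>])
    show "\<Phi> k \<in> Cc D" for k
    proof (cases "from_nat k \<in> P")
      case True
      then obtain i n l where l: "from_nat k = (i, n) # l" "cball (d i) (\<rho> n) \<subseteq> D" by (auto simp: P_def)
      have "\<Theta> ((i, n) # l) \<in> Cc D"
      proof (rule CcI[OF \<Theta>_cont _ l(2)])
        show "\<Theta> ((i, n) # l) x = 0" if "x \<notin> cball (d i) (\<rho> n)" for x
          using that \<rho>[of n] bump_zero[of "\<rho> n" x "d i"]
          by (simp add: \<Theta>_def \<beta>_def dist_norm norm_minus_commute)
      qed simp
      then show ?thesis using True l by (simp add: \<Phi>_def)
    qed (simp add: \<Phi>_def Cc_zero)
    show "C11 (\<Phi> k)" for k
      unfolding \<Phi>_def \<Theta>_def[abs_def] using C11_prod_list[of \<beta>] \<beta>_C11 by (auto intro: C11_zero)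
  next
    fix f :: "'a \<Rightarrow> real" and e :: real assume f: "f \<in> Cc D" and e: "0 < e"
    obtain K where K: "compact K" "K \<subseteq> D" "\<And>x. x \<notin> K \<Longrightarrow> f x = 0"
      using Cc_support[OF f] by auto
    define G where "G = {p. cball (d (fst p)) (\<rho> (snd p)) \<subseteq> D}"
    have cover: "\<exists>p\<in>G. x \<in> ball (d (fst p)) (\<rho> (snd p))" if xD: "x \<in> D" for x
    proof -
      obtain r where r: "r > 0" "cball x r \<subseteq> D" using open_contains_cball_eq[OF D] xD by blast
      obtain n where n: "\<rho> n < r / 2" using \<rho>_small[of "r/2"] r by auto
      obtain i where i: "d i \<in> ball x (\<rho> n)" using dense[of "ball x (\<rho> n)"] \<rho>[of n] by auto
      have "cball (d i) (\<rho> n) \<subseteq> cball x r"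
      proof
        fix y assume "y \<in> cball (d i) (\<rho> n)"
        then show "y \<in> cball x r" using i n dist_triangle[of x y "d i"] by auto
      qed
      then show ?thesis using r i by (intro bexI[of _ "(i, n)"]) (auto simp: G_def dist_commute)
    qed
    have sub: "K \<subseteq> (\<Union>p\<in>G. ball (d (fst p)) (\<rho> (snd p)))"
      using cover K(2) by blast
    obtain J where J: "J \<subseteq> G" "finite J" "K \<subseteq> (\<Union>p\<in>J. ball (d (fst p)) (\<rho> (snd p)))"
      by (rule compactE_image[OF K(1) open_ball sub])
    define \<psi> where "\<psi> x = (\<Sum>p\<in>J. \<beta> p x)" for x
    define K2 where "K2 = (\<Union>p\<in>J. cball (d (fst p)) (\<rho> (snd p)))"
    have K2: "compact K2" unfolding K2_def using J(2) by (intro compact_UN) auto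
    have \<beta>_nonneg: "0 \<le> \<beta> p x" for p x by (auto simp: \<beta>_def bump_nonneg split: prod.split)
    have \<psi>_nonneg: "0 \<le> \<psi> x" for x unfolding \<psi>_def by (intro sum_nonneg \<beta>_nonneg)
    have \<psi>_pos: "0 < \<psi> x" if xK: "x \<in> K" for x
    proof -
      obtain p where p: "p \<in> J" "x \<in> ball (d (fst p)) (\<rho> (snd p))" using J(3) xK by blast
      then have "0 < \<beta> p x"
        by (auto simp: \<beta>_def dist_norm norm_minus_commute split: prod.split intro!: bump_pos)
      then show ?thesis unfolding \<psi>_def using p(1) J(2) \<beta>_nonneg by (intro sum_pos2[of J p]) auto
    qed
    have \<psi>_zero: "\<psi> x = 0" if "x \<notin> K2" for x
      unfolding \<psi>_def
    proof (rule sum.neutral, safe)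
      fix i n assume "(i, n) \<in> J"
      then have "x \<notin> cball (d i) (\<rho> n)" using that by (force simp: K2_def)
      then show "\<beta> (i, n) x = 0"
        using bump_zero[of "\<rho> n" x "d i"] \<rho>[of n] by (simp add: \<beta>_def dist_norm norm_minus_commute)
    qed
    have \<psi>_cont: "continuous_on S \<psi>" for S unfolding \<psi>_def by (intro continuous_intros \<beta>_cont)
    have "compact (\<psi> ` K2)" using K2 \<psi>_cont by (rule compact_continuous_image[rotated])
    then obtain B where B: "\<And>x. x \<in> K2 \<Longrightarrow> \<bar>\<psi> x\<bar> \<le> B"
      using compact_imp_bounded[of "\<psi> ` K2"] unfolding bounded_iff by auto
    define B' where "B' = max B 1"
    have B': "0 < B'" "\<psi> x \<le> B'" for x
      using B[of x] \<psi>_zero[of x] by (auto simp: B'_def) (metis abs_le_D1 max.coboundedI1 max.coboundedI2 zero_le_one)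
    define \<phi> where "\<phi> x = f x / \<psi> x" for x
    \<comment> \<open>The quotient is continuous on {\<psi> > 0} and equals 0 on the open complement
      of \<open>K\<close>, including points where it reads 0/0; these two open sets cover the
      space.\<close>
    have \<phi>_cont: "continuous_on UNIV \<phi>"
    proof -
      have o: "open {x. 0 < \<psi> x}" using \<psi>_cont by (intro open_Collect_less) auto
      have "continuous_on {x. 0 < \<psi> x} \<phi>"
        unfolding \<phi>_def by (intro continuous_intros Cc_continuous[OF f] \<psi>_cont) auto
      moreover have "continuous_on (- K) \<phi>"
        by (rule continuous_on_eq[of _ "\<lambda>x. 0"]) (auto simp: \<phi>_def K(3))
      ultimately have "continuous_on ({x. 0 < \<psi> x} \<union> - K) \<phi>"
        using o K(1) by (intro continuous_on_open_Un) (auto simp: compact_imp_closed open_Compl)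
      moreover have "{x. 0 < \<psi> x} \<union> - K = UNIV" using \<psi>_pos by auto
      ultimately show ?thesis by simp
    qed
    interpret R: function_ring_on "fspan \<Theta>" K2
    proof
      show "compact K2" by (rule K2)
      show "continuous_on K2 g" if "g \<in> fspan \<Theta>" for g
        using that by induction (auto intro!: continuous_intros \<Theta>_cont)
      show "(\<lambda>x. g x + h x) \<in> fspan \<Theta>" if "g \<in> fspan \<Theta>" "h \<in> fspan \<Theta>" for g h
        using that by (rule fspan_add)
      show "(\<lambda>x. g x * h x) \<in> fspan \<Theta>" if "g \<in> fspan \<Theta>" "h \<in> fspan \<Theta>" for g h
        by (rule fspan_mult[OF _ that]) (simp add: \<Theta>_mult fspan_base)
      show "(\<lambda>x. c) \<in> fspan \<Theta>" for c
        using fspan_scale[OF fspan_base[of \<Theta> "[]"], of c] by (simp add: \<Theta>_def)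
      show "\<exists>g\<in>fspan \<Theta>. g x \<noteq> g y" if "x \<in> K2" "y \<in> K2" "x \<noteq> y" for x y
      proof -
        \<comment> \<open>A bump centred near x whose radius is below half the distance separates x
          from y.\<close>
        have "0 < norm (x - y) / 2" using that by simp
        then obtain n where n: "\<rho> n < norm (x - y) / 2" using \<rho>_small by blast
        obtain i where i: "d i \<in> ball x (\<rho> n)" using dense[of "ball x (\<rho> n)"] \<rho>[of n] by auto
        have "0 < \<Theta> [(i, n)] x"
          using i by (auto simp: \<Theta>_def \<beta>_def dist_norm intro!: bump_pos)
        moreover have "\<Theta> [(i, n)] y = 0"
        proof -
          have "norm (x - y) \<le> norm (x - d i) + norm (y - d i)"
            using norm_triangle_ineq4[of "x - d i" "y - d i"] by simp
          then have "\<rho> n \<le> norm (y - d i)" using i n by (auto simp: dist_norm)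
          then show ?thesis using bump_zero[of "\<rho> n"] \<rho>[of n] by (auto simp: \<Theta>_def \<beta>_def)
        qed
        ultimately show ?thesis using fspan_base[of \<Theta> "[(i, n)]"] by (metis less_irrefl)
      qed
    qed
    obtain g where g: "g \<in> fspan \<Theta>" "\<And>x. x \<in> K2 \<Longrightarrow> \<bar>\<phi> x - g x\<bar> < e / B'"
      using R.Stone_Weierstrass_basic[of \<phi> "e / B'"] \<phi>_cont e B' by (auto intro: continuous_on_subset)
    have mem: "(\<lambda>x. \<psi> x * g x) \<in> fspan \<Phi>"
    proof (rule fspan_linear_image[OF g(1)])
      fix l
      \<comment> \<open>Multiplication by \<psi> distributes into products that begin with some p in
        \<open>J\<close>, and these belong to \<open>P\<close>.\<close>
      have "(\<lambda>x. \<Sum>p\<in>J. \<Theta> (p # l) x) \<in> fspan \<Phi>"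
        using J(1) by (intro fspan_sum \<Phi>_eq) (auto simp: P_def G_def)
      then show "(\<lambda>x. \<psi> x * \<Theta> l x) \<in> fspan \<Phi>"
        by (simp add: \<psi>_def \<Theta>_def sum_distrib_right)
    qed
    have "\<bar>f x - \<psi> x * g x\<bar> \<le> e" for x
    proof (cases "x \<in> K2")
      case True
      have "f x = \<psi> x * \<phi> x"
        using K(3)[of x] \<psi>_pos[of x] by (cases "x \<in> K") (auto simp: \<phi>_def)
      then have "\<bar>f x - \<psi> x * g x\<bar> = \<psi> x * \<bar>\<phi> x - g x\<bar>"
        using \<psi>_nonneg[of x] by (simp add: right_diff_distrib[symmetric] abs_mult)
      also have "\<dots> \<le> B' * (e / B')"
        using g(2)[OF True] B' \<psi>_nonneg[of x] by (intro mult_mono) auto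
      finally show ?thesis using B'(1) by simp
    next
      case False
      then have "x \<notin> K" using \<psi>_zero \<psi>_pos by force
      then show ?thesis using False K(3) \<psi>_zero e by simp
    qed
    with mem show "\<exists>g\<in>fspan \<Phi>. \<forall>x. \<bar>f x - g x\<bar> \<le> e"
      by (intro bexI[of _ "\<lambda>x. \<psi> x * g x"] allI)
  qed
qed

section \<open>Taylor expansion of test functions\<close>

lemma Cc_uniformly_continuous:
  assumes f: "f \<in> Cc D" and e: "0 < e"
  shows "\<exists>\<delta>>0. \<forall>x y. dist x y < \<delta> \<longrightarrow> \<bar>f x - f y\<bar> < e"
proof -
  obtain K where K: "compact K" "\<And>x. x \<notin> K \<Longrightarrow> f x = 0" using Cc_support[OF f] by auto
  \<comment> \<open>Unit neighbourhood of the support: of two points at distance below 1, either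
    both lie in it or both lie outside the support.\<close>
  define K' where "K' = {x + y | x y. x \<in> K \<and> y \<in> cball 0 1}"
  have "compact K'" unfolding K'_def using K(1) by (intro compact_sums) auto
  then have "uniformly_continuous_on K' f"
    using Cc_continuous[OF f] by (rule compact_uniformly_continuous[rotated])
  then obtain \<delta> where \<delta>: "\<delta> > 0" "\<And>x y. x \<in> K' \<Longrightarrow> y \<in> K' \<Longrightarrow> dist y x < \<delta> \<Longrightarrow> dist (f y) (f x) < e"
    unfolding uniformly_continuous_on_def using e by meson
  have K': "y \<in> K'" if "x \<in> K" "dist x y < 1" for x y
    unfolding K'_def using that by (intro CollectI exI[of _ x] exI[of _ "y - x"]) (auto simp: dist_norm norm_minus_commute)
  have "\<bar>f x - f y\<bar> < e" if xy: "dist x y < min \<delta> 1" for x y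
  proof (cases "x \<in> K \<or> y \<in> K")
    case True
    then have "x \<in> K'" "y \<in> K'"
      using xy K'[of x y] K'[of y x] K'[of x x] K'[of y y] by (auto simp: dist_commute)
    then show ?thesis using \<delta>(2)[of y x] xy by (auto simp: dist_real_def)
  next
    case False
    then show ?thesis using K(2) e by auto
  qed
  then show ?thesis using \<delta>(1) by (intro exI[of _ "min \<delta> 1"]) auto
qed

text \<open>The increment from x to x + v is split into one-coordinate moves, each treated by the
  mean value theorem. \<open>P S v\<close> keeps only the coordinates in \<open>S\<close>, so every
  intermediate point stays within \<open>norm v\<close> of x.\<close>

lemma partial_derivatives_imp_has_derivative:
  fixes f :: "real^'n::finite \<Rightarrow> real"
  assumes pd: "\<And>i x. ((\<lambda>h. f (x + h *\<^sub>R axis i 1)) has_real_derivative G i x) (at 0)"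
    and cont: "\<And>i. continuous_on UNIV (G i)"
  shows "(f has_derivative (\<lambda>v. \<Sum>i\<in>UNIV. v $ i * G i x)) (at x)"
proof -
  define P where "P S v = (\<chi> i. if i \<in> S then v $ i else 0)" for S :: "'n set" and v :: "real^'n"
  have mvt: "\<exists>\<theta>. \<bar>\<theta>\<bar> \<le> \<bar>s\<bar> \<and> f (y + s *\<^sub>R axis i 1) - f y = s * G i (y + \<theta> *\<^sub>R axis i 1)" for y s i
  proof -
    have D: "((\<lambda>h. f (y + h *\<^sub>R axis i 1)) has_real_derivative G i (y + t *\<^sub>R axis i 1)) (at t)" for t
    proof -
      have "((\<lambda>h. f (y + t *\<^sub>R axis i 1 + (h - t) *\<^sub>R axis i 1)) has_real_derivative G i (y + t *\<^sub>R axis i 1) * 1) (at t)"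
        by (rule DERIV_chain2[where f="\<lambda>h. f (y + t *\<^sub>R axis i 1 + h *\<^sub>R axis i 1)" and g="\<lambda>h. h - t"])
           (use pd[of "y + t *\<^sub>R axis i 1" i] in \<open>auto intro!: derivative_eq_intros\<close>)
      then show ?thesis by (simp add: algebra_simps)
    qed
    consider "s = 0" | "s > 0" | "s < 0" by linarith
    then show ?thesis
    proof cases
      case 2
      then obtain z where z: "0 < z" "z < s" "f (y + s *\<^sub>R axis i 1) - f (y + 0 *\<^sub>R axis i 1) = (s - 0) * G i (y + z *\<^sub>R axis i 1)"
        using MVT2[of 0 s "\<lambda>h. f (y + h *\<^sub>R axis i 1)" "\<lambda>z. G i (y + z *\<^sub>R axis i 1)", OF 2 D] by auto
      then show ?thesis by (intro exI[of _ z]) auto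
    next
      case 3
      then obtain z where z: "s < z" "z < 0" "f (y + 0 *\<^sub>R axis i 1) - f (y + s *\<^sub>R axis i 1) = (0 - s) * G i (y + z *\<^sub>R axis i 1)"
        using MVT2[of s 0 "\<lambda>h. f (y + h *\<^sub>R axis i 1)" "\<lambda>z. G i (y + z *\<^sub>R axis i 1)", OF 3 D] by auto
      then show ?thesis by (intro exI[of _ z]) auto
    qed auto
  qed
  have tele: "\<bar>f (x + P S v) - f x - (\<Sum>i\<in>S. v $ i * G i x)\<bar> \<le> real (card S) * (norm v * e)"
    if near: "\<And>i y. norm (y - x) \<le> norm v \<Longrightarrow> \<bar>G i y - G i x\<bar> \<le> e" for S v e
    using finite[of S]
  proof (induction S rule: finite_induct)
    case empty
    have "P {} v = 0" by (simp add: P_def vec_eq_iff)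
    then show ?case by simp
  next
    case (insert i S)
    have Pi: "P (insert i S) v = P S v + (v $ i) *\<^sub>R axis i 1"
      using insert.hyps by (auto simp: P_def vec_eq_iff axis_def)
    obtain \<theta> where \<theta>: "\<bar>\<theta>\<bar> \<le> \<bar>v $ i\<bar>"
        "f (x + P S v + (v $ i) *\<^sub>R axis i 1) - f (x + P S v) = v $ i * G i (x + P S v + \<theta> *\<^sub>R axis i 1)"
      using mvt by blast
    have "norm (P S v + \<theta> *\<^sub>R axis i 1) \<le> norm v"
      using \<theta>(1) insert.hyps by (intro norm_le_componentwise_cart) (auto simp: P_def axis_def)
    then have "\<bar>G i (x + P S v + \<theta> *\<^sub>R axis i 1) - G i x\<bar> \<le> e"
      by (intro near) (simp add: add.assoc)
    then have "\<bar>v $ i * (G i (x + P S v + \<theta> *\<^sub>R axis i 1) - G i x)\<bar> \<le> norm v * e"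
      unfolding abs_mult by (intro mult_mono component_le_norm_cart) auto
    then have "\<bar>f (x + P (insert i S) v) - f (x + P S v) - v $ i * G i x\<bar> \<le> norm v * e"
      unfolding Pi using \<theta>(2) by (simp add: add.assoc right_diff_distrib)
    then show ?case
      using insert.IH insert.hyps by (simp add: algebra_simps)
  qed
  show ?thesis
    unfolding has_derivative_at_alt
  proof (intro conjI allI impI)
    show "bounded_linear (\<lambda>v. \<Sum>i\<in>UNIV. v $ i * G i x)"
      by (intro bounded_linear_sum bounded_linear_mult_const bounded_linear_vec_nth)
    fix e :: real assume e: "0 < e"
    define e' where "e' = e / real CARD('n)"
    have e': "e' > 0" using e by (simp add: e'_def)
    have "\<exists>\<delta>>0. \<forall>y. dist y x < \<delta> \<longrightarrow> dist (G i y) (G i x) < e'" for i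
      using cont[of i] e' unfolding continuous_on_iff by blast
    then obtain \<delta> where \<delta>: "\<And>i. \<delta> i > 0" "\<And>i y. dist y x < \<delta> i \<Longrightarrow> dist (G i y) (G i x) < e'" by metis
    define \<delta>0 where "\<delta>0 = Min (range \<delta>)"
    have "\<delta>0 > 0" using \<delta>(1) by (simp add: \<delta>0_def)
    moreover have "norm (f y - f x - (\<Sum>i\<in>UNIV. (y - x) $ i * G i x)) \<le> e * norm (y - x)"
      if y: "norm (y - x) < \<delta>0" for y
    proof -
      have "\<bar>f (x + P UNIV (y - x)) - f x - (\<Sum>i\<in>UNIV. (y - x) $ i * G i x)\<bar> \<le> real CARD('n) * (norm (y - x) * e')"
      proof (rule tele)
        fix i z assume z: "norm (z - x) \<le> norm (y - x)"
        have "\<delta>0 \<le> \<delta> i" by (simp add: \<delta>0_def)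
        then show "\<bar>G i z - G i x\<bar> \<le> e'"
          using \<delta>(2)[of z i] z y by (simp add: dist_norm)
      qed
      moreover have "P UNIV (y - x) = y - x" by (simp add: P_def vec_eq_iff)
      ultimately show ?thesis by (simp add: e'_def mult.commute)
    qed
    ultimately show "\<exists>d>0. \<forall>y. norm (y - x) < d \<longrightarrow>
        norm (f y - f x - (\<Sum>i\<in>UNIV. (y - x) $ i * G i x)) \<le> e * norm (y - x)" by blast
  qed
qed

lemma partial_derivatives_imp_line_derivative:
  fixes f :: "real^'n::finite \<Rightarrow> real"
  assumes "\<And>i x. ((\<lambda>h. f (x + h *\<^sub>R axis i 1)) has_real_derivative G i x) (at 0)"
    and "\<And>i. continuous_on UNIV (G i)"
  shows "((\<lambda>t. f (x + t *\<^sub>R v)) has_real_derivative (\<Sum>i\<in>UNIV. v $ i * G i (x + t *\<^sub>R v))) (at t)"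
proof -
  have "((\<lambda>t. x + t *\<^sub>R v) has_derivative (\<lambda>h. h *\<^sub>R v)) (at t)"
    by (auto intro!: derivative_eq_intros)
  from has_derivative_compose[OF this partial_derivatives_imp_has_derivative[of f G "x + t *\<^sub>R v", OF assms]]
  moreover have "(\<lambda>h. \<Sum>i\<in>UNIV. (h *\<^sub>R v) $ i * G i (x + t *\<^sub>R v)) = (\<lambda>h. (\<Sum>i\<in>UNIV. v $ i * G i (x + t *\<^sub>R v)) * h)"
    by (intro ext) (simp add: sum_distrib_left mult_ac)
  ultimately show ?thesis
    unfolding has_field_derivative_def by (simp only:)
qed

text \<open>The complement of \<open>K\<close> is open, so f vanishes on a whole segment around x in
  the direction v.\<close>

lemma dirderiv_eq_0:
  assumes "closed K" "\<And>x. x \<notin> K \<Longrightarrow> f x = 0" "x \<notin> K"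
  shows "dirderiv v f x = 0"
proof -
  have "((\<lambda>h. x + h *\<^sub>R v) \<longlongrightarrow> x + 0 *\<^sub>R v) (at 0)" by (intro tendsto_intros)
  then have "((\<lambda>h. x + h *\<^sub>R v) \<longlongrightarrow> x) (nhds 0)"
    using tendsto_at_iff_tendsto_nhds[of "\<lambda>h. x + h *\<^sub>R v" 0] by simp
  then have "\<forall>\<^sub>F h in nhds 0. x + h *\<^sub>R v \<in> - K"
    using assms(1,3) by (intro topological_tendstoD) auto
  then have "\<forall>\<^sub>F h in nhds 0. f (x + h *\<^sub>R v) = 0"
    by (rule eventually_mono) (use assms(2) in auto)
  then have "deriv (\<lambda>h. f (x + h *\<^sub>R v)) 0 = deriv (\<lambda>h. 0) 0"
    by (rule deriv_cong_ev) simp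
  then show ?thesis by (simp add: dirderiv_def)
qed

lemma test_fun_Cc: "test_fun U f \<Longrightarrow> f \<in> Cc U"
proof -
  assume f: "test_fun U f"
  have "iter_deriv [] f = f" by simp
  then have "continuous_on UNIV f"
    using f unfolding test_fun_def smooth_fun_def by (metis empty_set empty_subsetI)
  then show ?thesis
    using f closure_subset[of "{x. f x \<noteq> 0}"] unfolding test_fun_def
    by (intro CcI[of f "closure {x. f x \<noteq> 0}"]) auto
qed

lemma smooth_fun_partial:
  fixes f :: "real^'n::finite \<Rightarrow> real"
  assumes "smooth_fun f" "set vs \<subseteq> Basis"
  shows "continuous_on UNIV (iter_deriv vs f)"
    "((\<lambda>h. iter_deriv vs f (x + h *\<^sub>R axis i 1)) has_real_derivative pd i (iter_deriv vs f) x) (at 0)"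
proof -
  show "continuous_on UNIV (iter_deriv vs f)"
    using assms unfolding smooth_fun_def by blast
  have "axis i (1::real) \<in> Basis" by (auto simp: Basis_vec_def)
  then have "(\<lambda>h. iter_deriv vs f (x + h *\<^sub>R axis i 1)) differentiable (at 0)"
    using assms unfolding smooth_fun_def by blast
  then show "((\<lambda>h. iter_deriv vs f (x + h *\<^sub>R axis i 1)) has_real_derivative pd i (iter_deriv vs f) x) (at 0)"
    unfolding pd_def dirderiv_def
    using DERIV_deriv_iff_real_differentiable by blast
qed

text \<open>Maclaurin's formula along the segment from x to x + v leaves the Hessian form at an
  intermediate point. Uniform continuity of the second derivatives moves it back to x, with an error
  uniform in x.\<close>

lemma test_fun_taylor:
  fixes \<phi> :: "real^'n::finite \<Rightarrow> real"
  assumes "test_fun D \<phi>"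
  shows "\<phi> \<in> Cc D" "pd i \<phi> \<in> Cc D" "pd i (pd j \<phi>) \<in> Cc D"
    "0 < e \<Longrightarrow> \<exists>\<delta>>0. \<forall>x v. norm v < \<delta> \<longrightarrow>
      \<bar>\<phi> (x + v) - \<phi> x - (\<Sum>i\<in>UNIV. v $ i * pd i \<phi> x)
        - (\<Sum>i\<in>UNIV. \<Sum>j\<in>UNIV. v $ i * v $ j * pd i (pd j \<phi>) x) / 2\<bar> \<le> e * (norm v)\<^sup>2"
proof -
  have sm: "smooth_fun \<phi>" using assms by (simp add: test_fun_def)
  obtain K where K: "compact K" "K \<subseteq> D" "\<And>x. x \<notin> K \<Longrightarrow> \<phi> x = 0"
    using Cc_support[OF test_fun_Cc[OF assms]] by auto
  have b: "axis i (1::real) \<in> Basis" for i :: 'n by (auto simp: Basis_vec_def)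
  have d0: "((\<lambda>h. \<phi> (x + h *\<^sub>R axis i 1)) has_real_derivative pd i \<phi> x) (at 0)" for i x
    using smooth_fun_partial(2)[OF sm, of "[]"] by simp
  have d1: "((\<lambda>h. pd j \<phi> (x + h *\<^sub>R axis i 1)) has_real_derivative pd i (pd j \<phi>) x) (at 0)" for i j x
    using smooth_fun_partial(2)[OF sm, of "[axis j 1]"] b by (simp add: pd_def)
  have c1: "continuous_on UNIV (pd i \<phi>)" for i
    using smooth_fun_partial(1)[OF sm, of "[axis i 1]"] b by (simp add: pd_def)
  have c2: "continuous_on UNIV (pd i (pd j \<phi>))" for i j
    using smooth_fun_partial(1)[OF sm, of "[axis i 1, axis j 1]"] b by (simp add: pd_def)
  have z1: "pd i \<phi> x = 0" if "x \<notin> K" for i x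
    unfolding pd_def by (rule dirderiv_eq_0[OF compact_imp_closed[OF K(1)] K(3) that])
  have z2: "pd i (pd j \<phi>) x = 0" if "x \<notin> K" for i j x
    unfolding pd_def[of i] by (rule dirderiv_eq_0[OF compact_imp_closed[OF K(1)] z1 that])
  show "\<phi> \<in> Cc D" by (rule test_fun_Cc[OF assms])
  show "pd i \<phi> \<in> Cc D" by (rule CcI[OF c1 K(1,2) z1])
  have Cc2: "pd i (pd j \<phi>) \<in> Cc D" for i j by (rule CcI[OF c2 K(1,2) z2])
  then show "pd i (pd j \<phi>) \<in> Cc D" .
  assume e: "0 < e"
  \<comment> \<open>The Hessian form has d^2 entries and enters with the factor 1/2.\<close>
  define e' where "e' = 2 * e / (real CARD('n))\<^sup>2"
  have e': "e' > 0" using e by (simp add: e'_def)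
  have "\<exists>\<delta>>0. \<forall>x y. dist x y < \<delta> \<longrightarrow> \<bar>pd i (pd j \<phi>) x - pd i (pd j \<phi>) y\<bar> < e'" for i j
    by (rule Cc_uniformly_continuous[OF Cc2 e'])
  then obtain \<delta> where \<delta>: "\<And>i j. \<delta> i j > 0"
    "\<And>i j x y. dist x y < \<delta> i j \<Longrightarrow> \<bar>pd i (pd j \<phi>) x - pd i (pd j \<phi>) y\<bar> < e'" by metis
  define \<delta>0 where "\<delta>0 = Min (range (\<lambda>(i, j). \<delta> i j))"
  have \<delta>0: "\<delta>0 > 0" unfolding \<delta>0_def using \<delta>(1) by (subst Min_gr_iff) auto
  have \<delta>0_le: "\<delta>0 \<le> \<delta> i j" for i j
    unfolding \<delta>0_def by (intro Min_le) (auto intro: image_eqI[of _ _ "(i, j)"])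
  have "\<bar>\<phi> (x + v) - \<phi> x - (\<Sum>i\<in>UNIV. v $ i * pd i \<phi> x)
        - (\<Sum>i\<in>UNIV. \<Sum>j\<in>UNIV. v $ i * v $ j * pd i (pd j \<phi>) x) / 2\<bar> \<le> e * (norm v)\<^sup>2"
    if v: "norm v < \<delta>0" for x v
  proof -
    define Q where "Q y = (\<Sum>i\<in>UNIV. \<Sum>j\<in>UNIV. v $ i * v $ j * pd i (pd j \<phi>) y)" for y
    \<comment> \<open>For m \<le> 2, \<open>g m\<close> is the m-th derivative of the restriction of
      \<phi> to the line, in the shape that \<open>Maclaurin\<close> expects.\<close>
    define g where "g m t = (if m = 0 then \<phi> (x + t *\<^sub>R v)
        else if m = 1 then (\<Sum>i\<in>UNIV. v $ i * pd i \<phi> (x + t *\<^sub>R v)) else Q (x + t *\<^sub>R v))" for m :: nat and t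
    have "((\<lambda>t. \<Sum>j\<in>UNIV. v $ j * pd j \<phi> (x + t *\<^sub>R v)) has_real_derivative
        (\<Sum>j\<in>UNIV. v $ j * (\<Sum>i\<in>UNIV. v $ i * pd i (pd j \<phi>) (x + t *\<^sub>R v)))) (at t)" for t
      using partial_derivatives_imp_line_derivative[OF d1 c2]
      by (intro DERIV_sum DERIV_cmult) auto
    moreover have "(\<Sum>j\<in>UNIV. v $ j * (\<Sum>i\<in>UNIV. v $ i * pd i (pd j \<phi>) y)) = Q y" for y
      unfolding Q_def by (subst sum.swap) (simp add: sum_distrib_left mult_ac)
    ultimately have g1: "DERIV (g 1) t :> g 2 t" for t
      by (simp add: g_def[abs_def])
    have g0: "DERIV (g 0) t :> g 1 t" for t
      using partial_derivatives_imp_line_derivative[OF d0 c1] by (simp add: g_def[abs_def])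
    have "\<exists>t. 0 < t \<and> t < 1 \<and> g 0 1 = (\<Sum>m<2. g m 0 / fact m * 1 ^ m) + g 2 t / fact 2 * 1 ^ 2"
    proof (rule Maclaurin)
      show "\<forall>m t. m < 2 \<and> 0 \<le> t \<and> t \<le> 1 \<longrightarrow> DERIV (g m) t :> g (Suc m) t"
        using g0 g1[unfolded numeral_2_eq_2] by (auto simp: less_2_cases_iff)
    qed auto
    then obtain t where t: "0 < t" "t < 1" "g 0 1 = g 0 0 + g 1 0 + g 2 t / 2"
      by (auto simp: numeral_2_eq_2)
    have "\<bar>Q (x + t *\<^sub>R v) - Q x\<bar> \<le> (\<Sum>i\<in>(UNIV::'n set). \<Sum>j\<in>(UNIV::'n set). norm v * norm v * e')"
    proof -
      have "\<bar>v $ i * v $ j * (pd i (pd j \<phi>) (x + t *\<^sub>R v) - pd i (pd j \<phi>) x)\<bar> \<le> norm v * norm v * e'" for i j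
      proof -
        have "norm (t *\<^sub>R v) \<le> norm v" using t by (simp add: mult_left_le_one_le)
        then have "dist (x + t *\<^sub>R v) x < \<delta> i j" using v \<delta>0_le[of i j] by (simp add: dist_norm)
        then have "\<bar>pd i (pd j \<phi>) (x + t *\<^sub>R v) - pd i (pd j \<phi>) x\<bar> \<le> e'" using \<delta>(2) by (meson less_imp_le)
        then show ?thesis
          unfolding abs_mult by (intro mult_mono component_le_norm_cart) auto
      qed
      then have "(\<Sum>i\<in>UNIV. \<Sum>j\<in>UNIV. \<bar>v $ i * v $ j * (pd i (pd j \<phi>) (x + t *\<^sub>R v) - pd i (pd j \<phi>) x)\<bar>)
          \<le> (\<Sum>i\<in>(UNIV::'n set). \<Sum>j\<in>(UNIV::'n set). norm v * norm v * e')"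
        by (intro sum_mono)
      moreover have "\<bar>Q (x + t *\<^sub>R v) - Q x\<bar>
          \<le> (\<Sum>i\<in>UNIV. \<Sum>j\<in>UNIV. \<bar>v $ i * v $ j * (pd i (pd j \<phi>) (x + t *\<^sub>R v) - pd i (pd j \<phi>) x)\<bar>)"
        unfolding Q_def sum_subtractf[symmetric] right_diff_distrib[symmetric]
        by (rule order_trans[OF sum_abs sum_mono[OF sum_abs]])
      ultimately show ?thesis by linarith
    qed
    also have "\<dots> = 2 * e * (norm v)\<^sup>2"
      by (simp add: e'_def power2_eq_square)
    finally have "\<bar>Q (x + t *\<^sub>R v) - Q x\<bar> \<le> 2 * (e * (norm v)\<^sup>2)" by simp
    moreover have "\<phi> (x + v) - \<phi> x - (\<Sum>i\<in>UNIV. v $ i * pd i \<phi> x) = Q (x + t *\<^sub>R v) / 2"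
      using t(3) by (simp add: g_def)
    ultimately show ?thesis unfolding Q_def[symmetric] by linarith
  qed
  then show "\<exists>\<delta>>0. \<forall>x v. norm v < \<delta> \<longrightarrow>
      \<bar>\<phi> (x + v) - \<phi> x - (\<Sum>i\<in>UNIV. v $ i * pd i \<phi> x)
        - (\<Sum>i\<in>UNIV. \<Sum>j\<in>UNIV. v $ i * v $ j * pd i (pd j \<phi>) x) / 2\<bar> \<le> e * (norm v)\<^sup>2"
    using \<delta>0 by blast
qed

text \<open>Replacing x by simple functions \<open>F n x\<close> gives finite sums of products of
  measurable functions, and continuity in x identifies the pointwise limit.\<close>

lemma Caratheodory_function_measurable:
  fixes f :: "'a::{metric_space, second_countable_topology} \<Rightarrow> 'b \<Rightarrow> real"
  assumes cont: "\<And>s. s \<in> space M \<Longrightarrow> continuous_on UNIV (\<lambda>x. f x s)"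
    and meas: "\<And>x. f x \<in> borel_measurable M"
  shows "(\<lambda>p. f (fst p) (snd p)) \<in> borel_measurable (borel \<Otimes>\<^sub>M M)"
proof -
  obtain F :: "nat \<Rightarrow> 'a \<Rightarrow> 'a" where F: "\<And>i. simple_function borel (F i)" "\<And>x. (\<lambda>i. F i x) \<longlonglongrightarrow> x"
    using borel_measurable_implies_sequence_metric[of "\<lambda>x. x" borel undefined] by auto
  have fin: "finite (range (F n))" for n
    using F(1)[of n] by (simp add: simple_function_def)
  have ms [measurable]: "F n -` {y} \<in> sets borel" for n y
    using simple_functionD(2)[OF F(1), of n "{y}"] by simp
  have eq: "f (F n x) s = (\<Sum>y\<in>range (F n). f y s * indicator (F n -` {y}) x)" for n x s
  proof -
    have "(\<Sum>y\<in>range (F n). f y s * indicator (F n -` {y}) x) = (\<Sum>y\<in>{F n x}. f y s * indicator (F n -` {y}) x)"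
      using fin by (intro sum.mono_neutral_right) (auto simp: indicator_def)
    then show ?thesis by simp
  qed
  show ?thesis
  proof (rule borel_measurable_LIMSEQ_metric)
    show "(\<lambda>p. f (F n (fst p)) (snd p)) \<in> borel_measurable (borel \<Otimes>\<^sub>M M)" for n
      unfolding eq using meas by measurable
    show "(\<lambda>n. f (F n (fst p)) (snd p)) \<longlonglongrightarrow> f (fst p) (snd p)" if "p \<in> space (borel \<Otimes>\<^sub>M M)" for p
      using that F(2)[of "fst p"] cont[of "snd p"]
      by (intro continuous_on_tendsto_compose[of UNIV "\<lambda>x. f x (snd p)"]) (auto simp: space_pair_measure)
  qed
qed

section \<open>The Euler scheme\<close>

lemma finsupp_subset: "finsupp S L \<Longrightarrow> S \<subseteq> S' \<Longrightarrow> finsupp S' L"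
proof (induction rule: finsupp.induct)
  case (insert L w y)
  then show ?case by (intro finsupp.insert) auto
qed (rule finsupp.zero)

lemma set_integrable_bounded_restrict:
  fixes g :: "real \<Rightarrow> real"
  assumes "g \<in> borel_measurable (restrict_space lborel {0..T})" "\<And>s. s \<in> {0..T} \<Longrightarrow> \<bar>g s\<bar> \<le> M"
    and "S \<in> sets borel" "S \<subseteq> {0..T}"
  shows "set_integrable lborel S g"
  unfolding set_integrable_def
proof (rule Bochner_Integration.integrable_bound)
  show "integrable lborel (\<lambda>s. \<bar>M\<bar> * indicator {0..T} s)"
    by (intro integrable_mult_right integrable_real_indicator) (auto simp: emeasure_lborel_Icc_eq)
  have [measurable]: "(\<lambda>s. indicator {0..T} s *\<^sub>R g s) \<in> borel_measurable lborel"
    using assms(1) by (subst (asm) borel_measurable_restrict_space_iff) auto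
  have [measurable]: "S \<in> sets lborel" using assms(3) by simp
  have eq: "(\<lambda>s. indicator S s *\<^sub>R g s) = (\<lambda>s. indicator S s * (indicator {0..T} s *\<^sub>R g s))"
    using assms(4) by (auto simp: fun_eq_iff indicator_def)
  show "(\<lambda>s. indicator S s *\<^sub>R g s) \<in> borel_measurable lborel"
    unfolding eq by measurable
  show "AE s in lborel. norm (indicator S s *\<^sub>R g s) \<le> norm (\<bar>M\<bar> * indicator {0..T} s)"
    using assms(2,4) by (intro AE_I2) (fastforce simp: indicator_def intro: order_trans[OF _ abs_ge_self])
qed

lemma set_lebesgue_integral_abs_le:
  fixes g :: "real \<Rightarrow> real"
  assumes "set_integrable lborel {t..<t + h} g" "\<And>s. s \<in> {t..<t + h} \<Longrightarrow> \<bar>g s\<bar> \<le> M" "0 \<le> h"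
  shows "\<bar>LINT s:{t..<t + h}|lborel. g s\<bar> \<le> h * M"
proof -
  have "\<bar>LINT s:{t..<t + h}|lborel. g s\<bar> \<le> (LINT s:{t..<t + h}|lborel. \<bar>g s\<bar>)"
    using set_integral_norm_bound[OF assms(1)] by simp
  also have "\<dots> \<le> (LINT s:{t..<t + h}|lborel. M)"
    using assms by (intro set_integral_mono set_integrable_abs) (auto simp: set_integrable_def)
  also have "\<dots> = h * M" using assms(3) by (simp add: set_lebesgue_integral_def)
  finally show ?thesis .
qed

section \<open>Standing assumptions, local bounds and existence of a step law\<close>

locale cauchy_data =
  fixes D :: "(real^'n::finite) set" and Dk :: "nat \<Rightarrow> (real^'n) set" and T :: real
    and a :: "'n \<Rightarrow> 'n \<Rightarrow> real^'n \<Rightarrow> real \<Rightarrow> real"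
    and b :: "'n \<Rightarrow> real^'n \<Rightarrow> real \<Rightarrow> real"
    and c :: "real^'n \<Rightarrow> real \<Rightarrow> real"
    and \<nu> :: "(real^'n) measure"
  assumes T: "T > 0"
    and D_open: "open D"
    and Dk_open: "\<And>k. open (Dk k)"
    and Dk_incr: "\<And>k. closure (Dk k) \<subseteq> Dk (Suc k)"
    and Dk_union: "(\<Union>k. Dk k) = D"
    and c_nonpos: "\<And>x t. x \<in> D \<Longrightarrow> t \<in> {0..T} \<Longrightarrow> c x t \<le> 0"
    and a_cont: "\<And>i j t. t \<in> {0..T} \<Longrightarrow> continuous_on D (\<lambda>x. a i j x t)"
    and b_cont: "\<And>i t. t \<in> {0..T} \<Longrightarrow> continuous_on D (\<lambda>x. b i x t)"
    and c_cont: "\<And>t. t \<in> {0..T} \<Longrightarrow> continuous_on D (\<lambda>x. c x t)"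
    and a_meas: "\<And>i j x. x \<in> D \<Longrightarrow> (\<lambda>t. a i j x t) \<in> borel_measurable (restrict_space lborel {0..T})"
    and b_meas: "\<And>i x. x \<in> D \<Longrightarrow> (\<lambda>t. b i x t) \<in> borel_measurable (restrict_space lborel {0..T})"
    and c_meas: "\<And>x. x \<in> D \<Longrightarrow> (\<lambda>t. c x t) \<in> borel_measurable (restrict_space lborel {0..T})"
    and a_bdd: "\<And>i j k. \<exists>M. \<forall>x\<in>Dk k. \<forall>t\<in>{0..T}. \<bar>a i j x t\<bar> \<le> M"
    and b_bdd: "\<And>i k. \<exists>M. \<forall>x\<in>Dk k. \<forall>t\<in>{0..T}. \<bar>b i x t\<bar> \<le> M"
    and c_bdd: "\<And>k. \<exists>M. \<forall>x\<in>Dk k. \<forall>t\<in>{0..T}. \<bar>c x t\<bar> \<le> M"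
    and a_sym: "\<And>i j x t. x \<in> D \<Longrightarrow> t \<in> {0..T} \<Longrightarrow> a i j x t = a j i x t"
    and a_psd: "\<And>x t y. x \<in> D \<Longrightarrow> t \<in> {0..T} \<Longrightarrow>
                   (\<Sum>i\<in>UNIV. \<Sum>j\<in>UNIV. a i j x t * y $ j * y $ i) \<ge> 0"
    and \<nu>_prob: "prob_space \<nu>"
    and \<nu>_sets: "sets \<nu> = sets borel"
    and \<nu>_on_D: "emeasure \<nu> (UNIV - D) = 0"
begin

lemma Dk_mono: "m \<le> n \<Longrightarrow> Dk m \<subseteq> Dk n"
  by (rule lift_Suc_mono_le[of Dk]) (use Dk_incr closure_subset in blast)+

lemma Dk_subset_D: "Dk k \<subseteq> D"
  using Dk_union by blast

lemma compact_subset_Dk: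
  assumes "compact K" "K \<subseteq> D"
  shows "\<exists>k. K \<subseteq> Dk k"
proof -
  have sub: "K \<subseteq> (\<Union>k\<in>UNIV. Dk k)" using assms(2) Dk_union by simp
  obtain S where S: "finite S" "K \<subseteq> (\<Union>k\<in>S. Dk k)"
    by (rule compactE_image[OF assms(1) Dk_open sub])
  obtain N where "\<And>k. k \<in> S \<Longrightarrow> k \<le> N"
    using S(1) unfolding finite_nat_set_iff_bounded_le by auto
  then have "K \<subseteq> Dk N" using S(2) Dk_mono by blast
  then show ?thesis ..
qed

text \<open>Jumps shorter than r that start outside \<open>Dk k\<close> miss the support
  \<open>K\<close>; this confines all estimates to one fixed \<open>Dk k\<close>.\<close>

lemma compact_margin:
  assumes "compact K" "K \<subseteq> D"
  shows "\<exists>k r. 0 < r \<and> (\<forall>x v. x \<notin> Dk k \<longrightarrow> norm v < r \<longrightarrow> x + v \<notin> K)"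
proof -
  obtain k where k: "K \<subseteq> Dk k" using compact_subset_Dk[OF assms] by blast
  obtain r where r: "0 < r" "(\<Union>x\<in>K. ball x r) \<subseteq> Dk k"
    by (rule compact_subset_open_imp_ball_epsilon_subset[OF assms(1) Dk_open k])
  have "x + v \<notin> K" if "x \<notin> Dk k" "norm v < r" for x v
  proof
    assume "x + v \<in> K"
    then have "ball (x + v) r \<subseteq> Dk k" using r(2) by blast
    moreover have "x \<in> ball (x + v) r" using that(2) by (simp add: dist_norm)
    ultimately show False using that(1) by blast
  qed
  then show ?thesis using r(1) by blast
qed

text \<open>One constant for all coefficients on \<open>Dk k\<close>, taken at least 1 so that
  \<open>spread k\<close>, which dominates it, is a safe divisor.\<close>

definition bound :: "nat \<Rightarrow> real" where
  "bound k = (SOME M. 1 \<le> M \<and> (\<forall>x\<in>Dk k. \<forall>t\<in>{0..T}. (\<forall>i j. \<bar>a i j x t\<bar> \<le> M) \<and> (\<forall>i. \<bar>b i x t\<bar> \<le> M) \<and> \<bar>c x t\<bar> \<le> M))"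

lemma bound:
  shows bound_ge_1: "1 \<le> bound k"
    and a_le_bound: "x \<in> Dk k \<Longrightarrow> t \<in> {0..T} \<Longrightarrow> \<bar>a i j x t\<bar> \<le> bound k"
    and b_le_bound: "x \<in> Dk k \<Longrightarrow> t \<in> {0..T} \<Longrightarrow> \<bar>b i x t\<bar> \<le> bound k"
    and c_le_bound: "x \<in> Dk k \<Longrightarrow> t \<in> {0..T} \<Longrightarrow> \<bar>c x t\<bar> \<le> bound k"
proof -
  obtain A where A: "\<And>i j x t. x \<in> Dk k \<Longrightarrow> t \<in> {0..T} \<Longrightarrow> \<bar>a i j x t\<bar> \<le> A i j" using a_bdd[of k] by metis
  obtain B where B: "\<And>i x t. x \<in> Dk k \<Longrightarrow> t \<in> {0..T} \<Longrightarrow> \<bar>b i x t\<bar> \<le> B i" using b_bdd[of k] by metis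
  obtain C where C: "\<And>x t. x \<in> Dk k \<Longrightarrow> t \<in> {0..T} \<Longrightarrow> \<bar>c x t\<bar> \<le> C" using c_bdd[of k] by metis
  define M where "M = 1 + (\<Sum>i\<in>UNIV. \<Sum>j\<in>UNIV. \<bar>A i j\<bar>) + (\<Sum>i\<in>UNIV. \<bar>B i\<bar>) + \<bar>C\<bar>"
  have nn: "0 \<le> (\<Sum>i\<in>UNIV. \<Sum>j\<in>UNIV. \<bar>A i j\<bar>)" "0 \<le> (\<Sum>i\<in>UNIV. \<bar>B i\<bar>)" "0 \<le> \<bar>C\<bar>"
    by (auto intro!: sum_nonneg)
  have A_le: "\<bar>A i j\<bar> \<le> (\<Sum>i\<in>UNIV. \<Sum>j\<in>UNIV. \<bar>A i j\<bar>)" for i j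
    using member_le_sum[of j UNIV "\<lambda>j. \<bar>A i j\<bar>"] member_le_sum[of i UNIV "\<lambda>i. \<Sum>j\<in>UNIV. \<bar>A i j\<bar>"]
    by (fastforce intro: sum_nonneg)
  have "\<bar>A i j\<bar> \<le> M" for i j using nn A_le[of i j] unfolding M_def by linarith
  moreover have B_le: "\<bar>B i\<bar> \<le> (\<Sum>i\<in>UNIV. \<bar>B i\<bar>)" for i
    using member_le_sum[of i UNIV "\<lambda>i. \<bar>B i\<bar>"] by simp
  have "\<bar>B i\<bar> \<le> M" for i using nn B_le[of i] unfolding M_def by linarith
  moreover have "\<bar>C\<bar> \<le> M" "1 \<le> M" using nn unfolding M_def by auto
  ultimately have "1 \<le> M \<and> (\<forall>x\<in>Dk k. \<forall>t\<in>{0..T}. (\<forall>i j. \<bar>a i j x t\<bar> \<le> M) \<and> (\<forall>i. \<bar>b i x t\<bar> \<le> M) \<and> \<bar>c x t\<bar> \<le> M)"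
    using A B C by (meson abs_ge_self order_trans)
  then have "1 \<le> bound k \<and> (\<forall>x\<in>Dk k. \<forall>t\<in>{0..T}. (\<forall>i j. \<bar>a i j x t\<bar> \<le> bound k) \<and> (\<forall>i. \<bar>b i x t\<bar> \<le> bound k) \<and> \<bar>c x t\<bar> \<le> bound k)"
    unfolding bound_def by (rule someI)
  then show "1 \<le> bound k" "x \<in> Dk k \<Longrightarrow> t \<in> {0..T} \<Longrightarrow> \<bar>a i j x t\<bar> \<le> bound k"
    "x \<in> Dk k \<Longrightarrow> t \<in> {0..T} \<Longrightarrow> \<bar>b i x t\<bar> \<le> bound k"
    "x \<in> Dk k \<Longrightarrow> t \<in> {0..T} \<Longrightarrow> \<bar>c x t\<bar> \<le> bound k" by blast+
qed

text \<open>Bounds the squared jump length divided by h: the support radius of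
  \<open>step_functional\<close> with |b|^2 \<le> d M^2, trace \<le> d M and h^2 \<le> h, where d is
  the dimension and M = \<open>bound k\<close>.\<close>

definition spread :: "nat \<Rightarrow> real" where
  "spread k = 2 * real CARD('n) * (bound k)\<^sup>2 + 4 * (real CARD('n))\<^sup>2 * bound k"

text \<open>An integral, that is, h times the average, so that cells add up to integrals over longer
  times.\<close>

definition cell :: "real \<Rightarrow> real \<Rightarrow> (real \<Rightarrow> real) \<Rightarrow> real" where
  "cell h t g = (LINT s:{t..<t + h}|lborel. g s)"

lemma
  assumes "x \<in> D" "S \<in> sets borel" "S \<subseteq> {0..T}"
  shows a_integrable: "set_integrable lborel S (a i j x)"
    and b_integrable: "set_integrable lborel S (b i x)"
    and c_integrable: "set_integrable lborel S (c x)"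
proof -
  obtain k where k: "x \<in> Dk k" using assms(1) Dk_union by blast
  show "set_integrable lborel S (a i j x)"
    by (rule set_integrable_bounded_restrict[OF a_meas[OF assms(1)] a_le_bound[OF k] assms(2,3)])
  show "set_integrable lborel S (b i x)"
    by (rule set_integrable_bounded_restrict[OF b_meas[OF assms(1)] b_le_bound[OF k] assms(2,3)])
  show "set_integrable lborel S (c x)"
    by (rule set_integrable_bounded_restrict[OF c_meas[OF assms(1)] c_le_bound[OF k] assms(2,3)])
qed

context
  fixes h t :: real
  assumes h: "0 < h" "h \<le> 1" and t: "0 \<le> t" "t + h \<le> T"
begin

lemma cell_subset: "{t..<t + h} \<subseteq> {0..T}"
  using h t by auto

lemma
  assumes "x \<in> D"
  shows a_cell_integrable: "set_integrable lborel {t..<t + h} (a i j x)"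
    and b_cell_integrable: "set_integrable lborel {t..<t + h} (b i x)"
    and c_cell_integrable: "set_integrable lborel {t..<t + h} (c x)"
  by (intro a_integrable b_integrable c_integrable assms cell_subset; simp)+

lemma
  assumes "x \<in> Dk k"
  shows a_cell_le: "\<bar>cell h t (a i j x)\<bar> \<le> h * bound k"
    and b_cell_le: "\<bar>cell h t (b i x)\<bar> \<le> h * bound k"
    and c_cell_le: "\<bar>cell h t (c x)\<bar> \<le> h * bound k"
proof -
  have x: "x \<in> D" using assms Dk_subset_D by blast
  have s: "s \<in> {0..T}" if "s \<in> {t..<t + h}" for s using that cell_subset by blast
  show "\<bar>cell h t (a i j x)\<bar> \<le> h * bound k" "\<bar>cell h t (b i x)\<bar> \<le> h * bound k" "\<bar>cell h t (c x)\<bar> \<le> h * bound k"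
    unfolding cell_def using h
    by (auto intro!: set_lebesgue_integral_abs_le a_cell_integrable b_cell_integrable c_cell_integrable x
        a_le_bound b_le_bound c_le_bound assms s simp del: atLeastLessThan_iff)
qed

lemma c_cell_nonpos:
  assumes "x \<in> D"
  shows "cell h t (c x) \<le> 0"
proof -
  have "cell h t (c x) \<le> (LINT s:{t..<t + h}|lborel. 0)"
    unfolding cell_def using assms cell_subset
    by (intro set_integral_mono c_cell_integrable) (auto simp: set_integrable_def intro: c_nonpos)
  then show ?thesis by (simp add: set_lebesgue_integral_def)
qed

text \<open>The support bound is imposed for every k with x in \<open>Dk k\<close> at once: a fixed
  k gives constants free of n, while k = n controls the jumps of the whole chain.\<close>

definition is_step :: "real^'n \<Rightarrow> ((real^'n \<Rightarrow> real) \<Rightarrow> real) \<Rightarrow> bool" where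
  "is_step x E \<longleftrightarrow> finsupp {v. \<forall>k. x \<in> Dk k \<longrightarrow> (norm v)\<^sup>2 \<le> h * spread k} E \<and> E (\<lambda>v. 1) = 1 \<and>
     (\<forall>i. E (\<lambda>v. v $ i) = cell h t (b i x)) \<and>
     (\<forall>i j. E (\<lambda>v. v $ i * v $ j) = 2 * cell h t (a i j x) + cell h t (b i x) * cell h t (b j x))"

text \<open>Averages of a over a cell inherit symmetry and nonnegativity, so
  \<open>step_functional\<close> applies to them; the averaged drift and trace obey the same local
  bounds as the coefficients.\<close>

lemma step_exists:
  assumes x: "x \<in> D"
  shows "\<exists>E. is_step x E"
proof -
  define A where "A i j = cell h t (a i j x) / h" for i j
  define \<beta> where "\<beta> = (\<chi> i. cell h t (b i x) / h)"
  have sym: "A i j = A j i" for i j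
  proof -
    have "cell h t (a i j x) = cell h t (a j i x)"
      unfolding cell_def using a_sym[OF x] cell_subset by (intro set_lebesgue_integral_cong) auto
    then show ?thesis by (simp add: A_def)
  qed
  have psd: "0 \<le> (\<Sum>i\<in>UNIV. \<Sum>j\<in>UNIV. A i j * y j * y i)" for y
  proof -
    have int: "integrable lborel (\<lambda>s. indicator {t..<t + h} s *\<^sub>R a i j x s)" for i j
      using a_cell_integrable[OF x] unfolding set_integrable_def .
    have "0 \<le> (LINT s:{t..<t + h}|lborel. (\<Sum>i\<in>UNIV. \<Sum>j\<in>UNIV. a i j x s * y j * y i))"
      unfolding set_lebesgue_integral_def
      using a_psd[OF x, of _ "\<chi> i. y i"] cell_subset
      by (intro integral_nonneg_AE AE_I2) (auto simp: indicator_def)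
    also have "(LINT s:{t..<t + h}|lborel. (\<Sum>i\<in>UNIV. \<Sum>j\<in>UNIV. a i j x s * y j * y i))
        = (LINT s|lborel. (\<Sum>i\<in>UNIV. \<Sum>j\<in>UNIV. (indicator {t..<t + h} s *\<^sub>R a i j x s) * (y j * y i)))"
      unfolding set_lebesgue_integral_def by (simp add: sum_distrib_left mult.assoc)
    also have "\<dots> = (\<Sum>i\<in>UNIV. \<Sum>j\<in>UNIV. cell h t (a i j x) * (y j * y i))"
      using int by (simp add: cell_def set_lebesgue_integral_def)
    finally have "0 \<le> (\<Sum>i\<in>UNIV. \<Sum>j\<in>UNIV. cell h t (a i j x) * (y j * y i)) / h" using h by simp
    then show ?thesis by (simp add: A_def sum_divide_distrib mult.assoc)
  qed
  obtain E where E: "finsupp {v. (norm v)\<^sup>2 \<le> 2 * h\<^sup>2 * (norm \<beta>)\<^sup>2 + 4 * h * real CARD('n) * (\<Sum>i\<in>UNIV. A i i)} E"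
    "E (\<lambda>v. 1) = 1" "\<And>i. E (\<lambda>v. v $ i) = h * \<beta> $ i"
    "\<And>i j. E (\<lambda>v. v $ i * v $ j) = 2 * h * A i j + h\<^sup>2 * (\<beta> $ i * \<beta> $ j)"
    by (rule step_functional[of A h \<beta>, OF sym psd less_imp_le[OF h(1)]]) (rule that; assumption)
  have "2 * h\<^sup>2 * (norm \<beta>)\<^sup>2 + 4 * h * real CARD('n) * (\<Sum>i\<in>UNIV. A i i) \<le> h * spread k" if "x \<in> Dk k" for k
  proof -
    have \<beta>: "\<bar>\<beta> $ i\<bar> \<le> bound k" for i
      using b_cell_le[OF that, of i] h by (simp add: \<beta>_def abs_divide field_simps)
    have "(norm \<beta>)\<^sup>2 = (\<Sum>i\<in>UNIV. (\<beta> $ i)\<^sup>2)"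
      by (simp add: norm_vec_def L2_set_def sum_nonneg)
    also have "\<dots> \<le> (\<Sum>i\<in>(UNIV::'n set). (bound k)\<^sup>2)"
      using power_mono[OF \<beta> abs_ge_zero, where n=2] by (intro sum_mono) simp
    finally have 1: "(norm \<beta>)\<^sup>2 \<le> real CARD('n) * (bound k)\<^sup>2" by simp
    have "A i i \<le> bound k" for i
      using a_cell_le[OF that, of i i] h by (simp add: A_def field_simps)
    then have "(\<Sum>i\<in>UNIV. A i i) \<le> (\<Sum>i\<in>(UNIV::'n set). bound k)" by (intro sum_mono)
    then have 2: "(\<Sum>i\<in>UNIV. A i i) \<le> real CARD('n) * bound k" by simp
    have "h\<^sup>2 \<le> h" using h by (simp add: power2_eq_square mult_left_le)
    then have "2 * h\<^sup>2 * (norm \<beta>)\<^sup>2 \<le> 2 * h * (real CARD('n) * (bound k)\<^sup>2)"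
      using 1 h by (intro mult_mono) auto
    moreover have "4 * h * real CARD('n) * (\<Sum>i\<in>UNIV. A i i) \<le> 4 * h * real CARD('n) * (real CARD('n) * bound k)"
      using 2 h by (intro mult_left_mono) auto
    ultimately show ?thesis by (simp add: spread_def algebra_simps power2_eq_square)
  qed
  then have "finsupp {v. \<forall>k. x \<in> Dk k \<longrightarrow> (norm v)\<^sup>2 \<le> h * spread k} E"
    by (intro finsupp_subset[OF E(1)]) (auto intro: order_trans)
  moreover have "h * \<beta> $ i = cell h t (b i x)" "h\<^sup>2 * (\<beta> $ i * \<beta> $ j) = cell h t (b i x) * cell h t (b j x)"
    "2 * h * A i j = 2 * cell h t (a i j x)" for i j
    using h by (auto simp: \<beta>_def A_def power2_eq_square)
  ultimately have "is_step x E" using E by (simp add: is_step_def)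
  then show ?thesis by (rule exI[of "is_step x" E])
qed

end

end

lemma Lop_outside:
  assumes "closed K" "\<And>x. x \<notin> K \<Longrightarrow> \<phi> x = 0" "x \<notin> K"
  shows "Lop a b c \<phi> x s = 0"
proof -
  have 1: "pd i \<phi> x = 0" if "x \<notin> K" for i x
    unfolding pd_def by (rule dirderiv_eq_0[OF assms(1,2) that])
  have "pd i (pd j \<phi>) x = 0" for i j
    unfolding pd_def[of i] by (rule dirderiv_eq_0[OF assms(1) 1 assms(3)])
  then show ?thesis using 1 assms(2,3) by (simp add: Lop_def)
qed

section \<open>Transition kernel and one-step estimates\<close>

context cauchy_data
begin

definition step :: "real \<Rightarrow> real \<Rightarrow> real^'n \<Rightarrow> (real^'n \<Rightarrow> real) \<Rightarrow> real" where
  "step h t x = (SOME E. is_step h t x E)"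

text \<open>\<open>1 + cell h t (c x)\<close> is the first-order survival probability, nonnegative
  once \<open>h * bound n\<close> \<le> 1. The test \<open>t + h \<le> T\<close> freezes the chain
  after its last cell, so that its laws have mass at most 1 after any number of steps.\<close>

definition kernel :: "nat \<Rightarrow> real \<Rightarrow> real \<Rightarrow> real^'n \<Rightarrow> (real^'n \<Rightarrow> real) \<Rightarrow> real" where
  "kernel n h t x f = (if x \<in> Dk n \<and> t + h \<le> T then (1 + cell h t (c x)) * step h t x (\<lambda>v. f (x + v)) else f x)"

lemma spread_ge: "bound k \<le> spread k" "1 \<le> spread k"
proof -
  have "1 \<le> real CARD('n)" by (simp add: Suc_le_eq)
  then have "1 \<le> (real CARD('n))\<^sup>2" by simp
  then have "1 * bound k \<le> (4 * (real CARD('n))\<^sup>2) * bound k"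
    using bound_ge_1[of k] by (intro mult_right_mono) linarith+
  moreover have "0 \<le> 2 * real CARD('n) * (bound k)\<^sup>2" by simp
  ultimately show "bound k \<le> spread k" unfolding spread_def by linarith
  then show "1 \<le> spread k" using bound_ge_1[of k] by linarith
qed

context
  fixes h t :: real
  assumes h: "0 < h" "h \<le> 1" and t: "0 \<le> t" "t + h \<le> T"
begin

lemma
  assumes "x \<in> D"
  shows step_finsupp: "finsupp {v. \<forall>k. x \<in> Dk k \<longrightarrow> (norm v)\<^sup>2 \<le> h * spread k} (step h t x)"
    and step_one: "step h t x (\<lambda>v. 1) = 1"
    and step_mean: "step h t x (\<lambda>v. v $ i) = cell h t (b i x)"
    and step_second: "step h t x (\<lambda>v. v $ i * v $ j) = 2 * cell h t (a i j x) + cell h t (b i x) * cell h t (b j x)"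
proof -
  have "is_step h t x (step h t x)"
    unfolding step_def using step_exists[OF h t assms] by (rule someI_ex)
  then show "finsupp {v. \<forall>k. x \<in> Dk k \<longrightarrow> (norm v)\<^sup>2 \<le> h * spread k} (step h t x)"
    "step h t x (\<lambda>v. 1) = 1" "step h t x (\<lambda>v. v $ i) = cell h t (b i x)"
    "step h t x (\<lambda>v. v $ i * v $ j) = 2 * cell h t (a i j x) + cell h t (b i x) * cell h t (b j x)"
    by (simp_all add: is_step_def[OF h t])
qed

lemma kernel_finsupp:
  assumes "h * bound n \<le> 1"
  shows "finsupp UNIV (kernel n h t x)"
proof (cases "x \<in> Dk n")
  case True
  then have x: "x \<in> D" using Dk_subset_D by blast
  have "0 \<le> 1 + cell h t (c x)" using c_cell_le[OF h t True] assms by linarith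
  then have "finsupp UNIV (\<lambda>f. (1 + cell h t (c x)) * step h t x (\<lambda>v. f (x + v)))"
    by (intro finsupp_times finsupp_map[OF step_finsupp[OF x]]) auto
  then show ?thesis using True t by (simp add: kernel_def[abs_def])
next
  case False
  then show ?thesis using finsupp_point[of 1 x UNIV] by (simp add: kernel_def[abs_def])
qed

lemma kernel_one: "kernel n h t x (\<lambda>y. 1) = (if x \<in> Dk n then 1 + cell h t (c x) else 1)"
  using step_one Dk_subset_D[of n] t by (auto simp: kernel_def)

text \<open>A jump from x in \<open>Dk n\<close> has squared length at most
  \<open>h * spread n\<close>, which is below the square of the margin r, so the new position misses
  \<open>K\<close> as well.\<close>

lemma kernel_far:
  assumes margin: "\<And>x v. x \<notin> Dk k \<Longrightarrow> norm v < r \<Longrightarrow> x + v \<notin> K" and f: "\<And>x. x \<notin> K \<Longrightarrow> f x = 0"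
    and "0 < r" "h * spread n < r\<^sup>2" "x \<notin> Dk k"
  shows "kernel n h t x f = 0" "f x = 0" "x \<notin> K"
proof -
  show K: "x \<notin> K" using margin[of x 0] assms(3,5) by simp
  then show "f x = 0" by (rule f)
  show "kernel n h t x f = 0"
  proof (cases "x \<in> Dk n")
    case True
    then have x: "x \<in> D" using Dk_subset_D by blast
    have "step h t x (\<lambda>v. f (x + v)) = step h t x (\<lambda>v. 0)"
    proof (rule finsupp_cong[OF step_finsupp[OF x]])
      fix v :: "real^'n" assume "v \<in> {v. \<forall>k. x \<in> Dk k \<longrightarrow> (norm v)\<^sup>2 \<le> h * spread k}"
      then have "(norm v)\<^sup>2 < r\<^sup>2" using True assms(4) by force
      then have "norm v < r" using assms(3) by (simp add: power_less_imp_less_base)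
      then show "f (x + v) = 0" using margin assms(5) f by blast
    qed
    then show ?thesis using finsupp_fun_zero[OF step_finsupp[OF x]] by (simp add: kernel_def f K)
  next
    case False
    then show ?thesis by (simp add: kernel_def f K)
  qed
qed

text \<open>The three terms of the bound come from the Taylor remainder, from the drift in the
  linear part and from the killing. Their constants belong to \<open>Dk k\<close>, whatever n
  is.\<close>

lemma kernel_near_C11:
  assumes x: "x \<in> Dk k" and k: "k \<le> n"
    and f: "\<And>x. \<bar>f x\<bar> \<le> C" "norm (g x) \<le> C" "\<And>v. \<bar>f (x + v) - f x - inner (g x) v\<bar> \<le> C * (norm v)\<^sup>2"
  shows "\<bar>kernel n h t x f - f x\<bar> \<le> h * (C * spread k + real CARD('n) * (C * bound k) + bound k * C)"
proof -
  have xn: "x \<in> Dk n" "x \<in> D" using x Dk_mono[OF k] Dk_subset_D by blast+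
  have C: "0 \<le> C" using f(1)[of 0] by linarith
  let ?E = "step h t x"
  note E = step_finsupp[OF xn(2)]
  define R where "R v = f (x + v) - f x - inner (g x) v" for v
  have "\<bar>?E R\<bar> \<le> C * (h * spread k)"
  proof (rule finsupp_abs_const[OF E])
    show "\<bar>R v\<bar> \<le> C * (h * spread k)" if "v \<in> {v. \<forall>k. x \<in> Dk k \<longrightarrow> (norm v)\<^sup>2 \<le> h * spread k}" for v
      using f(3)[of v] mult_left_mono[of "(norm v)\<^sup>2" "h * spread k" C] that x C by (force simp: R_def)
  qed (use step_one[OF xn(2)] C h spread_ge(2)[of k] in auto)
  moreover have lin: "?E (\<lambda>v. inner (g x) v) = (\<Sum>i\<in>UNIV. g x $ i * cell h t (b i x))"
    unfolding inner_vec_def using finsupp_fun_sum[OF E, of "\<lambda>i v. g x $ i * v $ i" UNIV]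
    by (simp add: finsupp_fun_cmult[OF E] step_mean[OF xn(2)])
  moreover have "\<bar>\<Sum>i\<in>UNIV. g x $ i * cell h t (b i x)\<bar> \<le> (\<Sum>i\<in>(UNIV::'n set). C * (h * bound k))"
  proof (rule order_trans[OF sum_abs sum_mono])
    show "\<bar>g x $ i * cell h t (b i x)\<bar> \<le> C * (h * bound k)" for i
      unfolding abs_mult using component_le_norm_cart[of "g x" i] f(2) b_cell_le[OF h t x, of i] C
      by (intro mult_mono) auto
  qed
  moreover have "?E (\<lambda>v. f (x + v)) = ?E R + ?E (\<lambda>v. inner (g x) v) + f x"
  proof -
    have "?E (\<lambda>v. f (x + v)) = ?E (\<lambda>v. (R v + inner (g x) v) + f x)" by (simp add: R_def)
    also have "\<dots> = ?E (\<lambda>v. R v + inner (g x) v) + ?E (\<lambda>v. f x)" by (rule finsupp_fun_add[OF E])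
    also have "\<dots> = ?E R + ?E (\<lambda>v. inner (g x) v) + f x"
      using finsupp_fun_add[OF E, of R "\<lambda>v. inner (g x) v"] finsupp_fun_const[OF E, of "f x"]
        step_one[OF xn(2)] by simp
    finally show ?thesis .
  qed
  ultimately have 1: "\<bar>?E (\<lambda>v. f (x + v)) - f x\<bar> \<le> C * (h * spread k) + real CARD('n) * (C * (h * bound k))"
    by simp
  have "\<bar>?E (\<lambda>v. f (x + v))\<bar> \<le> C"
    by (rule finsupp_abs_const[OF E]) (use step_one[OF xn(2)] C f(1) in auto)
  then have 2: "\<bar>cell h t (c x) * ?E (\<lambda>v. f (x + v))\<bar> \<le> (h * bound k) * C"
    unfolding abs_mult using c_cell_le[OF h t x] C h bound_ge_1[of k] by (intro mult_mono) auto
  have "kernel n h t x f - f x = (?E (\<lambda>v. f (x + v)) - f x) + cell h t (c x) * ?E (\<lambda>v. f (x + v))"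
    using xn t by (simp add: kernel_def algebra_simps)
  then have "\<bar>kernel n h t x f - f x\<bar> \<le> (C * (h * spread k) + real CARD('n) * (C * (h * bound k))) + (h * bound k) * C"
    using 1 2 by linarith
  then show ?thesis by (simp add: algebra_simps)
qed

lemma cell_Lop:
  assumes "x \<in> D"
  shows "cell h t (Lop a b c \<phi> x) = (\<Sum>i\<in>UNIV. \<Sum>j\<in>UNIV. cell h t (a i j x) * pd i (pd j \<phi>) x)
     + (\<Sum>i\<in>UNIV. cell h t (b i x) * pd i \<phi> x) + cell h t (c x) * \<phi> x"
proof -
  have a: "integrable lborel (\<lambda>s. indicator {t..<t + h} s *\<^sub>R a i j x s)" for i j
    using a_cell_integrable[OF h t assms] unfolding set_integrable_def .
  have b: "integrable lborel (\<lambda>s. indicator {t..<t + h} s *\<^sub>R b i x s)" for i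
    using b_cell_integrable[OF h t assms] unfolding set_integrable_def .
  have c: "integrable lborel (\<lambda>s. indicator {t..<t + h} s *\<^sub>R c x s)"
    using c_cell_integrable[OF h t assms] unfolding set_integrable_def .
  have "cell h t (Lop a b c \<phi> x) = (LINT s|lborel.
      (\<Sum>i\<in>UNIV. \<Sum>j\<in>UNIV. (indicator {t..<t + h} s *\<^sub>R a i j x s) * pd i (pd j \<phi>) x)
     + (\<Sum>i\<in>UNIV. (indicator {t..<t + h} s *\<^sub>R b i x s) * pd i \<phi> x)
     + (indicator {t..<t + h} s *\<^sub>R c x s) * \<phi> x)"
    unfolding cell_def set_lebesgue_integral_def Lop_def
    by (simp add: distrib_left sum_distrib_left mult.assoc)
  also have "\<dots> = (\<Sum>i\<in>UNIV. \<Sum>j\<in>UNIV. cell h t (a i j x) * pd i (pd j \<phi>) x)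
     + (\<Sum>i\<in>UNIV. cell h t (b i x) * pd i \<phi> x) + cell h t (c x) * \<phi> x"
    using a b c by (simp add: cell_def set_lebesgue_integral_def)
  finally show ?thesis .
qed

text \<open>The first and second moments of a step reproduce the cell integral of \<open>Lop\<close>
  up to three errors: the Taylor remainder, of size e h; the squared drift \<open>qb\<close>, of
  order h^2; and the product of the killing with the jump terms, whose size is again of order
  h^2.\<close>

lemma kernel_near_taylor:
  assumes x: "x \<in> Dk k" and k: "k \<le> n"
    and C: "\<And>i. \<bar>pd i \<phi> x\<bar> \<le> C" "\<And>i j. \<bar>pd i (pd j \<phi>) x\<bar> \<le> C"
    and taylor: "\<And>v. norm v < \<delta> \<Longrightarrow> \<bar>\<phi> (x + v) - \<phi> x - (\<Sum>i\<in>UNIV. v $ i * pd i \<phi> x)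
        - (\<Sum>i\<in>UNIV. \<Sum>j\<in>UNIV. v $ i * v $ j * pd i (pd j \<phi>) x) / 2\<bar> \<le> e * (norm v)\<^sup>2"
    and \<delta>: "0 < \<delta>" "h * spread k < \<delta>\<^sup>2" and e: "0 < e" "e \<le> 1"
  defines "d \<equiv> real CARD('n)" and "M \<equiv> bound k"
  shows "\<bar>kernel n h t x \<phi> - \<phi> x - cell h t (Lop a b c \<phi> x)\<bar>
    \<le> h * (e * spread k + h * (d * d * C * M * M + M * (d * C * M + d * d * C * M + d * d * C * M * M + spread k)))"
proof -
  have xn: "x \<in> Dk n" "x \<in> D" using x Dk_mono[OF k] Dk_subset_D by blast+
  have C0: "0 \<le> C" using C(1) by (meson abs_ge_zero order_trans)
  have M: "1 \<le> M" unfolding M_def by (rule bound_ge_1)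
  let ?E = "step h t x"
  note E = step_finsupp[OF xn(2)]
  define lin where "lin = (\<Sum>i\<in>UNIV. cell h t (b i x) * pd i \<phi> x)"
  define quad where "quad = (\<Sum>i\<in>UNIV. \<Sum>j\<in>UNIV. cell h t (a i j x) * pd i (pd j \<phi>) x)"
  define qb where "qb = (\<Sum>i\<in>UNIV. \<Sum>j\<in>UNIV. (cell h t (b i x) * cell h t (b j x)) * pd i (pd j \<phi>) x) / 2"
  define \<gamma> where "\<gamma> = cell h t (c x)"
  define R where "R v = \<phi> (x + v) - \<phi> x - (\<Sum>i\<in>UNIV. v $ i * pd i \<phi> x)
        - (\<Sum>i\<in>UNIV. \<Sum>j\<in>UNIV. v $ i * v $ j * pd i (pd j \<phi>) x) / 2" for v
  define r where "r = ?E R"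
  have r: "\<bar>r\<bar> \<le> e * (h * spread k)"
    unfolding r_def
  proof (rule finsupp_abs_const[OF E])
    show "\<bar>R v\<bar> \<le> e * (h * spread k)" if "v \<in> {v. \<forall>k. x \<in> Dk k \<longrightarrow> (norm v)\<^sup>2 \<le> h * spread k}" for v
    proof -
      have v: "(norm v)\<^sup>2 \<le> h * spread k" using that x by blast
      then have "(norm v)\<^sup>2 < \<delta>\<^sup>2" using \<delta>(2) by linarith
      then have "norm v < \<delta>" using \<delta>(1) by (simp add: power_less_imp_less_base)
      then have "\<bar>R v\<bar> \<le> e * (norm v)\<^sup>2" unfolding R_def by (rule taylor)
      also have "\<dots> \<le> e * (h * spread k)" using v e by (intro mult_left_mono) auto
      finally show ?thesis .
    qed
  qed (use step_one[OF xn(2)] e h spread_ge(2)[of k] in auto)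
  have E_eq: "?E (\<lambda>v. \<phi> (x + v)) = \<phi> x + lin + (quad + qb) + r"
  proof -
    have l: "?E (\<lambda>v. \<Sum>i\<in>UNIV. v $ i * pd i \<phi> x) = lin"
    proof -
      have "?E (\<lambda>v. \<Sum>i\<in>UNIV. v $ i * pd i \<phi> x) = ?E (\<lambda>v. \<Sum>i\<in>UNIV. pd i \<phi> x * v $ i)"
        by (simp add: mult.commute)
      also have "\<dots> = (\<Sum>i\<in>UNIV. ?E (\<lambda>v. pd i \<phi> x * v $ i))"
        by (rule finsupp_fun_sum[OF E])
      also have "\<dots> = (\<Sum>i\<in>UNIV. pd i \<phi> x * cell h t (b i x))"
        by (simp add: finsupp_fun_cmult[OF E] step_mean[OF xn(2)])
      also have "\<dots> = lin"
        by (simp add: lin_def mult.commute)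
      finally show ?thesis .
    qed
    have q: "?E (\<lambda>v. \<Sum>i\<in>UNIV. \<Sum>j\<in>UNIV. v $ i * v $ j * pd i (pd j \<phi>) x) = 2 * quad + 2 * qb"
    proof -
      have "?E (\<lambda>v. \<Sum>i\<in>UNIV. \<Sum>j\<in>UNIV. v $ i * v $ j * pd i (pd j \<phi>) x)
          = ?E (\<lambda>v. \<Sum>i\<in>UNIV. \<Sum>j\<in>UNIV. pd i (pd j \<phi>) x * (v $ i * v $ j))"
        by (simp add: mult.commute)
      also have "\<dots> = (\<Sum>i\<in>UNIV. ?E (\<lambda>v. \<Sum>j\<in>UNIV. pd i (pd j \<phi>) x * (v $ i * v $ j)))"
        by (rule finsupp_fun_sum[OF E])
      also have "\<dots> = (\<Sum>i\<in>UNIV. \<Sum>j\<in>UNIV. ?E (\<lambda>v. pd i (pd j \<phi>) x * (v $ i * v $ j)))"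
        by (intro sum.cong refl finsupp_fun_sum[OF E])
      also have "\<dots> = (\<Sum>i\<in>UNIV. \<Sum>j\<in>UNIV. 2 * (cell h t (a i j x) * pd i (pd j \<phi>) x)
          + (cell h t (b i x) * cell h t (b j x)) * pd i (pd j \<phi>) x)"
        by (intro sum.cong refl) (simp add: finsupp_fun_cmult[OF E] step_second[OF xn(2)], simp add: algebra_simps)
      also have "\<dots> = 2 * quad + 2 * qb"
        by (simp add: quad_def qb_def sum.distrib flip: sum_distrib_left)
      finally show ?thesis .
    qed
    define f1 where "f1 v = (\<Sum>i\<in>UNIV. v $ i * pd i \<phi> x)" for v :: "real^'n"
    define f2 where "f2 v = (\<Sum>i\<in>UNIV. \<Sum>j\<in>UNIV. v $ i * v $ j * pd i (pd j \<phi>) x)" for v :: "real^'n"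
    have "?E (\<lambda>v. \<phi> (x + v)) = ?E (\<lambda>v. ((\<phi> x + f1 v) + (1/2) * f2 v) + R v)"
      by (simp add: R_def f1_def f2_def)
    also have "\<dots> = ?E (\<lambda>v. (\<phi> x + f1 v) + (1/2) * f2 v) + ?E R" by (rule finsupp_fun_add[OF E])
    also have "?E (\<lambda>v. (\<phi> x + f1 v) + (1/2) * f2 v) = ?E (\<lambda>v. \<phi> x + f1 v) + ?E (\<lambda>v. (1/2) * f2 v)"
      by (rule finsupp_fun_add[OF E])
    also have "?E (\<lambda>v. \<phi> x + f1 v) = ?E (\<lambda>v. \<phi> x) + ?E f1" by (rule finsupp_fun_add[OF E])
    also have "?E (\<lambda>v. \<phi> x) = \<phi> x" using finsupp_fun_const[OF E, of "\<phi> x"] step_one[OF xn(2)] by simp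
    also have "?E (\<lambda>v. (1/2) * f2 v) = (1/2) * ?E f2" by (rule finsupp_fun_cmult[OF E])
    also have "?E f1 = lin" unfolding f1_def[abs_def] by (rule l)
    also have "?E f2 = 2 * quad + 2 * qb" unfolding f2_def[abs_def] by (rule q)
    finally show ?thesis by (simp add: r_def)
  qed
  have hM: "0 \<le> h * M" using h M by simp
  have \<gamma>: "\<bar>\<gamma>\<bar> \<le> h * M" unfolding \<gamma>_def M_def by (rule c_cell_le[OF h t x])
  have lin: "\<bar>lin\<bar> \<le> d * (h * M * C)"
  proof -
    have "\<bar>lin\<bar> \<le> (\<Sum>i\<in>(UNIV::'n set). h * M * C)"
      unfolding lin_def
    proof (rule order_trans[OF sum_abs sum_mono])
      show "\<bar>cell h t (b i x) * pd i \<phi> x\<bar> \<le> h * M * C" for i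
        unfolding abs_mult using b_cell_le[OF h t x, of i] C(1)[of i] hM by (intro mult_mono) (auto simp: M_def)
    qed
    then show ?thesis by (simp add: d_def)
  qed
  have quad: "\<bar>quad\<bar> \<le> d * d * (h * M * C)"
  proof -
    have "\<bar>quad\<bar> \<le> (\<Sum>i\<in>(UNIV::'n set). \<Sum>j\<in>(UNIV::'n set). h * M * C)"
      unfolding quad_def
    proof (rule order_trans[OF sum_abs sum_mono[OF order_trans[OF sum_abs sum_mono]]])
      show "\<bar>cell h t (a i j x) * pd i (pd j \<phi>) x\<bar> \<le> h * M * C" for i j
        unfolding abs_mult using a_cell_le[OF h t x, of i j] C(2)[of i j] hM by (intro mult_mono) (auto simp: M_def)
    qed
    then show ?thesis by (simp add: d_def)
  qed
  have qb: "\<bar>qb\<bar> \<le> d * d * (h * M * (h * M) * C)"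
  proof -
    have "\<bar>2 * qb\<bar> \<le> (\<Sum>i\<in>(UNIV::'n set). \<Sum>j\<in>(UNIV::'n set). h * M * (h * M) * C)"
      unfolding qb_def times_divide_eq_right nonzero_mult_div_cancel_left[OF zero_neq_numeral[symmetric]]
    proof (rule order_trans[OF sum_abs sum_mono[OF order_trans[OF sum_abs sum_mono]]])
      show "\<bar>(cell h t (b i x) * cell h t (b j x)) * pd i (pd j \<phi>) x\<bar> \<le> h * M * (h * M) * C" for i j
        unfolding abs_mult using b_cell_le[OF h t x] C(2)[of i j] hM by (intro mult_mono) (auto simp: M_def)
    qed
    then show ?thesis by (simp add: d_def)
  qed
  \<comment> \<open>One of the two factors h is given up, using h \<le> 1, so that all terms of
    \<open>W\<close> become linear in h.\<close>
  have "h * M * (h * M) * C \<le> h * M * M * C"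
  proof -
    have "h * (M * (h * M) * C) \<le> h * (M * (1 * M) * C)"
      using h M C0 by (intro mult_left_mono mult_right_mono) auto
    then show ?thesis by (simp add: mult.assoc)
  qed
  moreover have dd: "0 \<le> d * d" by simp
  ultimately have qb': "\<bar>qb\<bar> \<le> d * d * (h * M * M * C)"
    using qb mult_left_mono[of "h * M * (h * M) * C" "h * M * M * C" "d * d"] by linarith
  have r': "\<bar>r\<bar> \<le> h * spread k"
  proof -
    have "0 \<le> h * spread k" using h spread_ge(2)[of k] by simp
    from mult_right_mono[OF e(2) this] show ?thesis using r by linarith
  qed
  have eq: "kernel n h t x \<phi> - \<phi> x - cell h t (Lop a b c \<phi> x) = qb + r + \<gamma> * (lin + quad + qb + r)"
  proof -
    have "kernel n h t x \<phi> = (1 + \<gamma>) * (\<phi> x + lin + (quad + qb) + r)"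
      using xn t E_eq by (simp add: kernel_def \<gamma>_def)
    moreover have "cell h t (Lop a b c \<phi> x) = quad + lin + \<gamma> * \<phi> x"
      unfolding cell_Lop[OF xn(2)] quad_def lin_def \<gamma>_def ..
    ultimately show ?thesis by (simp add: algebra_simps)
  qed
  define W where "W = d * (h * M * C) + d * d * (h * M * C) + d * d * (h * M * M * C) + h * spread k"
  have "\<bar>lin + quad + qb + r\<bar> \<le> W" using lin quad qb' r' unfolding W_def by linarith
  then have "\<bar>\<gamma> * (lin + quad + qb + r)\<bar> \<le> (h * M) * W"
    unfolding abs_mult using \<gamma> hM by (intro mult_mono) auto
  then have "\<bar>kernel n h t x \<phi> - \<phi> x - cell h t (Lop a b c \<phi> x)\<bar>
      \<le> d * d * (h * M * (h * M) * C) + e * (h * spread k) + (h * M) * W"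
    unfolding eq using qb r by linarith
  also have "\<dots> = h * (e * spread k + h * (d * d * C * M * M + M * (d * C * M + d * d * C * M + d * d * C * M * M + spread k)))"
    unfolding W_def by (simp add: algebra_simps)
  finally show ?thesis .
qed

end


text \<open>Enough cells for \<open>mesh n * spread n\<close> \<le> 1/(n+1): jumps shrink even if
  the bounds on \<open>Dk n\<close> blow up with n. The successor keeps the number of cells
  positive.\<close>

definition steps :: "nat \<Rightarrow> nat" where
  "steps n = Suc (nat \<lceil>T * spread n * real (Suc n)\<rceil>)"

definition mesh :: "nat \<Rightarrow> real" where
  "mesh n = T / real (steps n)"

lemma mesh_pos: "0 < mesh n"
  using T by (simp add: mesh_def steps_def)

lemma mesh_steps: "real (steps n) * mesh n = T"
  by (simp add: mesh_def steps_def)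

lemma mesh_spread: "mesh n * spread n \<le> 1 / real (Suc n)"
proof -
  have "T * spread n * real (Suc n) \<le> real (steps n)"
    unfolding steps_def using real_nat_ceiling_ge[of "T * spread n * real (Suc n)"] by linarith
  moreover have "0 < real (steps n)" by (simp add: steps_def)
  ultimately show ?thesis by (simp add: mesh_def field_simps)
qed

lemma mesh_bound: "mesh n * bound n \<le> 1"
proof -
  have "mesh n * bound n \<le> mesh n * spread n"
    using spread_ge(1) mesh_pos by (intro mult_left_mono) (auto intro: less_imp_le)
  also have "\<dots> \<le> 1" using mesh_spread[of n] by (rule order_trans) simp
  finally show ?thesis .
qed

lemma mesh_le: "mesh n \<le> 1 / real (Suc n)"
proof -
  have "mesh n * 1 \<le> mesh n * spread n"
    using spread_ge(2) mesh_pos by (intro mult_left_mono) (auto intro: less_imp_le)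
  then show ?thesis using mesh_spread[of n] by linarith
qed

lemma mesh_le_1: "mesh n \<le> 1"
  using mesh_le[of n] by (rule order_trans) simp

lemma mesh_tendsto: "mesh \<longlonglongrightarrow> 0"
  by (rule tendsto_sandwich[of "\<lambda>n. 0" _ _ "\<lambda>n. 1 / real (Suc n)"])
     (use mesh_pos mesh_le lim_1_over_n[THEN LIMSEQ_Suc] in \<open>auto intro!: always_eventually less_imp_le\<close>)

lemma mesh_spread_small:
  assumes "0 < e"
  shows "\<exists>n0. \<forall>n\<ge>n0. mesh n * spread n < e"
proof -
  obtain n0 where n0: "1 / real (Suc n0) < e" using nat_approx_posE[OF assms] by metis
  have "mesh n * spread n < e" if "n \<ge> n0" for n
  proof -
    have "1 / real (Suc n) \<le> 1 / real (Suc n0)" using that by (simp add: frac_le)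
    then show ?thesis using mesh_spread[of n] n0 by linarith
  qed
  then show ?thesis by blast
qed

lemma mesh_small: "0 < e \<Longrightarrow> \<exists>n0. \<forall>n\<ge>n0. mesh n < e"
  using order_tendstoD(2)[OF mesh_tendsto] by (simp add: eventually_sequentially)

lemma grid_nonneg: "0 \<le> real m * mesh n"
  using mesh_pos[of n] by simp

lemma grid_le:
  assumes "m < steps n"
  shows "0 \<le> real m * mesh n" "real m * mesh n + mesh n \<le> T"
proof -
  show "0 \<le> real m * mesh n" using mesh_pos[of n] by simp
  have "real (Suc m) * mesh n \<le> real (steps n) * mesh n"
    using assms mesh_pos[of n] by (intro mult_right_mono) auto
  then show "real m * mesh n + mesh n \<le> T" unfolding mesh_steps by (simp add: algebra_simps)
qed

section \<open>Laws of the Euler chain and their consistency with the equation\<close>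

definition init :: "nat \<Rightarrow> (real^'n \<Rightarrow> real) \<Rightarrow> real" where
  "init = (SOME L. (\<forall>n. finsupp UNIV (L n)) \<and> (\<forall>n. L n (\<lambda>x. 1) = 1) \<and>
     (\<forall>f B. continuous_on UNIV f \<longrightarrow> (\<forall>x. \<bar>f x\<bar> \<le> B) \<longrightarrow> (\<lambda>n. L n f) \<longlonglongrightarrow> integral\<^sup>L \<nu> f))"

lemma
  shows init_finsupp: "finsupp UNIV (init n)"
    and init_one: "init n (\<lambda>x. 1) = 1"
    and init_tendsto: "continuous_on UNIV f \<Longrightarrow> (\<And>x. \<bar>f x\<bar> \<le> B) \<Longrightarrow> (\<lambda>n. init n f) \<longlonglongrightarrow> integral\<^sup>L \<nu> f"
proof -
  from someI_ex[OF prob_finsupp_approx[OF \<nu>_prob \<nu>_sets], folded init_def]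
  show "finsupp UNIV (init n)" "init n (\<lambda>x. 1) = 1"
    "continuous_on UNIV f \<Longrightarrow> (\<And>x. \<bar>f x\<bar> \<le> B) \<Longrightarrow> (\<lambda>n. init n f) \<longlonglongrightarrow> integral\<^sup>L \<nu> f"
    by blast+
qed

text \<open>Laws act on functions, so the newest kernel is innermost: the transition transforms f,
  and the previous law is evaluated on the result.\<close>

primrec euler :: "nat \<Rightarrow> nat \<Rightarrow> (real^'n \<Rightarrow> real) \<Rightarrow> real" where
  "euler n 0 = init n"
| "euler n (Suc m) = (\<lambda>f. euler n m (\<lambda>x. kernel n (mesh n) (real m * mesh n) x f))"

lemma euler_finsupp: "finsupp UNIV (euler n m)"
proof (induction m)
  case 0
  show ?case using init_finsupp by simp
next
  case (Suc m)
  have "finsupp UNIV (kernel n (mesh n) (real m * mesh n) x)" for x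
  proof (cases "real m * mesh n + mesh n \<le> T")
    case True
    then show ?thesis
      using mesh_pos mesh_le_1 mesh_bound grid_nonneg by (intro kernel_finsupp) (auto intro: less_imp_le)
  next
    case False
    then show ?thesis using finsupp_point[of 1 x UNIV] by (simp add: kernel_def[abs_def])
  qed
  from finsupp_bind[OF Suc.IH this] show ?case by simp
qed

lemma euler_diff_le:
  assumes "\<And>x. \<bar>kernel n (mesh n) (real m * mesh n) x f - g x\<bar> \<le> B" "euler n m (\<lambda>x. 1) \<le> 1" "0 \<le> B"
  shows "\<bar>euler n (Suc m) f - euler n m g\<bar> \<le> B"
proof -
  have "euler n (Suc m) f - euler n m g = euler n m (\<lambda>x. kernel n (mesh n) (real m * mesh n) x f - g x)"
    using finsupp_fun_diff[OF euler_finsupp] by simp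
  then show ?thesis
    using finsupp_abs_const[OF euler_finsupp assms(2,3), of "\<lambda>x. kernel n (mesh n) (real m * mesh n) x f - g x"] assms(1)
    by simp
qed

lemma euler_one_le: "euler n m (\<lambda>x. 1) \<le> 1"
proof (induction m)
  case 0
  show ?case using init_one by simp
next
  case (Suc m)
  have "kernel n (mesh n) (real m * mesh n) x (\<lambda>x. 1) \<le> 1" for x
  proof (cases "x \<in> Dk n \<and> real m * mesh n + mesh n \<le> T")
    case True
    then have "x \<in> D" using Dk_subset_D by blast
    then have "cell (mesh n) (real m * mesh n) (c x) \<le> 0"
      using True mesh_pos mesh_le_1 grid_nonneg by (intro c_cell_nonpos) (auto intro: less_imp_le)
    then show ?thesis
      using True by (simp add: kernel_one[OF mesh_pos mesh_le_1 grid_nonneg])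
  qed (auto simp: kernel_def)
  then have "euler n (Suc m) (\<lambda>x. 1) \<le> euler n m (\<lambda>x. 1)"
    using finsupp_mono[OF euler_finsupp[of n m], of "\<lambda>x. kernel n (mesh n) (real m * mesh n) x (\<lambda>x. 1)" "\<lambda>x. 1"] by simp
  then show ?case using Suc.IH by linarith
qed

text \<open>Inside \<open>Dk k\<close> the C11 estimate applies; outside, f vanishes before and
  after the step. As C depends on neither n nor m, this is the source of equicontinuity in
  time.\<close>

lemma euler_C11:
  assumes f: "f \<in> Cc D" "C11 f"
  shows "\<exists>C n0. 0 \<le> C \<and> (\<forall>n\<ge>n0. \<forall>m<steps n. \<bar>euler n (Suc m) f - euler n m f\<bar> \<le> C * mesh n)"
proof -
  obtain K where K: "compact K" "K \<subseteq> D" "\<And>x. x \<notin> K \<Longrightarrow> f x = 0" using Cc_support[OF f(1)] by auto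
  obtain k r where kr: "0 < r" "\<And>x v. x \<notin> Dk k \<Longrightarrow> norm v < r \<Longrightarrow> x + v \<notin> K"
    using compact_margin[OF K(1,2)] by auto
  obtain g C where g: "\<And>x. \<bar>f x\<bar> \<le> C" "\<And>x. norm (g x) \<le> C"
      "\<And>x v. \<bar>f (x + v) - f x - inner (g x) v\<bar> \<le> C * (norm v)\<^sup>2"
    using f(2) unfolding C11_def by auto
  obtain n1 where n1: "\<And>n. n \<ge> n1 \<Longrightarrow> mesh n * spread n < r\<^sup>2"
    using mesh_spread_small[of "r\<^sup>2"] kr(1) by auto
  define B where "B = C * spread k + real CARD('n) * (C * bound k) + bound k * C"
  have C: "0 \<le> C" using g(1)[of 0] by linarith
  have B: "0 \<le> B" using C bound_ge_1[of k] spread_ge(2)[of k] by (simp add: B_def)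
  have "\<bar>euler n (Suc m) f - euler n m f\<bar> \<le> B * mesh n" if n: "n \<ge> max n1 k" and m: "m < steps n" for n m
  proof (rule euler_diff_le[OF _ euler_one_le])
    note grid = mesh_pos mesh_le_1 grid_le[OF m]
    show "\<bar>kernel n (mesh n) (real m * mesh n) x f - f x\<bar> \<le> B * mesh n" for x
    proof (cases "x \<in> Dk k")
      case True
      then show ?thesis
        using kernel_near_C11[where f=f and g=g and C=C and n=n, OF grid True _ g] n by (simp add: B_def mult.commute)
    next
      case False
      have "mesh n * spread n < r\<^sup>2" using n1 n by simp
      from kernel_far(1,2)[where f=f, OF grid kr(2) K(3) kr(1) this False]
      show ?thesis using B mesh_pos[of n] by simp
    qed
    show "0 \<le> B * mesh n" using B mesh_pos[of n] by simp
  qed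
  then show ?thesis using B by blast
qed

text \<open>One-step consistency: the error is o(h) uniformly in m, so the errors of all steps up to
  time T still sum to o(1).\<close>

lemma euler_taylor:
  assumes \<phi>: "test_fun D \<phi>" and \<eta>: "0 < \<eta>"
  shows "\<exists>n0. \<forall>n\<ge>n0. \<forall>m<steps n. \<bar>euler n (Suc m) \<phi> - euler n m \<phi>
    - euler n m (\<lambda>x. cell (mesh n) (real m * mesh n) (Lop a b c \<phi> x))\<bar> \<le> \<eta> * mesh n"
proof -
  note T = test_fun_taylor[OF \<phi>]
  obtain K where K: "compact K" "K \<subseteq> D" "\<And>x. x \<notin> K \<Longrightarrow> \<phi> x = 0" using Cc_support[OF T(1)] by auto
  obtain k r where kr: "0 < r" "\<And>x v. x \<notin> Dk k \<Longrightarrow> norm v < r \<Longrightarrow> x + v \<notin> K"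
    using compact_margin[OF K(1,2)] by auto
  have "\<forall>i. \<exists>B. \<forall>x. \<bar>pd i \<phi> x\<bar> \<le> B" using Cc_bounded[OF T(2)] by metis
  then obtain B1 where B1: "\<And>i x. \<bar>pd i \<phi> x\<bar> \<le> B1 i" by metis
  have "\<forall>i j. \<exists>B. \<forall>x. \<bar>pd i (pd j \<phi>) x\<bar> \<le> B" using Cc_bounded[OF T(3)] by metis
  then obtain B2 where B2: "\<And>i j x. \<bar>pd i (pd j \<phi>) x\<bar> \<le> B2 i j" by metis
  define C where "C = Max (range B1 \<union> range (\<lambda>(i, j). B2 i j))"
  have C1: "\<bar>pd i \<phi> x\<bar> \<le> C" for i x
    by (rule order_trans[OF B1]) (auto simp: C_def intro!: Max_ge)
  have C2: "\<bar>pd i (pd j \<phi>) x\<bar> \<le> C" for i j x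
    by (rule order_trans[OF B2]) (auto simp: C_def intro!: Max_ge image_eqI[of _ _ "(i, j)"])
  define d M W where "d = real CARD('n)" and "M = bound k"
    and "W = d * d * C * M * M + M * (d * C * M + d * d * C * M + d * d * C * M * M + spread k)"
  have C0: "0 \<le> C" using C1 by (meson abs_ge_zero order_trans)
  have W: "0 \<le> W" unfolding W_def using C0 bound_ge_1[of k] spread_ge(2)[of k] by (simp add: M_def d_def)
  \<comment> \<open>Half of \<eta> pays for the Taylor remainder, the other half for the terms of
    order h^2 through \<open>mesh n * W\<close>.\<close>
  define e where "e = min 1 (\<eta> / (2 * spread k))"
  have sp: "1 \<le> spread k" by (rule spread_ge)
  have e: "0 < e" "e \<le> 1" using \<eta> sp by (auto simp: e_def)
  have es: "e * spread k \<le> \<eta> / 2"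
  proof -
    have "e * spread k \<le> \<eta> / (2 * spread k) * spread k" using sp by (intro mult_right_mono) (auto simp: e_def)
    then show ?thesis using sp by simp
  qed
  obtain \<delta> where \<delta>: "0 < \<delta>" "\<And>x v. norm v < \<delta> \<Longrightarrow> \<bar>\<phi> (x + v) - \<phi> x - (\<Sum>i\<in>UNIV. v $ i * pd i \<phi> x)
        - (\<Sum>i\<in>UNIV. \<Sum>j\<in>UNIV. v $ i * v $ j * pd i (pd j \<phi>) x) / 2\<bar> \<le> e * (norm v)\<^sup>2"
    using T(4)[OF e(1)] by auto
  obtain n1 where n1: "\<And>n. n \<ge> n1 \<Longrightarrow> mesh n * spread n < r\<^sup>2"
    using mesh_spread_small[of "r\<^sup>2"] kr(1) by auto
  obtain n2 where n2: "\<And>n. n \<ge> n2 \<Longrightarrow> mesh n < \<delta>\<^sup>2 / spread k"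
    using mesh_small[of "\<delta>\<^sup>2 / spread k"] \<delta>(1) sp by auto
  obtain n3 where n3: "\<And>n. n \<ge> n3 \<Longrightarrow> mesh n < \<eta> / (2 * (W + 1))"
    using mesh_small[of "\<eta> / (2 * (W + 1))"] \<eta> W by auto
  have "\<bar>euler n (Suc m) \<phi> - euler n m \<phi>
      - euler n m (\<lambda>x. cell (mesh n) (real m * mesh n) (Lop a b c \<phi> x))\<bar> \<le> \<eta> * mesh n"
    if n: "n \<ge> max (max n1 n2) (max n3 k)" and m: "m < steps n" for n m
  proof -
    note grid = mesh_pos mesh_le_1 grid_le[OF m]
    let ?cell = "\<lambda>x. cell (mesh n) (real m * mesh n) (Lop a b c \<phi> x)"
    have "\<bar>kernel n (mesh n) (real m * mesh n) x \<phi> - (\<phi> x + ?cell x)\<bar> \<le> \<eta> * mesh n" for x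
    proof (cases "x \<in> Dk k")
      case True
      have "mesh n * spread k < \<delta>\<^sup>2" using n2[of n] n sp by (simp add: field_simps)
      moreover have "k \<le> n" using n by simp
      ultimately have "\<bar>kernel n (mesh n) (real m * mesh n) x \<phi> - \<phi> x - ?cell x\<bar> \<le> mesh n * (e * spread k + mesh n * W)"
        unfolding W_def d_def M_def
        using kernel_near_taylor[OF grid True _ C1 C2 \<delta>(2) \<delta>(1) _ e] by blast
      also have "mesh n * W \<le> \<eta> / 2"
      proof -
        have "mesh n * W \<le> mesh n * (W + 1)" using mesh_pos[of n] by (simp add: mult_left_mono)
        also have "\<dots> \<le> \<eta> / (2 * (W + 1)) * (W + 1)"
          using n3[of n] n W by (intro mult_right_mono) auto
        also have "\<dots> = \<eta> / 2" using W by (simp add: field_simps)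
        finally show ?thesis .
      qed
      then have "mesh n * (e * spread k + mesh n * W) \<le> mesh n * \<eta>"
        using es mesh_pos[of n] by (intro mult_left_mono) auto
      finally show ?thesis by (simp add: mult.commute diff_diff_eq)
    next
      case False
      have s: "mesh n * spread n < r\<^sup>2" using n1 n by simp
      note far = kernel_far[where f=\<phi>, OF grid kr(2) K(3) kr(1) s False]
      have "?cell x = 0"
        using Lop_outside[of K \<phi> x a b c, OF compact_imp_closed[OF K(1)] K(3) far(3)]
        by (simp add: cell_def set_lebesgue_integral_def)
      then show ?thesis using far \<eta> mesh_pos[of n] by simp
    qed
    then have "\<bar>euler n (Suc m) \<phi> - euler n m (\<lambda>x. \<phi> x + ?cell x)\<bar> \<le> \<eta> * mesh n"
      by (rule euler_diff_le[OF _ euler_one_le]) (use \<eta> mesh_pos[of n] in simp)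
    then show ?thesis
      unfolding finsupp_fun_add[OF euler_finsupp] by (simp add: diff_diff_eq)
  qed
  then show ?thesis by blast
qed

text \<open>The chain loses mass at the full rate -c on \<open>Dk n\<close>. As c \<le> 0 and \<psi>
  \<le> 1, replacing c by \<psi> c only weakens the bound, but it makes the integrand compactly
  supported in \<open>D\<close> and thus accessible to vague limits.\<close>

lemma euler_mass:
  assumes \<psi>: "\<psi> \<in> Cc D" "\<And>x. 0 \<le> \<psi> x" "\<And>x. \<psi> x \<le> 1"
  shows "\<exists>n0. \<forall>n\<ge>n0. \<forall>m<steps n. euler n (Suc m) (\<lambda>x. 1)
    \<le> euler n m (\<lambda>x. 1) + euler n m (\<lambda>x. cell (mesh n) (real m * mesh n) (\<lambda>s. \<psi> x * c x s))"
proof -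
  obtain K where K: "compact K" "K \<subseteq> D" "\<And>x. x \<notin> K \<Longrightarrow> \<psi> x = 0" using Cc_support[OF \<psi>(1)] by auto
  obtain k where k: "K \<subseteq> Dk k" using compact_subset_Dk[OF K(1,2)] by blast
  have "euler n (Suc m) (\<lambda>x. 1)
      \<le> euler n m (\<lambda>x. 1) + euler n m (\<lambda>x. cell (mesh n) (real m * mesh n) (\<lambda>s. \<psi> x * c x s))"
    if n: "n \<ge> k" and m: "m < steps n" for n m
  proof -
    note grid = mesh_pos mesh_le_1 grid_le[OF m]
    have cell: "cell (mesh n) (real m * mesh n) (\<lambda>s. \<psi> x * c x s) = \<psi> x * cell (mesh n) (real m * mesh n) (c x)" for x
      by (simp add: cell_def)
    have "kernel n (mesh n) (real m * mesh n) x (\<lambda>x. 1)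
        \<le> 1 + cell (mesh n) (real m * mesh n) (\<lambda>s. \<psi> x * c x s)" for x
    proof (cases "x \<in> Dk n")
      case True
      then have "x \<in> D" using Dk_subset_D by blast
      then have "cell (mesh n) (real m * mesh n) (c x) \<le> 0" by (rule c_cell_nonpos[OF grid])
      then have "1 * cell (mesh n) (real m * mesh n) (c x) \<le> \<psi> x * cell (mesh n) (real m * mesh n) (c x)"
        using \<psi>(3) by (intro mult_right_mono_neg)
      then show ?thesis using True kernel_one[OF grid] by (simp add: cell)
    next
      case False
      then have "\<psi> x = 0" using k K(3) Dk_mono[OF n] by blast
      then show ?thesis using False kernel_one[OF grid] cell[of x] by simp
    qed
    then have "euler n (Suc m) (\<lambda>x. 1) \<le> euler n m (\<lambda>x. 1 + cell (mesh n) (real m * mesh n) (\<lambda>s. \<psi> x * c x s))"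
      using finsupp_mono[OF euler_finsupp[of n m]] by simp
    then show ?thesis unfolding finsupp_fun_add[OF euler_finsupp] .
  qed
  then show ?thesis by blast
qed

end

section \<open>Compactness of the scheme\<close>

lemma diagonal_convergent:
  fixes f :: "'i::countable \<Rightarrow> nat \<Rightarrow> real"
  assumes "\<And>i. bounded (range (f i))"
  shows "\<exists>r. strict_mono (r :: nat \<Rightarrow> nat) \<and> (\<forall>i. convergent (\<lambda>j. f i (r j)))"
proof -
  define P where "P n s \<longleftrightarrow> convergent (\<lambda>j. f (from_nat n) (s j))" for n and s :: "nat \<Rightarrow> nat"
  interpret subseqs P
  proof
    fix n and s :: "nat \<Rightarrow> nat" assume "strict_mono s"
    have "bounded (range (\<lambda>j. f (from_nat n) (s j)))"
      by (rule bounded_subset[OF assms[of "from_nat n"]]) auto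
    from bounded_imp_convergent_subsequence[OF this]
    obtain l q where "strict_mono q" "((\<lambda>j. f (from_nat n) (s j)) \<circ> q) \<longlonglongrightarrow> l" by auto
    then show "\<exists>q. strict_mono q \<and> P n (s \<circ> q)"
      by (auto simp: P_def convergent_def comp_def)
  qed
  have "P n diagseq" for n
  proof -
    have "P n (diagseq \<circ> (+) (Suc n))"
    proof (rule diagseq_holds)
      fix q s :: "nat \<Rightarrow> nat" and n assume "strict_mono q" "P n s"
      then show "P n (s \<circ> q)"
        using convergent_subseq_convergent[of "\<lambda>j. f (from_nat n) (s j)" q] by (simp add: P_def comp_def)
    qed
    then have "convergent (\<lambda>j. f (from_nat n) (diagseq (j + Suc n)))"
      by (simp add: P_def comp_def add.commute)
    then show ?thesis
      unfolding P_def by (rule convergent_ignore_initial_segment[THEN iffD1])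
  qed
  then have "convergent (\<lambda>j. f i (diagseq j))" for i
    unfolding P_def by (metis from_nat_to_nat)
  then show ?thesis using subseq_diagseq by blast
qed

context cauchy_data
begin

definition idx :: "nat \<Rightarrow> real \<Rightarrow> nat" where
  "idx n s = nat \<lfloor>s / mesh n\<rfloor>"

text \<open>Constant on each half-open cell, matching the domain of integration in
  \<open>cell\<close>; this makes time integrals along a path exact sums over cells.\<close>

definition path :: "nat \<Rightarrow> real \<Rightarrow> (real^'n \<Rightarrow> real) \<Rightarrow> real" where
  "path n s = euler n (idx n s)"

lemma path_finsupp: "finsupp UNIV (path n s)"
  by (simp add: path_def euler_finsupp)

lemma path_one_le: "path n s (\<lambda>x. 1) \<le> 1"
  by (simp add: path_def euler_one_le)

lemma path_abs_le: "(\<And>x. \<bar>f x\<bar> \<le> B) \<Longrightarrow> \<bar>path n s f\<bar> \<le> B"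
  using abs_ge_zero order_trans
  by (intro finsupp_abs_const[OF path_finsupp path_one_le]) blast+

lemma idx_lower: "0 \<le> s \<Longrightarrow> real (idx n s) * mesh n \<le> s"
  using mesh_pos[of n] unfolding idx_def by (simp add: pos_le_divide_eq[symmetric])

lemma idx_upper: "s < real (idx n s) * mesh n + mesh n"
proof -
  have "s / mesh n < real (nat \<lfloor>s / mesh n\<rfloor>) + 1" by linarith
  then show ?thesis using mesh_pos[of n] unfolding idx_def by (simp add: pos_divide_less_eq algebra_simps)
qed

lemma idx_mono: "s \<le> t \<Longrightarrow> idx n s \<le> idx n t"
  unfolding idx_def using mesh_pos[of n] by (intro nat_mono floor_mono divide_right_mono) auto

lemma idx_le_steps: "s \<le> T \<Longrightarrow> idx n s \<le> steps n"
proof -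
  assume "s \<le> T"
  \<comment> \<open>T is itself a grid point, where the floor is exact: at the final time all
    \<open>steps n\<close> steps have been made.\<close>
  moreover have "idx n T = steps n"
  proof -
    have "T / mesh n = real (steps n)"
      using mesh_steps[of n] mesh_pos[of n] by (simp add: field_simps)
    then show ?thesis by (simp add: idx_def)
  qed
  ultimately show ?thesis using idx_mono by metis
qed

lemma idx_eq:
  assumes "s \<in> {real m * mesh n..<real m * mesh n + mesh n}"
  shows "idx n s = m"
proof -
  have "real m \<le> s / mesh n" "s / mesh n < real m + 1"
    using assms mesh_pos[of n] by (auto simp: field_simps)
  then have "\<lfloor>s / mesh n\<rfloor> = int m" by (simp add: floor_eq_iff)
  then show ?thesis by (simp add: idx_def)
qed

lemma euler_lipschitz:
  assumes "\<And>m. m < steps n \<Longrightarrow> \<bar>euler n (Suc m) f - euler n m f\<bar> \<le> B" "m \<le> m'" "m' \<le> steps n"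
  shows "\<bar>euler n m' f - euler n m f\<bar> \<le> real (m' - m) * B"
  using assms(2,3)
proof (induction m' rule: dec_induct)
  case base
  then show ?case by simp
next
  case (step i)
  have "\<bar>euler n i f - euler n m f\<bar> \<le> real (i - m) * B" using step by simp
  moreover have "\<bar>euler n (Suc i) f - euler n i f\<bar> \<le> B" using step by (intro assms(1)) simp
  ultimately have "\<bar>euler n (Suc i) f - euler n m f\<bar> \<le> real (i - m) * B + B" by linarith
  also have "\<dots> = real (Suc i - m) * B" using step by (simp add: Suc_diff_le algebra_simps)
  finally show ?case .
qed

text \<open>The summand \<open>mesh n\<close> pays for rounding s and t down to the grid. It
  vanishes in the limit, so the bound serves as equicontinuity although the paths jump.\<close>

lemma path_equicontinuous:
  assumes "f \<in> Cc D" "C11 f"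
  shows "\<exists>C n0. 0 \<le> C \<and> (\<forall>n\<ge>n0. \<forall>s t. 0 \<le> s \<longrightarrow> s \<le> t \<longrightarrow> t \<le> T \<longrightarrow>
    \<bar>path n t f - path n s f\<bar> \<le> C * (t - s + mesh n))"
proof -
  obtain C n0 where C: "0 \<le> C" "\<And>n m. n \<ge> n0 \<Longrightarrow> m < steps n \<Longrightarrow> \<bar>euler n (Suc m) f - euler n m f\<bar> \<le> C * mesh n"
    using euler_C11[OF assms] by auto
  have "\<bar>path n t f - path n s f\<bar> \<le> C * (t - s + mesh n)"
    if "n \<ge> n0" "0 \<le> s" "s \<le> t" "t \<le> T" for n s t
  proof -
    have i: "idx n s \<le> idx n t" "idx n t \<le> steps n" using that idx_mono idx_le_steps by auto
    have "\<bar>path n t f - path n s f\<bar> \<le> real (idx n t - idx n s) * (C * mesh n)"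
      unfolding path_def by (rule euler_lipschitz[OF C(2)[OF that(1)] i])
    also have "\<dots> = C * (real (idx n t) * mesh n - real (idx n s) * mesh n)"
      using i by (simp add: of_nat_diff algebra_simps)
    also have "\<dots> \<le> C * (t - s + mesh n)"
      using idx_lower[of t n] idx_upper[of s n] that C(1) by (intro mult_left_mono) auto
    finally show ?thesis .
  qed
  then show ?thesis using C(1) by blast
qed

text \<open>Convergence spreads in three stages: rational times and the countable family by
  diagonalisation, all times by equicontinuity, and all of \<open>Cc D\<close> by linearity and
  uniform density, since the masses are at most 1.\<close>

lemma convergent_subsequence:
  "\<exists>r. strict_mono (r :: nat \<Rightarrow> nat) \<and> (\<forall>t\<in>{0..T}. \<forall>f\<in>Cc D. convergent (\<lambda>j. path (r j) t f))"
proof -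
  obtain \<Phi> :: "nat \<Rightarrow> real^'n \<Rightarrow> real" where \<Phi>: "\<And>k. \<Phi> k \<in> Cc D" "\<And>k. C11 (\<Phi> k)"
    and dense: "\<And>f e. f \<in> Cc D \<Longrightarrow> 0 < e \<Longrightarrow> \<exists>g\<in>fspan \<Phi>. \<forall>x. \<bar>f x - g x\<bar> \<le> e"
    using countable_C11_dense[OF D_open] by metis
  have "bounded (range (\<lambda>n. path n (real_of_rat (snd i)) (\<Phi> (fst i))))" for i :: "nat \<times> rat"
  proof -
    obtain B where "\<And>x. \<bar>\<Phi> (fst i) x\<bar> \<le> B" using Cc_bounded[OF \<Phi>(1)] by blast
    then show ?thesis by (intro boundedI[of _ B]) (auto intro: path_abs_le)
  qed
  from diagonal_convergent[where f="\<lambda>i n. path n (real_of_rat (snd i)) (\<Phi> (fst i))", OF this]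
  obtain r where r1: "strict_mono r"
      and conv: "\<forall>i. convergent (\<lambda>j. path (r j) (real_of_rat (snd i)) (\<Phi> (fst i)))"
    by (elim exE conjE) (rule that)
  have r: "strict_mono r" "convergent (\<lambda>j. path (r j) (real_of_rat q) (\<Phi> k))" for k q
    using r1 conv[rule_format, of "(k, q)"] by simp_all
  have rj: "j \<le> r j" for j using r(1) by (rule strict_mono_imp_increasing)
  have base: "convergent (\<lambda>j. path (r j) t (\<Phi> k))" if t: "t \<in> {0..T}" for t k
    unfolding Cauchy_convergent_iff[symmetric]
  proof (rule metric_CauchyI)
    fix e :: real assume e: "0 < e"
    obtain C n0 where C: "0 \<le> C" "\<And>n s t. n \<ge> n0 \<Longrightarrow> 0 \<le> s \<Longrightarrow> s \<le> t \<Longrightarrow> t \<le> T \<Longrightarrow>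
        \<bar>path n t (\<Phi> k) - path n s (\<Phi> k)\<bar> \<le> C * (t - s + mesh n)"
      using path_equicontinuous[OF \<Phi>] by metis
    \<comment> \<open>Both the distance from t to the rational q and the mesh are kept below
      \<delta>, so each comparison of times costs at most e / 3; C + 1 avoids a division by
      zero.\<close>
    define \<delta> where "\<delta> = e / 6 / (C + 1)"
    have \<delta>: "0 < \<delta>" using e C(1) by (simp add: \<delta>_def)
    have C\<delta>: "C * (\<delta> + \<delta>) \<le> e / 3"
    proof -
      have "C + 1 \<noteq> 0" using C(1) by linarith
      then have "(C + 1) * (z / (C + 1)) = z" for z by simp
      then have "(C + 1) * \<delta> = e / 6" unfolding \<delta>_def by blast
      then have "C * \<delta> + \<delta> = e / 6" by (simp add: distrib_right)
      then show ?thesis using \<delta> unfolding distrib_left by linarith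
    qed
    \<comment> \<open>The rational q must lie in [0, T] as well as near t; T > 0 makes this interval
      nonempty even at t = 0 and t = T.\<close>
    have "max 0 (t - \<delta>) < min T (t + \<delta>)" using t T \<delta> by auto
    then obtain q where q: "q \<in> \<rat>" "max 0 (t - \<delta>) < q" "q < min T (t + \<delta>)" using Rats_dense_in_real by blast
    then obtain p where p: "q = real_of_rat p" by (auto elim: Rats_cases)
    have near: "\<bar>path n t (\<Phi> k) - path n q (\<Phi> k)\<bar> \<le> e / 3" if "n \<ge> n0" "mesh n < \<delta>" for n
    proof -
      have "\<bar>path n t (\<Phi> k) - path n q (\<Phi> k)\<bar> \<le> C * (\<bar>t - q\<bar> + mesh n)"
        using C(2)[of n t q] C(2)[of n q t] that(1) q t by (cases "t \<le> q") (auto simp: abs_minus_commute)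
      also have "\<dots> \<le> C * (\<delta> + \<delta>)" using q that(2) C(1) by (intro mult_left_mono) auto
      finally show ?thesis using C\<delta> by linarith
    qed
    obtain n1 where n1: "\<And>n. n \<ge> n1 \<Longrightarrow> mesh n < \<delta>" using mesh_small[OF \<delta>] by auto
    have "Cauchy (\<lambda>j. path (r j) q (\<Phi> k))" using r(2) unfolding p by (rule convergent_Cauchy)
    moreover have "e / 3 > 0" using e by simp
    ultimately obtain M where M: "\<And>i j. i \<ge> M \<Longrightarrow> j \<ge> M \<Longrightarrow> dist (path (r i) q (\<Phi> k)) (path (r j) q (\<Phi> k)) < e / 3"
      unfolding Cauchy_def by meson
    have "dist (path (r i) t (\<Phi> k)) (path (r j) t (\<Phi> k)) < e"
      if "i \<ge> max M (max n0 n1)" "j \<ge> max M (max n0 n1)" for i j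
    proof -
      have "n0 \<le> r i" "n1 \<le> r i" "n0 \<le> r j" "n1 \<le> r j" using that rj[of i] rj[of j] by auto
      then have "\<bar>path (r i) t (\<Phi> k) - path (r i) q (\<Phi> k)\<bar> \<le> e / 3"
        "\<bar>path (r j) t (\<Phi> k) - path (r j) q (\<Phi> k)\<bar> \<le> e / 3"
        using near n1 by blast+
      moreover have "\<bar>path (r i) q (\<Phi> k) - path (r j) q (\<Phi> k)\<bar> < e / 3"
        using M[of i j] that by (simp add: dist_real_def)
      ultimately show ?thesis unfolding dist_real_def by linarith
    qed
    then show "\<exists>M. \<forall>m\<ge>M. \<forall>n\<ge>M. dist (path (r m) t (\<Phi> k)) (path (r n) t (\<Phi> k)) < e" by blast
  qed
  have span: "convergent (\<lambda>j. path (r j) t g)" if "g \<in> fspan \<Phi>" and t: "t \<in> {0..T}" for t g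
    using that(1)
  proof induction
    case zero
    show ?case by (simp add: finsupp_fun_zero[OF path_finsupp] convergent_const)
  next
    case (step g c i)
    have "path n t (\<lambda>x. g x + c * \<Phi> i x) = path n t g + c * path n t (\<Phi> i)" for n
      using finsupp_fun_add[OF path_finsupp, of n t g "\<lambda>x. c * \<Phi> i x"] finsupp_fun_cmult[OF path_finsupp, of n t c "\<Phi> i"] by simp
    then show ?case
      using convergent_add[OF step.IH convergent_mult[OF convergent_const base[OF t]], of c i] by simp
  qed
  have "convergent (\<lambda>j. path (r j) t f)" if t: "t \<in> {0..T}" and f: "f \<in> Cc D" for t f
    unfolding Cauchy_convergent_iff[symmetric]
  proof (rule metric_CauchyI)
    fix e :: real assume e: "0 < e"
    then have e4: "0 < e / 4" by simp
    obtain g where g: "g \<in> fspan \<Phi>" "\<And>x. \<bar>f x - g x\<bar> \<le> e / 4" using dense[OF f e4] by blast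
    have near: "\<bar>path n t f - path n t g\<bar> \<le> e / 4" for n
      using path_abs_le[of "\<lambda>x. f x - g x", OF g(2)] by (simp add: finsupp_fun_diff[OF path_finsupp])
    have "Cauchy (\<lambda>j. path (r j) t g)" using span[OF g(1) t] by (rule convergent_Cauchy)
    then obtain M where M: "\<And>i j. i \<ge> M \<Longrightarrow> j \<ge> M \<Longrightarrow> dist (path (r i) t g) (path (r j) t g) < e / 4"
      unfolding Cauchy_def using e4 by meson
    have "dist (path (r i) t f) (path (r j) t f) < e" if "i \<ge> M" "j \<ge> M" for i j
      using near[of "r i"] near[of "r j"] M[OF that] unfolding dist_real_def by linarith
    then show "\<exists>M. \<forall>m\<ge>M. \<forall>n\<ge>M. dist (path (r m) t f) (path (r n) t f) < e" by blast
  qed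
  then show ?thesis using r(1) by blast
qed

text \<open>Limits of positive functionals of mass at most 1 keep exactly the properties demanded by
  \<open>Cc_functional\<close>. Mass may escape in the limit, hence only an upper bound on the total
  mass.\<close>

lemma limit_flow_exists:
  "\<exists>r mt. strict_mono (r :: nat \<Rightarrow> nat) \<and> (\<forall>t\<in>{0..T}. sets (mt t) = sets borel \<and> emeasure (mt t) (UNIV - D) = 0 \<and>
     emeasure (mt t) UNIV \<le> 1 \<and> (\<forall>f\<in>Cc D. (\<lambda>j. path (r j) t f) \<longlonglongrightarrow> integral\<^sup>L (mt t) f))"
proof -
  obtain r where r: "strict_mono r" "\<And>t f. t \<in> {0..T} \<Longrightarrow> f \<in> Cc D \<Longrightarrow> convergent (\<lambda>j. path (r j) t f)"
    using convergent_subsequence by blast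
  define I where "I t f = lim (\<lambda>j. path (r j) t f)" for t f
  have I: "(\<lambda>j. path (r j) t f) \<longlonglongrightarrow> I t f" if "t \<in> {0..T}" "f \<in> Cc D" for t f
    unfolding I_def using r(2)[OF that] convergent_LIMSEQ_iff by blast
  have "\<exists>N. sets N = sets borel \<and> emeasure N (UNIV - D) = 0 \<and> emeasure N UNIV \<le> 1 \<and>
      (\<forall>f\<in>Cc D. (\<lambda>j. path (r j) t f) \<longlonglongrightarrow> integral\<^sup>L N f)" if t: "t \<in> {0..T}" for t
  proof -
    interpret F: Cc_functional D "I t"
    proof
      show "open D" by (rule D_open)
      fix f g assume f: "f \<in> Cc D"
      show "I t (\<lambda>x. c * f x) = c * I t f" for c
        using tendsto_mult_left[OF I[OF t f], of c]
        by (intro LIMSEQ_unique[OF I[OF t Cc_scale[OF f]]]) (simp add: finsupp_fun_cmult[OF path_finsupp])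
      show "0 \<le> I t f" if "\<And>x. 0 \<le> f x"
      proof (rule LIMSEQ_le_const[OF I[OF t f]])
        have "path n t (\<lambda>x. 0) \<le> path n t f" for n using that by (intro finsupp_mono[OF path_finsupp])
        then show "\<exists>N. \<forall>n\<ge>N. 0 \<le> path (r n) t f" by (simp add: finsupp_fun_zero[OF path_finsupp])
      qed
      show "I t f \<le> 1" if "\<And>x. f x \<le> 1"
      proof (rule LIMSEQ_le_const2[OF I[OF t f]])
        have "path n t f \<le> path n t (\<lambda>x. 1)" for n using that by (intro finsupp_mono[OF path_finsupp])
        then show "\<exists>N. \<forall>n\<ge>N. path (r n) t f \<le> 1" using path_one_le by (meson order_trans)
      qed
      assume g: "g \<in> Cc D"
      show "I t (\<lambda>x. f x + g x) = I t f + I t g"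
        using tendsto_add[OF I[OF t f] I[OF t g]]
        by (intro LIMSEQ_unique[OF I[OF t Cc_add[OF f g]]]) (simp add: finsupp_fun_add[OF path_finsupp])
    qed
    show ?thesis
      using F.sets_repr_measure F.emeasure_repr_outside F.emeasure_repr_le_1 F.integral_repr_measure I[OF t]
      by (intro exI[of _ F.repr_measure]) simp
  qed
  then obtain mt where "\<And>t. t \<in> {0..T} \<Longrightarrow> sets (mt t) = sets borel \<and> emeasure (mt t) (UNIV - D) = 0 \<and> emeasure (mt t) UNIV \<le> 1 \<and>
      (\<forall>f\<in>Cc D. (\<lambda>j. path (r j) t f) \<longlonglongrightarrow> integral\<^sup>L (mt t) f)"
    by metis
  then show ?thesis using r(1) by blast
qed

end

section \<open>Passing to the limit\<close>

lemma
  assumes "finsupp UNIV L" "\<And>x. set_integrable M S (F x)"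
  shows finsupp_set_integrable: "set_integrable M S (\<lambda>s. L (\<lambda>x. F x s))"
    and finsupp_set_integral: "(LINT s:S|M. L (\<lambda>x. F x s)) = L (\<lambda>x. LINT s:S|M. F x s)"
proof -
  have int: "integrable M (\<lambda>s. indicator S s * F x s)" for x
    using assms(2)[of x] by (simp add: set_integrable_def)
  show "set_integrable M S (\<lambda>s. L (\<lambda>x. F x s))"
    using finsupp_integrable[OF assms(1), of M "\<lambda>x s. indicator S s * F x s", OF int]
    by (simp add: set_integrable_def finsupp_fun_cmult[OF assms(1)])
  show "(LINT s:S|M. L (\<lambda>x. F x s)) = L (\<lambda>x. LINT s:S|M. F x s)"
    using finsupp_integral[OF assms(1), of M "\<lambda>x s. indicator S s * F x s", OF int]
    by (simp add: set_lebesgue_integral_def finsupp_fun_cmult[OF assms(1)])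
qed

text \<open>g is controlled on \<open>D\<close> only. Off the support of f the product is 0 whatever
  g does, and continuity is glued from two open sets.\<close>

lemma Cc_mult_continuous_on:
  assumes "open D" "continuous_on D g" "f \<in> Cc D"
  shows "(\<lambda>x. g x * f x) \<in> Cc D"
proof -
  obtain K where K: "compact K" "K \<subseteq> D" "\<And>x. x \<notin> K \<Longrightarrow> f x = 0" using Cc_support[OF assms(3)] by auto
  have "continuous_on (D \<union> - K) (\<lambda>x. g x * f x)"
  proof (rule continuous_on_open_Un)
    show "continuous_on D (\<lambda>x. g x * f x)"
      by (rule continuous_on_mult[OF assms(2) Cc_continuous[OF assms(3)]])
    show "continuous_on (- K) (\<lambda>x. g x * f x)"
      by (rule continuous_on_eq[of _ "\<lambda>x. 0"]) (auto simp: K(3))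
  qed (use assms K in \<open>auto simp: compact_imp_closed open_Compl\<close>)
  moreover have "D \<union> - K = UNIV" using K(2) by auto
  ultimately have "continuous_on UNIV (\<lambda>x. g x * f x)" by simp
  then show ?thesis by (rule CcI[OF _ K(1,2)]) (simp add: K(3))
qed

context cauchy_data
begin

text \<open>Integrands for which the limit and the time integral can be exchanged: vague convergence
  at a fixed time needs \<open>Cc D\<close> in x, dominated convergence needs a bound uniform in x
  and s, and in time integrability of each section is enough.\<close>

definition admissible :: "(real^'n \<Rightarrow> real \<Rightarrow> real) \<Rightarrow> bool" where
  "admissible F \<longleftrightarrow> (\<forall>x. set_integrable lborel {0..T} (F x)) \<and> (\<exists>C. \<forall>x. \<forall>s\<in>{0..T}. \<bar>F x s\<bar> \<le> C) \<and>
    (\<forall>s\<in>{0..T}. (\<lambda>x. F x s) \<in> Cc D)"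

lemma admissible_integrable: "admissible F \<Longrightarrow> set_integrable lborel {0..T} (F x)"
  by (simp add: admissible_def)

lemma admissible_Cc: "admissible F \<Longrightarrow> s \<in> {0..T} \<Longrightarrow> (\<lambda>x. F x s) \<in> Cc D"
  by (simp add: admissible_def)

lemma admissible_bounded: "admissible F \<Longrightarrow> \<exists>C\<ge>0. \<forall>x. \<forall>s\<in>{0..T}. \<bar>F x s\<bar> \<le> C"
proof -
  assume "admissible F"
  then have "\<exists>C. \<forall>x. \<forall>s\<in>{0..T}. \<bar>F x s\<bar> \<le> C" by (simp add: admissible_def)
  then obtain C where C: "\<forall>x. \<forall>s\<in>{0..T}. \<bar>F x s\<bar> \<le> C" ..
  then have "\<bar>F 0 0\<bar> \<le> C" using T by simp
  then have "0 \<le> C" by linarith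
  then show ?thesis using C by blast
qed

lemma admissibleI:
  assumes "\<And>x. set_integrable lborel {0..T} (F x)" "\<And>x s. s \<in> {0..T} \<Longrightarrow> \<bar>F x s\<bar> \<le> C"
    and "\<And>s. s \<in> {0..T} \<Longrightarrow> (\<lambda>x. F x s) \<in> Cc D"
  shows "admissible F"
proof -
  have "\<exists>C. \<forall>x. \<forall>s\<in>{0..T}. \<bar>F x s\<bar> \<le> C" using assms(2) by (intro exI[of _ C]) simp
  then show ?thesis using assms(1,3) by (simp add: admissible_def)
qed

lemma admissible_zero: "admissible (\<lambda>x s. 0)"
  by (rule admissibleI[of _ 0]) (simp_all add: Cc_zero set_integrable_def)

lemma admissible_add:
  assumes "admissible F" "admissible G"
  shows "admissible (\<lambda>x s. F x s + G x s)"
proof -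
  obtain C where C: "\<forall>x. \<forall>s\<in>{0..T}. \<bar>F x s\<bar> \<le> C" using admissible_bounded[OF assms(1)] by blast
  obtain E where E: "\<forall>x. \<forall>s\<in>{0..T}. \<bar>G x s\<bar> \<le> E" using admissible_bounded[OF assms(2)] by blast
  show ?thesis
  proof (rule admissibleI[of _ "C + E"])
    show "\<bar>F x s + G x s\<bar> \<le> C + E" if "s \<in> {0..T}" for x s
      using C[rule_format, OF that, of x] E[rule_format, OF that, of x] by linarith
    show "set_integrable lborel {0..T} (\<lambda>s. F x s + G x s)" for x
      using assms by (intro set_integral_add admissible_integrable)
    show "(\<lambda>x. F x s + G x s) \<in> Cc D" if "s \<in> {0..T}" for s
      using assms that by (intro Cc_add admissible_Cc)
  qed
qed

lemma admissible_sum: "(\<And>i. i \<in> S \<Longrightarrow> admissible (F i)) \<Longrightarrow> admissible (\<lambda>x s. \<Sum>i\<in>S. F i x s)"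
  by (induction S rule: infinite_finite_induct) (simp_all add: admissible_zero admissible_add)

text \<open>The support of f lies in some \<open>Dk k\<close>, where the coefficient is bounded
  uniformly in time.\<close>

lemma admissible_coef:
  assumes cont: "\<And>s. s \<in> {0..T} \<Longrightarrow> continuous_on D (\<lambda>x. g x s)"
    and int: "\<And>x. x \<in> D \<Longrightarrow> set_integrable lborel {0..T} (g x)"
    and bdd: "\<And>k. \<exists>M. \<forall>x\<in>Dk k. \<forall>t\<in>{0..T}. \<bar>g x t\<bar> \<le> M"
    and f: "f \<in> Cc D"
  shows "admissible (\<lambda>x s. g x s * f x)"
proof -
  obtain K where K: "compact K" "K \<subseteq> D" "\<And>x. x \<notin> K \<Longrightarrow> f x = 0" using Cc_support[OF f] by auto
  obtain k where k: "K \<subseteq> Dk k" using compact_subset_Dk[OF K(1,2)] by blast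
  obtain M where M: "\<forall>x\<in>Dk k. \<forall>t\<in>{0..T}. \<bar>g x t\<bar> \<le> M" using bdd[of k] by blast
  obtain B where B: "0 < B" "\<And>x. \<bar>f x\<bar> \<le> B" using Cc_bounded[OF f] by auto
  have "\<bar>g x s * f x\<bar> \<le> \<bar>M\<bar> * B" if "s \<in> {0..T}" for x s
  proof (cases "x \<in> K")
    case True
    then have "\<bar>g x s\<bar> \<le> \<bar>M\<bar>" using k M that abs_ge_self[of M] by (meson order_trans subsetD)
    then show ?thesis unfolding abs_mult using B by (intro mult_mono) auto
  next
    case False
    then show ?thesis using K(3) B(1) by simp
  qed
  moreover have "set_integrable lborel {0..T} (\<lambda>s. g x s * f x)" for x
    using int[of x] Cc_outside[OF f, of x] by (intro set_integrable_mult_left) blast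
  ultimately show ?thesis
    using Cc_mult_continuous_on[OF D_open cont f] by (intro admissibleI[of _ "\<bar>M\<bar> * B"])
qed

lemma admissible_a: "f \<in> Cc D \<Longrightarrow> admissible (\<lambda>x s. a i j x s * f x)"
  by (rule admissible_coef) (auto intro: a_cont a_integrable a_bdd)

lemma admissible_b: "f \<in> Cc D \<Longrightarrow> admissible (\<lambda>x s. b i x s * f x)"
  by (rule admissible_coef) (auto intro: b_cont b_integrable b_bdd)

lemma admissible_c: "f \<in> Cc D \<Longrightarrow> admissible (\<lambda>x s. c x s * f x)"
  by (rule admissible_coef) (auto intro: c_cont c_integrable c_bdd)

lemma admissible_Lop:
  assumes "test_fun D \<phi>"
  shows "admissible (Lop a b c \<phi>)"
proof -
  note t = test_fun_taylor[OF assms]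
  have "admissible (\<lambda>x s. (\<Sum>i\<in>UNIV. \<Sum>j\<in>UNIV. a i j x s * pd i (pd j \<phi>) x) + (\<Sum>i\<in>UNIV. b i x s * pd i \<phi> x) + c x s * \<phi> x)"
    by (intro admissible_add admissible_sum admissible_a admissible_b admissible_c t(1-3))
  then show ?thesis by (simp add: Lop_def[abs_def])
qed

lemma admissible_measurable:
  assumes "admissible F"
  shows "(\<lambda>p. indicator {0..T} (snd p) * F (fst p) (snd p)) \<in> borel_measurable (borel \<Otimes>\<^sub>M borel)"
proof (rule Caratheodory_function_measurable[of borel "\<lambda>x s. indicator {0..T} s * F x s"])
  show "continuous_on UNIV (\<lambda>x. indicator {0..T} s * F x s)" for s
    using Cc_continuous[OF admissible_Cc[OF assms, of s]] by (cases "s \<in> {0..T}") (auto simp: indicator_def)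
  show "(\<lambda>s. indicator {0..T} s * F x s) \<in> borel_measurable borel" for x
    using borel_measurable_integrable[OF admissible_integrable[OF assms, of x, unfolded set_integrable_def]] by simp
qed

text \<open>On each cell the path is one fixed law of finite support, which commutes with the time
  integral; the result is exactly the sum that occurs in the one-step estimates.\<close>

lemma path_sum_cells:
  assumes F: "\<And>x. set_integrable lborel {0..T} (F x)" and J: "J \<le> steps n"
  shows "set_integrable lborel {0..<real J * mesh n} (\<lambda>s. path n s (\<lambda>x. F x s)) \<and>
    (LINT s:{0..<real J * mesh n}|lborel. path n s (\<lambda>x. F x s)) =
    (\<Sum>m<J. euler n m (\<lambda>x. cell (mesh n) (real m * mesh n) (F x)))"
  using J
proof (induction J)
  case 0
  then show ?case by (simp add: set_integrable_def set_lebesgue_integral_def)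
next
  case (Suc J)
  define A B where "A = {0..<real J * mesh n}" and "B = {real J * mesh n..<real J * mesh n + mesh n}"
  have IH: "set_integrable lborel A (\<lambda>s. path n s (\<lambda>x. F x s))"
    "(LINT s:A|lborel. path n s (\<lambda>x. F x s)) = (\<Sum>m<J. euler n m (\<lambda>x. cell (mesh n) (real m * mesh n) (F x)))"
    using Suc by (auto simp: A_def)
  have AB: "A \<inter> B = {}" "{0..<real (Suc J) * mesh n} = A \<union> B"
    using mesh_pos[of n] by (auto simp: A_def B_def algebra_simps intro: order_trans[OF grid_nonneg])
  have "B \<subseteq> {0..T}"
    using grid_le[of J n] Suc.prems order_trans[OF grid_nonneg[of J n]] by (auto simp: B_def simp del: of_nat_0_le_iff)
  then have FB: "set_integrable lborel B (F x)" for x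
    by (rule set_integrable_subset[OF F, rotated]) (simp add: B_def)
  have eq: "path n s (\<lambda>x. F x s) = euler n J (\<lambda>x. F x s)" if "s \<in> B" for s
    using idx_eq[of s J n] that by (simp add: B_def path_def)
  have B1: "set_integrable lborel B (\<lambda>s. path n s (\<lambda>x. F x s))"
  proof -
    have "(\<lambda>s. indicator B s *\<^sub>R path n s (\<lambda>x. F x s)) = (\<lambda>s. indicator B s *\<^sub>R euler n J (\<lambda>x. F x s))"
      using eq by (auto simp: fun_eq_iff indicator_def)
    then show ?thesis
      using finsupp_set_integrable[where F=F, OF euler_finsupp[of n J] FB] by (simp add: set_integrable_def)
  qed
  have "(LINT s:B|lborel. path n s (\<lambda>x. F x s)) = (LINT s:B|lborel. euler n J (\<lambda>x. F x s))"
    using eq by (intro set_lebesgue_integral_cong) (auto simp: B_def)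
  also have "\<dots> = euler n J (\<lambda>x. cell (mesh n) (real J * mesh n) (F x))"
    using finsupp_set_integral[where F=F, OF euler_finsupp[of n J] FB] by (simp add: cell_def B_def)
  finally have B2: "(LINT s:B|lborel. path n s (\<lambda>x. F x s)) = euler n J (\<lambda>x. cell (mesh n) (real J * mesh n) (F x))" .
  show ?case
    unfolding AB(2) using set_integral_Un[OF AB(1) IH(1) B1] set_integrable_Un[OF IH(1) B1] IH(2) B2
    by (simp add: A_def B_def)
qed

end

locale limit_flow = cauchy_data D Dk T a b c \<nu>
  for D :: "(real^'n::finite) set" and Dk T a b c \<nu> +
  fixes r :: "nat \<Rightarrow> nat" and mt :: "real \<Rightarrow> (real^'n) measure"
  assumes r: "strict_mono r"
    and mt_sets: "\<And>t. t \<in> {0..T} \<Longrightarrow> sets (mt t) = sets borel"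
    and mt_outside: "\<And>t. t \<in> {0..T} \<Longrightarrow> emeasure (mt t) (UNIV - D) = 0"
    and mt_le_1: "\<And>t. t \<in> {0..T} \<Longrightarrow> emeasure (mt t) UNIV \<le> 1"
    and mt_lim: "\<And>t f. t \<in> {0..T} \<Longrightarrow> f \<in> Cc D \<Longrightarrow> (\<lambda>j. path (r j) t f) \<longlonglongrightarrow> integral\<^sup>L (mt t) f"
begin

lemma r_ge: "j \<le> r j"
  using r by (rule strict_mono_imp_increasing)

lemma mt_space: "t \<in> {0..T} \<Longrightarrow> space (mt t) = UNIV"
  using sets_eq_imp_space_eq[OF mt_sets] by simp

lemma mt_subprob: "t \<in> {0..T} \<Longrightarrow> subprob_space (mt t)"
  by (rule subprob_spaceI) (simp_all add: mt_space mt_le_1)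

lemma mt_integrable:
  fixes f :: "real^'n \<Rightarrow> real"
  assumes "t \<in> {0..T}" "f \<in> borel_measurable borel" "\<And>x. \<bar>f x\<bar> \<le> B"
  shows "integrable (mt t) f"
proof -
  interpret subprob_space "mt t" by (rule mt_subprob[OF assms(1)])
  have "f \<in> borel_measurable (mt t)" using assms(2) measurable_cong_sets[OF mt_sets[OF assms(1)] refl] by blast
  then show ?thesis using assms(3) by (intro integrable_const_bound[of _ B]) auto
qed

lemma mt_integral_Cc_le:
  assumes "t \<in> {0..T}" "f \<in> Cc D" "\<And>x. \<bar>f x\<bar> \<le> B"
  shows "\<bar>integral\<^sup>L (mt t) f\<bar> \<le> B"
proof (rule LIMSEQ_le_const2[OF tendsto_rabs[OF mt_lim[OF assms(1,2)]]])
  show "\<exists>N. \<forall>n\<ge>N. \<bar>path (r n) t f\<bar> \<le> B" using path_abs_le[of f B, OF assms(3)] by blast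
qed

lemma grid_time_tendsto:
  assumes "0 \<le> t"
  shows "(\<lambda>j. real (idx (r j) t) * mesh (r j)) \<longlonglongrightarrow> t"
proof (rule tendsto_sandwich)
  have "(\<lambda>j. mesh (r j)) \<longlonglongrightarrow> 0"
    using LIMSEQ_subseq_LIMSEQ[OF mesh_tendsto r] by (simp add: comp_def)
  then have "(\<lambda>j. t - mesh (r j)) \<longlonglongrightarrow> t - 0" by (intro tendsto_intros)
  then show "(\<lambda>j. t - mesh (r j)) \<longlonglongrightarrow> t" by simp
  show "\<forall>\<^sub>F j in sequentially. t - mesh (r j) \<le> real (idx (r j) t) * mesh (r j)"
    using idx_upper[of t] by (intro always_eventually allI) (smt (verit))
  show "\<forall>\<^sub>F j in sequentially. real (idx (r j) t) * mesh (r j) \<le> t"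
    using idx_lower[OF assms] by (intro always_eventually allI)
qed (rule tendsto_const)

text \<open>The approximating integrands are bounded by C on [0, T] and converge at every s, because
  a given s < t is eventually passed by the grid time \<open>\<tau> j\<close>. The same pointwise
  limit makes the integral against the limit flow measurable in time.\<close>

lemma
  assumes F: "admissible F" and t: "t \<in> {0..T}"
  shows flow_integrable: "set_integrable lborel {0..<t} (\<lambda>s. \<integral>x. F x s \<partial>mt s)"
    and time_integral_tendsto: "(\<lambda>j. LINT s:{0..<real (idx (r j) t) * mesh (r j)}|lborel. path (r j) s (\<lambda>x. F x s))
      \<longlonglongrightarrow> (LINT s:{0..<t}|lborel. \<integral>x. F x s \<partial>mt s)"
proof -
  define \<tau> where "\<tau> j = real (idx (r j) t) * mesh (r j)" for j
  define u where "u j s = indicator {0..<\<tau> j} s *\<^sub>R path (r j) s (\<lambda>x. F x s)" for j s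
  define v where "v s = indicator {0..<t} s *\<^sub>R (\<integral>x. F x s \<partial>mt s)" for s
  obtain C where C: "0 \<le> C" "\<forall>x. \<forall>s\<in>{0..T}. \<bar>F x s\<bar> \<le> C" using admissible_bounded[OF F] by blast
  have \<tau>_le: "\<tau> j \<le> t" for j using idx_lower[of t] t by (simp add: \<tau>_def)
  have \<tau>: "\<tau> \<longlonglongrightarrow> t" unfolding \<tau>_def using t by (intro grid_time_tendsto) auto
  have "set_integrable lborel {0..<\<tau> j} (\<lambda>s. path (r j) s (\<lambda>x. F x s))" for j
    using path_sum_cells[of F "idx (r j) t" "r j", OF admissible_integrable[OF F] idx_le_steps] t by (simp add: \<tau>_def)
  then have u_meas: "u j \<in> borel_measurable lborel" for j
    unfolding set_integrable_def u_def by (rule borel_measurable_integrable)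
  have lim: "(\<lambda>j. u j s) \<longlonglongrightarrow> v s" for s
  proof (cases "s \<in> {0..<t}")
    case True
    then have s: "s \<in> {0..T}" using t by auto
    have "\<forall>\<^sub>F j in sequentially. path (r j) s (\<lambda>x. F x s) = u j s"
      using order_tendstoD(1)[OF \<tau>, of s] True by (auto elim!: eventually_mono simp: u_def)
    then show ?thesis
      using mt_lim[OF s admissible_Cc[OF F s]] True by (simp add: v_def tendsto_cong)
  next
    case False
    then have "u j s = 0" for j using \<tau>_le[of j] by (auto simp: u_def indicator_def)
    then show ?thesis using False by (simp add: v_def)
  qed
  have v_meas: "v \<in> borel_measurable lborel"
    by (rule borel_measurable_LIMSEQ_real[OF lim u_meas])
  have dom: "norm (u j s) \<le> C * indicator {0..T} s" for j s
  proof (cases "s \<in> {0..<\<tau> j}")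
    case True
    then have s: "s \<in> {0..T}" using \<tau>_le[of j] t by auto
    have "\<bar>path (r j) s (\<lambda>x. F x s)\<bar> \<le> C" using C(2) s by (intro path_abs_le) blast
    then show ?thesis using True s by (simp add: u_def)
  next
    case False
    then show ?thesis using C(1) by (simp add: u_def)
  qed
  have w: "integrable lborel (\<lambda>s. C * indicator {0..T} s)"
    by (intro integrable_mult_right integrable_real_indicator) (auto simp: emeasure_lborel_Icc_eq)
  have "integrable lborel v"
    by (rule integrable_dominated_convergence[where s=u and f=v, OF v_meas u_meas w]) (use lim dom in auto)
  then show "set_integrable lborel {0..<t} (\<lambda>s. \<integral>x. F x s \<partial>mt s)"
    by (simp add: v_def[abs_def] set_integrable_def)
  have "(\<lambda>j. integral\<^sup>L lborel (u j)) \<longlonglongrightarrow> integral\<^sup>L lborel v"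
    by (rule integral_dominated_convergence[where s=u and f=v, OF v_meas u_meas w]) (use lim dom in auto)
  then show "(\<lambda>j. LINT s:{0..<real (idx (r j) t) * mesh (r j)}|lborel. path (r j) s (\<lambda>x. F x s))
      \<longlonglongrightarrow> (LINT s:{0..<t}|lborel. \<integral>x. F x s \<partial>mt s)"
    by (simp add: u_def[abs_def] v_def[abs_def] \<tau>_def set_lebesgue_integral_def)
qed

text \<open>The one-step identities are telescoped up to t. At most T / \<open>mesh n\<close> steps,
  each with error \<eta> times \<open>mesh n\<close>, give a total error of \<eta> T.\<close>

lemma flow_equation:
  assumes \<phi>: "test_fun D \<phi>" and t: "t \<in> {0..T}"
  shows "integral\<^sup>L (mt t) \<phi> - integral\<^sup>L \<nu> \<phi> = (LINT s:{0..<t}|lborel. \<integral>x. Lop a b c \<phi> x s \<partial>mt s)"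
proof -
  have Cc: "\<phi> \<in> Cc D" by (rule test_fun_Cc[OF \<phi>])
  define q where "q j = (LINT s:{0..<real (idx (r j) t) * mesh (r j)}|lborel. path (r j) s (\<lambda>x. Lop a b c \<phi> x s))" for j
  define p where "p j = path (r j) t \<phi> - init (r j) \<phi>" for j
  obtain B where "\<And>x. \<bar>\<phi> x\<bar> \<le> B" using Cc_bounded[OF Cc] by auto
  then have "(\<lambda>n. init n \<phi>) \<longlonglongrightarrow> integral\<^sup>L \<nu> \<phi>" using init_tendsto[OF Cc_continuous[OF Cc]] by blast
  then have "(\<lambda>j. init (r j) \<phi>) \<longlonglongrightarrow> integral\<^sup>L \<nu> \<phi>"
    using LIMSEQ_subseq_LIMSEQ[OF _ r] by (force simp: comp_def)
  then have p: "p \<longlonglongrightarrow> integral\<^sup>L (mt t) \<phi> - integral\<^sup>L \<nu> \<phi>"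
    unfolding p_def by (intro tendsto_diff mt_lim[OF t Cc])
  have q: "q \<longlonglongrightarrow> (LINT s:{0..<t}|lborel. \<integral>x. Lop a b c \<phi> x s \<partial>mt s)"
    unfolding q_def by (rule time_integral_tendsto[OF admissible_Lop[OF \<phi>] t])
  have "(\<lambda>j. p j - q j) \<longlonglongrightarrow> 0"
  proof (rule LIMSEQ_I)
    fix e :: real assume e: "0 < e"
    define \<eta> where "\<eta> = e / (2 * T)"
    have \<eta>: "0 < \<eta>" "\<eta> * T < e" using e T by (auto simp: \<eta>_def)
    obtain n0 where n0: "\<And>n m. n \<ge> n0 \<Longrightarrow> m < steps n \<Longrightarrow> \<bar>euler n (Suc m) \<phi> - euler n m \<phi>
        - euler n m (\<lambda>x. cell (mesh n) (real m * mesh n) (Lop a b c \<phi> x))\<bar> \<le> \<eta> * mesh n"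
      using euler_taylor[OF \<phi> \<eta>(1)] by auto
    have "norm (p j - q j - 0) < e" if j: "j \<ge> n0" for j
    proof -
      define n J where "n = r j" and "J = idx n t"
      have n: "n \<ge> n0" using j r_ge[of j] by (simp add: n_def)
      have J: "J \<le> steps n" using idx_le_steps[of t n] t by (simp add: J_def)
      have "q j = (\<Sum>m<J. euler n m (\<lambda>x. cell (mesh n) (real m * mesh n) (Lop a b c \<phi> x)))"
        using path_sum_cells[of "Lop a b c \<phi>" J n, OF admissible_integrable[OF admissible_Lop[OF \<phi>]] J]
        by (simp add: q_def J_def n_def)
      moreover have "p j = (\<Sum>m<J. euler n (Suc m) \<phi> - euler n m \<phi>)"
        using sum_lessThan_telescope[of "\<lambda>m. euler n m \<phi>" J] by (simp add: p_def path_def J_def n_def)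
      ultimately have eq: "p j - q j = (\<Sum>m<J. euler n (Suc m) \<phi> - euler n m \<phi>
          - euler n m (\<lambda>x. cell (mesh n) (real m * mesh n) (Lop a b c \<phi> x)))"
        by (simp add: sum_subtractf del: euler.simps)
      have "\<bar>p j - q j\<bar> \<le> (\<Sum>m<J. \<eta> * mesh n)"
        unfolding eq by (rule order_trans[OF sum_abs sum_mono], rule n0[OF n]) (use J in simp)
      also have "\<dots> = \<eta> * (real J * mesh n)" by simp
      also have "\<dots> \<le> \<eta> * T"
        using idx_lower[of t n] t \<eta>(1) by (intro mult_left_mono) (auto simp: J_def)
      finally show ?thesis using \<eta>(2) by simp
    qed
    then show "\<exists>N. \<forall>j\<ge>N. norm (p j - q j - 0) < e" by (intro exI[of _ n0] allI impI)
  qed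
  then have "(integral\<^sup>L (mt t) \<phi> - integral\<^sup>L \<nu> \<phi>) - (LINT s:{0..<t}|lborel. \<integral>x. Lop a b c \<phi> x s \<partial>mt s) = 0"
    by (rule LIMSEQ_unique[OF tendsto_diff[OF p q]])
  then show ?thesis by simp
qed

text \<open>Two cutoffs, so that each can be released on its own later: \<zeta> tests the mass at
  time t, \<psi> truncates the killing. The constant 1 is the initial mass of the chain.\<close>

lemma flow_mass:
  assumes \<zeta>: "\<zeta> \<in> Cc D" "\<And>x. \<zeta> x \<le> 1" and \<psi>: "\<psi> \<in> Cc D" "\<And>x. 0 \<le> \<psi> x" "\<And>x. \<psi> x \<le> 1" and t: "t \<in> {0..T}"
  shows "integral\<^sup>L (mt t) \<zeta> \<le> 1 + (LINT s:{0..<t}|lborel. \<integral>x. c x s * \<psi> x \<partial>mt s)"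
proof -
  define q where "q j = (LINT s:{0..<real (idx (r j) t) * mesh (r j)}|lborel. path (r j) s (\<lambda>x. c x s * \<psi> x))" for j
  have q: "q \<longlonglongrightarrow> (LINT s:{0..<t}|lborel. \<integral>x. c x s * \<psi> x \<partial>mt s)"
    unfolding q_def by (rule time_integral_tendsto[OF admissible_c[OF \<psi>(1)] t])
  obtain n0 where n0: "\<And>n m. n \<ge> n0 \<Longrightarrow> m < steps n \<Longrightarrow> euler n (Suc m) (\<lambda>x. 1)
      \<le> euler n m (\<lambda>x. 1) + euler n m (\<lambda>x. cell (mesh n) (real m * mesh n) (\<lambda>s. \<psi> x * c x s))"
    using euler_mass[OF \<psi>] by auto
  have "path (r j) t \<zeta> \<le> 1 + q j" if j: "j \<ge> n0" for j
  proof -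
    define n where "n = r j"
    have n: "n \<ge> n0" using j r_ge[of j] by (simp add: n_def)
    have "euler n J (\<lambda>x. 1) \<le> 1 + (\<Sum>m<J. euler n m (\<lambda>x. cell (mesh n) (real m * mesh n) (\<lambda>s. c x s * \<psi> x)))"
      if "J \<le> steps n" for J
      using that
    proof (induction J)
      case 0
      then show ?case by (simp add: init_one)
    next
      case (Suc J)
      then have "euler n J (\<lambda>x. 1) \<le> 1 + (\<Sum>m<J. euler n m (\<lambda>x. cell (mesh n) (real m * mesh n) (\<lambda>s. c x s * \<psi> x)))" by simp
      moreover have "euler n (Suc J) (\<lambda>x. 1) \<le> euler n J (\<lambda>x. 1) + euler n J (\<lambda>x. cell (mesh n) (real J * mesh n) (\<lambda>s. c x s * \<psi> x))"
        using n0[OF n, of J] Suc.prems by (simp add: mult.commute del: euler.simps)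
      ultimately show ?case by (simp del: euler.simps)
    qed
    moreover have J: "idx n t \<le> steps n" using idx_le_steps[of t n] t by simp
    moreover have "q j = (\<Sum>m<idx n t. euler n m (\<lambda>x. cell (mesh n) (real m * mesh n) (\<lambda>s. c x s * \<psi> x)))"
      using path_sum_cells[of "\<lambda>x s. c x s * \<psi> x" "idx n t" n, OF admissible_integrable[OF admissible_c[OF \<psi>(1)]] J]
      by (simp add: q_def n_def)
    moreover have "path n t \<zeta> \<le> euler n (idx n t) (\<lambda>x. 1)"
      unfolding path_def using \<zeta>(2) by (intro finsupp_mono[OF euler_finsupp])
    ultimately show ?thesis by (force simp: n_def)
  qed
  then show ?thesis
    by (intro LIMSEQ_le[OF mt_lim[OF t \<zeta>(1)] tendsto_add[OF tendsto_const q]]) auto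
qed

end

section \<open>The space-time measure\<close>

lemma SUP_ennreal_LIMSEQ:
  assumes "incseq f" "f \<longlonglongrightarrow> l"
  shows "(SUP n. ennreal (f n)) = ennreal l"
proof -
  have "incseq (\<lambda>n. ennreal (f n))" using assms(1) by (auto simp: incseq_def intro: ennreal_leI)
  from LIMSEQ_SUP[OF this] tendsto_ennrealI[OF assms(2)] show ?thesis by (rule LIMSEQ_unique)
qed

context limit_flow
begin

abbreviation R :: "real measure" where
  "R \<equiv> restrict_space lborel {0<..<T}"

lemma space_R [simp]: "space R = {0<..<T}"
  by (simp add: space_restrict_space)

lemma mt_borel_measurable: "t \<in> {0..T} \<Longrightarrow> f \<in> borel_measurable borel \<Longrightarrow> f \<in> borel_measurable (mt t)"
  using measurable_cong_sets[OF mt_sets refl] by blast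

lemma mt_AE_D: "t \<in> {0..T} \<Longrightarrow> AE x in mt t. x \<in> D"
  using mt_outside[of t] mt_sets[of t] D_open
  by (intro AE_I[of _ _ "UNIV - D"]) auto

lemma path_measurable [measurable]: "(\<lambda>t. path n t f) \<in> borel_measurable borel"
  unfolding path_def idx_def by measurable

lemma mt_integral_measurable:
  assumes "f \<in> Cc D"
  shows "(\<lambda>t. integral\<^sup>L (mt t) f) \<in> borel_measurable R"
proof (rule borel_measurable_LIMSEQ_real)
  show "(\<lambda>t. path (r j) t f) \<in> borel_measurable R" for j
    by (intro measurable_restrict_space1) measurable
  show "(\<lambda>j. path (r j) t f) \<longlonglongrightarrow> integral\<^sup>L (mt t) f" if "t \<in> space R" for t
    using that assms by (intro mt_lim) auto
qed

lemma emeasure_mt_open: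
  assumes \<psi>: "\<And>n. \<psi> n \<in> Cc D" "\<And>n x. 0 \<le> \<psi> n x" "\<And>n x. \<psi> n x \<le> 1" "\<And>x. incseq (\<lambda>n. \<psi> n x)"
      "\<And>x. (\<lambda>n. \<psi> n x) \<longlonglongrightarrow> indicator (A \<inter> D) x"
    and A: "open A" and t: "t \<in> {0..T}"
  shows "emeasure (mt t) A = (SUP n. ennreal (integral\<^sup>L (mt t) (\<psi> n)))"
proof -
  have [measurable]: "\<psi> n \<in> borel_measurable (mt t)" for n
    using \<psi>(1) t by (intro mt_borel_measurable Cc_measurable)
  have sets: "A \<inter> D \<in> sets (mt t)" "A \<in> sets (mt t)" using mt_sets[OF t] A D_open by auto
  have "emeasure (mt t) A = emeasure (mt t) (A \<inter> D)"
    using mt_AE_D[OF t] sets by (intro emeasure_eq_AE) auto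
  also have "\<dots> = (\<integral>\<^sup>+x. indicator (A \<inter> D) x \<partial>mt t)" using sets by simp
  also have "\<dots> = (\<integral>\<^sup>+x. (SUP n. ennreal (\<psi> n x)) \<partial>mt t)"
    unfolding SUP_ennreal_LIMSEQ[OF \<psi>(4,5)] by (simp add: ennreal_indicator)
  also have "\<dots> = (SUP n. \<integral>\<^sup>+x. ennreal (\<psi> n x) \<partial>mt t)"
    using \<psi>(4) by (intro nn_integral_monotone_convergence_SUP) (auto simp: incseq_def le_fun_def intro!: ennreal_leI)
  also have "(\<lambda>n. \<integral>\<^sup>+x. ennreal (\<psi> n x) \<partial>mt t) = (\<lambda>n. ennreal (integral\<^sup>L (mt t) (\<psi> n)))"
  proof
    fix n
    have "integrable (mt t) (\<psi> n)"
      using \<psi>(1-3) t by (intro mt_integrable[where B=1] Cc_measurable) (auto simp: abs_le_iff intro: order_trans[OF _ \<psi>(2)])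
    then show "(\<integral>\<^sup>+x. ennreal (\<psi> n x) \<partial>mt t) = ennreal (integral\<^sup>L (mt t) (\<psi> n))"
      using \<psi>(2) by (intro nn_integral_eq_integral) auto
  qed
  finally show ?thesis .
qed

text \<open>It suffices to check open sets, which are stable under intersection and generate the
  Borel sets. Their mass is a supremum of integrals of cutoffs, and each of these is a pointwise
  limit of paths, which are step functions of time.\<close>

lemma mt_kernel: "mt \<in> measurable R (subprob_algebra borel)"
proof (rule measurable_subprob_algebra_generated[where G="{S. open S}" and \<Omega>=UNIV])
  show "sets (borel :: (real^'n) measure) = sigma_sets UNIV {S. open S}"
    by (simp add: borel_def)
  show "Int_stable {S :: (real^'n) set. open S}" by (auto simp: Int_stable_def)
  show open_meas: "(\<lambda>t. emeasure (mt t) A) \<in> borel_measurable R" if A': "A \<in> {S. open S}" for A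
  proof -
    have A: "open A" using A' by simp
    have "open (A \<inter> D)" using A D_open by auto
    from open_exhaustion_Cc[OF this] obtain \<psi> :: "nat \<Rightarrow> real^'n \<Rightarrow> real"
      where \<psi>: "\<And>n. \<psi> n \<in> Cc (A \<inter> D)" "\<And>n x. 0 \<le> \<psi> n x" "\<And>n x. \<psi> n x \<le> 1" "\<And>x. incseq (\<lambda>n. \<psi> n x)"
        "\<And>x. (\<lambda>n. \<psi> n x) \<longlonglongrightarrow> indicator (A \<inter> D) x" by metis
    have Cc: "\<psi> n \<in> Cc D" for n by (rule Cc_mono[OF _ \<psi>(1)]) auto
    have "emeasure (mt t) A = (SUP n. ennreal (integral\<^sup>L (mt t) (\<psi> n)))" if "t \<in> space R" for t
      using that by (intro emeasure_mt_open Cc \<psi> A) auto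
    then show ?thesis
      using mt_integral_measurable[OF Cc] by (subst measurable_cong) auto
  qed
  show "(\<lambda>t. emeasure (mt t) UNIV) \<in> borel_measurable R" by (rule open_meas) simp
qed (auto simp: mt_sets intro: mt_subprob)

definition kern :: "real \<Rightarrow> ((real^'n) \<times> real) measure" where
  "kern t = distr (mt t) borel (\<lambda>x. (x, t))"

lemma kern_measurable [measurable]: "kern \<in> measurable R (subprob_algebra borel)"
proof -
  have id: "(\<lambda>t. t) \<in> measurable R borel" by (intro measurable_restrict_space1) simp
  have "(\<lambda>p. (snd p, fst p)) \<in> measurable (R \<Otimes>\<^sub>M borel) ((borel :: (real^'n) measure) \<Otimes>\<^sub>M (borel :: real measure))"
    by (intro measurable_Pair measurable_snd measurable_compose[OF measurable_fst id])
  then have "case_prod (\<lambda>t x. (x, t)) \<in> measurable (R \<Otimes>\<^sub>M borel) (borel :: ((real^'n) \<times> real) measure)"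
    by (simp add: borel_prod split_beta')
  from measurable_distr2[OF this mt_kernel] show ?thesis
    by (simp add: kern_def[abs_def])
qed

text \<open>The measure mt_t(dx) dt: \<open>kern t\<close> places \<open>mt t\<close> on the slice
  at time t, and the monadic bind integrates the slices over (0, T).\<close>

definition mu :: "((real^'n) \<times> real) measure" where
  "mu = R \<bind> kern"

lemma R_nonempty: "space R \<noteq> {}"
  using T by simp

lemma sets_mu [simp, measurable_cong]: "sets mu = sets borel"
  unfolding mu_def by (rule sets_bind[OF sets_kernel[OF kern_measurable] R_nonempty])

lemma pair_measurable: "(\<lambda>x. (x, t)) \<in> measurable borel (borel :: ((real^'n) \<times> real) measure)"
  by (intro borel_measurable_continuous_onI continuous_intros)

lemma nn_integral_mu:
  assumes f: "f \<in> borel_measurable borel"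
  shows "(\<integral>\<^sup>+p. f p \<partial>mu) = (\<integral>\<^sup>+t. (\<integral>\<^sup>+x. f (x, t) \<partial>mt t) \<partial>R)"
  unfolding mu_def nn_integral_bind[OF f kern_measurable]
proof (rule nn_integral_cong)
  fix t assume "t \<in> space R"
  then have t: "t \<in> {0..T}" by simp
  have "(\<lambda>x. (x, t)) \<in> measurable (mt t) borel"
    using pair_measurable measurable_cong_sets[OF mt_sets[OF t] refl] by blast
  then show "(\<integral>\<^sup>+p. f p \<partial>kern t) = (\<integral>\<^sup>+x. f (x, t) \<partial>mt t)"
    unfolding kern_def using f by (simp add: nn_integral_distr)
qed

lemma finite_mu: "finite_measure mu"
proof (rule finite_measureI)
  have "emeasure mu (space mu) = (\<integral>\<^sup>+p. 1 \<partial>mu)" by simp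
  also have "\<dots> = (\<integral>\<^sup>+t. (\<integral>\<^sup>+x. 1 \<partial>mt t) \<partial>R)" by (rule nn_integral_mu) simp
  also have "\<dots> \<le> (\<integral>\<^sup>+t. 1 \<partial>R)"
    using mt_le_1 mt_space by (intro nn_integral_mono) auto
  also have "\<dots> = emeasure R {0<..<T}" by simp
  also have "\<dots> = emeasure lborel {0<..<T}" by (intro emeasure_restrict_space) auto
  also have "\<dots> < \<infinity>" using T by (simp add: emeasure_lborel_Ioo)
  finally show "emeasure mu (space mu) \<noteq> \<infinity>" by simp
qed

lemma integrable_mu:
  fixes u :: "(real^'n) \<times> real \<Rightarrow> real"
  assumes "u \<in> borel_measurable borel" "\<And>p. \<bar>u p\<bar> \<le> B"
  shows "integrable mu u"
proof -
  interpret finite_measure mu by (rule finite_mu)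
  show ?thesis using assms by (intro integrable_const_bound[of _ B]) auto
qed

text \<open>The bind gives the iterated integral for nonnegative functions; a bounded signed u
  follows by splitting it into positive and negative parts.\<close>

lemma
  fixes u :: "(real^'n) \<times> real \<Rightarrow> real"
  assumes u: "u \<in> borel_measurable borel" "\<And>p. \<bar>u p\<bar> \<le> B"
  shows integrable_R: "integrable R (\<lambda>t. \<integral>x. u (x, t) \<partial>mt t)"
    and integral_mu: "(\<integral>p. u p \<partial>mu) = (\<integral>t. (\<integral>x. u (x, t) \<partial>mt t) \<partial>R)"
proof -
  have B: "0 \<le> B" using u(2) by (meson abs_ge_zero order_trans)
  have fin: "finite_measure R"
    using T by (intro finite_measureI) (simp add: emeasure_restrict_space emeasure_lborel_Ioo)
  have sec: "(\<lambda>x. v (x, t)) \<in> borel_measurable borel" if "v \<in> borel_measurable borel" for v :: "(real^'n) \<times> real \<Rightarrow> real" and t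
    using measurable_compose[OF pair_measurable that] .
  have *: "integrable R (\<lambda>t. \<integral>x. v (x, t) \<partial>mt t) \<and> (\<integral>p. v p \<partial>mu) = (\<integral>t. (\<integral>x. v (x, t) \<partial>mt t) \<partial>R)"
    if v: "v \<in> borel_measurable borel" "\<And>p. 0 \<le> v p" "\<And>p. v p \<le> B" for v :: "(real^'n) \<times> real \<Rightarrow> real"
  proof -
    have absv: "\<bar>v p\<bar> \<le> B" for p using v(2,3)[of p] by simp
    have i1: "integrable (mt t) (\<lambda>x. v (x, t))" if "t \<in> {0..T}" for t
      using that absv by (intro mt_integrable sec v(1))
    have le: "\<bar>\<integral>x. v (x, t) \<partial>mt t\<bar> \<le> B" if t: "t \<in> {0..T}" for t
    proof -
      interpret subprob_space "mt t" by (rule mt_subprob[OF t])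
      have "(\<integral>x. v (x, t) \<partial>mt t) \<le> (\<integral>x. B \<partial>mt t)"
        using v(3) by (intro integral_mono i1[OF t]) auto
      also have "\<dots> \<le> B" using B subprob_measure_le_1[of "space (mt t)"] by (simp add: mult_left_le_one_le)
      finally show ?thesis using v(2) by (simp add: integral_nonneg_AE)
    qed
    have "(\<lambda>t. \<integral>p. v p \<partial>kern t) \<in> borel_measurable R"
      using v(1) by (intro measurable_compose[OF kern_measurable integral_measurable_subprob_algebra])
    moreover have "(\<integral>p. v p \<partial>kern t) = (\<integral>x. v (x, t) \<partial>mt t)" if "t \<in> space R" for t
    proof -
      have t: "t \<in> {0..T}" using that by simp
      have "(\<lambda>x. (x, t)) \<in> measurable (mt t) borel"
        using pair_measurable measurable_cong_sets[OF mt_sets[OF t] refl] by blast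
      then show ?thesis unfolding kern_def using v(1) by (simp add: integral_distr)
    qed
    ultimately have meas: "(\<lambda>t. \<integral>x. v (x, t) \<partial>mt t) \<in> borel_measurable R"
      by (subst measurable_cong[of R _ "\<lambda>t. \<integral>p. v p \<partial>kern t"]) auto
    interpret finite_measure R by (rule fin)
    have i2: "integrable R (\<lambda>t. \<integral>x. v (x, t) \<partial>mt t)"
      using meas le by (intro integrable_const_bound[of _ B] AE_I2) auto
    have "ennreal (\<integral>p. v p \<partial>mu) = (\<integral>\<^sup>+p. ennreal (v p) \<partial>mu)"
      using integrable_mu[OF v(1) absv] v(2) by (intro nn_integral_eq_integral[symmetric]) auto
    also have "\<dots> = (\<integral>\<^sup>+t. (\<integral>\<^sup>+x. ennreal (v (x, t)) \<partial>mt t) \<partial>R)"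
      using v(1) by (intro nn_integral_mu) measurable
    also have "\<dots> = (\<integral>\<^sup>+t. ennreal (\<integral>x. v (x, t) \<partial>mt t) \<partial>R)"
      using i1 v(2) by (intro nn_integral_cong nn_integral_eq_integral) auto
    also have "\<dots> = ennreal (\<integral>t. (\<integral>x. v (x, t) \<partial>mt t) \<partial>R)"
      using i2 v(2) by (intro nn_integral_eq_integral) (auto intro: integral_nonneg_AE)
    finally have "(\<integral>p. v p \<partial>mu) = (\<integral>t. (\<integral>x. v (x, t) \<partial>mt t) \<partial>R)"
      using v(2) by (simp add: integral_nonneg_AE)
    then show ?thesis using i2 by simp
  qed
  define pos neg where "pos p = max 0 (u p)" and "neg p = max 0 (- u p)" for p
  have pm: "pos \<in> borel_measurable borel" "neg \<in> borel_measurable borel"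
    unfolding pos_def neg_def using u(1) by measurable
  have pn: "0 \<le> pos p" "0 \<le> neg p" "pos p \<le> B" "neg p \<le> B" for p
    using u(2)[of p] B by (auto simp: pos_def neg_def)
  note P = *[OF pm(1) pn(1,3)] and N = *[OF pm(2) pn(2,4)]
  have u_eq: "u p = pos p - neg p" for p by (auto simp: pos_def neg_def)
  have diff: "(\<integral>x. u (x, t) \<partial>mt t) = (\<integral>x. pos (x, t) \<partial>mt t) - (\<integral>x. neg (x, t) \<partial>mt t)" if "t \<in> {0..T}" for t
    unfolding u_eq using that pn
    by (intro Bochner_Integration.integral_diff mt_integrable[where B=B] sec pm) auto
  show "integrable R (\<lambda>t. \<integral>x. u (x, t) \<partial>mt t)"
    using Bochner_Integration.integrable_diff[OF conjunct1[OF P] conjunct1[OF N]]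
    by (rule Bochner_Integration.integrable_cong[OF refl, THEN iffD1, rotated]) (simp add: diff)
  have "(\<integral>p. u p \<partial>mu) = (\<integral>p. pos p \<partial>mu) - (\<integral>p. neg p \<partial>mu)"
    unfolding u_eq using pn by (intro Bochner_Integration.integral_diff integrable_mu[where B=B] pm) auto
  also have "\<dots> = (\<integral>t. (\<integral>x. pos (x, t) \<partial>mt t) - (\<integral>x. neg (x, t) \<partial>mt t) \<partial>R)"
    using P N by simp
  also have "\<dots> = (\<integral>t. (\<integral>x. u (x, t) \<partial>mt t) \<partial>R)"
    by (intro Bochner_Integration.integral_cong) (simp_all add: diff)
  finally show "(\<integral>p. u p \<partial>mu) = (\<integral>t. (\<integral>x. u (x, t) \<partial>mt t) \<partial>R)" .
qed

lemma set_integral_D: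
  assumes "t \<in> {0..T}" "f \<in> borel_measurable borel"
  shows "(LINT x:D|mt t. f x) = (\<integral>x. f x \<partial>mt t)"
  unfolding set_lebesgue_integral_def
proof (rule integral_cong_AE)
  have [measurable]: "D \<in> sets (mt t)" using mt_sets[OF assms(1)] D_open by simp
  show f: "f \<in> borel_measurable (mt t)" by (rule mt_borel_measurable[OF assms])
  then show "(\<lambda>x. indicator D x *\<^sub>R f x) \<in> borel_measurable (mt t)" by measurable
  show "AE x in mt t. indicator D x *\<^sub>R f x = f x"
    using mt_AE_D[OF assms(1)] by (rule AE_mp) simp
qed

lemma given_by_flow_mu: "given_by_flow D T mu mt"
  unfolding given_by_flow_def
proof (intro conjI allI impI ballI)
  interpret finite_measure mu by (rule finite_mu)
  show "sets mu = sets borel" by simp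
  have DT: "D \<times> {0<..<T} \<in> sets borel" using D_open by (intro borel_open open_Times) auto
  then have "emeasure mu (UNIV - D \<times> {0<..<T}) = (\<integral>\<^sup>+p. indicator (UNIV - D \<times> {0<..<T}) p \<partial>mu)" by simp
  also have "\<dots> = (\<integral>\<^sup>+t. (\<integral>\<^sup>+x. indicator (UNIV - D \<times> {0<..<T}) (x, t) \<partial>mt t) \<partial>R)"
    using DT by (intro nn_integral_mu) simp
  also have "\<dots> = (\<integral>\<^sup>+t. 0 \<partial>R)"
  proof (intro nn_integral_cong)
    fix t assume t: "t \<in> space R"
    have "(\<integral>\<^sup>+x. indicator (UNIV - D \<times> {0<..<T}) (x, t) \<partial>mt t) = (\<integral>\<^sup>+x. 0 \<partial>mt t)"
    proof (rule nn_integral_cong_AE)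
      have "AE x in mt t. x \<in> D" using t by (intro mt_AE_D) simp
      then show "AE x in mt t. indicator (UNIV - D \<times> {0<..<T}) (x, t) = (0 :: ennreal)"
        by eventually_elim (use t in simp)
    qed
    then show "(\<integral>\<^sup>+x. indicator (UNIV - D \<times> {0<..<T}) (x, t) \<partial>mt t) = 0" by simp
  qed
  finally show "emeasure mu (UNIV - D \<times> {0<..<T}) = 0" by simp
  show "emeasure mu K < \<infinity>" for K by (simp add: less_top[symmetric])
  show "sets (mt t) = sets borel" "emeasure (mt t) (UNIV - D) = 0" if "t \<in> {0<..<T}" for t
    using that mt_sets mt_outside by auto
  show "(\<lambda>t. emeasure (mt t) B) \<in> borel_measurable R" if "B \<in> sets borel" for B
    using measurable_compose[OF mt_kernel measurable_emeasure_subprob_algebra[OF that]] .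
  fix u :: "(real^'n) \<times> real \<Rightarrow> real" assume "test_fun (D \<times> {0<..<T}) u"
  then have Cc: "u \<in> Cc (D \<times> {0<..<T})" by (rule test_fun_Cc)
  obtain B where "0 < B" and B: "\<And>p. \<bar>u p\<bar> \<le> B" using Cc_bounded[OF Cc] by blast
  note m = Cc_measurable[OF Cc]
  have sec: "(\<lambda>x. u (x, t)) \<in> borel_measurable borel" for t
    using measurable_compose[OF pair_measurable m] .
  have sets: "{0<..<T} \<inter> space lborel \<in> sets lborel" by simp
  have eq: "indicator {0<..<T} t *\<^sub>R (LINT x:D|mt t. u (x, t)) = indicator {0<..<T} t *\<^sub>R (\<integral>x. u (x, t) \<partial>mt t)" for t
    using set_integral_D[OF _ sec[of t], of t] by (auto simp: indicator_def)
  show "integrable mu u" by (rule integrable_mu[OF m B])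
  show "set_integrable lborel {0<..<T} (\<lambda>t. LINT x:D|mt t. u (x, t))"
    unfolding set_integrable_def eq using integrable_R[OF m B] unfolding integrable_restrict_space[OF sets] .
  show "(LINT p|mu. u p) = (LINT t:{0<..<T}|lborel. LINT x:D|mt t. u (x, t))"
    unfolding set_lebesgue_integral_def[of lborel] eq integral_mu[OF m B] by (rule integral_restrict_space[OF sets])
qed


section \<open>Verification of the Cauchy problem and of the mass inequality\<close>

lemma Lop_D:
  assumes "test_fun D \<phi>"
  shows "(LINT x:D|mt s. Lop a b c \<phi> x s) = (\<integral>x. Lop a b c \<phi> x s \<partial>mt s)"
proof -
  obtain K where K: "compact K" "K \<subseteq> D" "\<And>x. x \<notin> K \<Longrightarrow> \<phi> x = 0"
    using Cc_support[OF test_fun_Cc[OF assms]] by auto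
  have "indicator D x *\<^sub>R Lop a b c \<phi> x s = Lop a b c \<phi> x s" for x
    using Lop_outside[of K \<phi> x a b c s, OF compact_imp_closed[OF K(1)] K(3)] K(2) by (auto simp: indicator_def)
  then show ?thesis by (simp only: set_lebesgue_integral_def)
qed

text \<open>The inner integral is bounded by a constant C on [0, T], so the part of the time
  integral before \<epsilon> is at most \<epsilon> C.\<close>

lemma flow_equation_limit:
  assumes \<phi>: "test_fun D \<phi>" and t: "t \<in> {0<..<T}"
  shows "((\<lambda>\<epsilon>. LINT s:{\<epsilon>..t}|lborel. LINT x:D|mt s. Lop a b c \<phi> x s)
    \<longlongrightarrow> (LINT x:D|mt t. \<phi> x) - (LINT x:D|\<nu>. \<phi> x)) (at_right 0)"
proof -
  define g where "g s = (\<integral>x. Lop a b c \<phi> x s \<partial>mt s)" for s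
  have Cc: "\<phi> \<in> Cc D" by (rule test_fun_Cc[OF \<phi>])
  have admissible: "admissible (Lop a b c \<phi>)" by (rule admissible_Lop[OF \<phi>])
  have t': "t \<in> {0..T}" using t by simp
  have "(LINT x:D|\<nu>. \<phi> x) = integral\<^sup>L \<nu> \<phi>"
    unfolding set_lebesgue_integral_def
    using Cc_outside[OF Cc] by (intro Bochner_Integration.integral_cong) (auto simp: indicator_def)
  then have I: "(LINT x:D|mt t. \<phi> x) - (LINT x:D|\<nu>. \<phi> x) = (LINT s:{0..<t}|lborel. g s)"
    using flow_equation[OF \<phi> t'] set_integral_D[OF t' Cc_measurable[OF Cc]] by (simp add: g_def)
  have "set_integrable lborel {0..<T} g"
    unfolding g_def using T by (intro flow_integrable[OF admissible]) auto
  then have int: "set_integrable lborel S g" if "S \<in> sets borel" "S \<subseteq> {0..<T}" for S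
    by (rule set_integrable_subset) (use that in auto)
  obtain C where C: "0 \<le> C" "\<forall>x. \<forall>s\<in>{0..T}. \<bar>Lop a b c \<phi> x s\<bar> \<le> C" using admissible_bounded[OF admissible] by blast
  have g_le: "\<bar>g s\<bar> \<le> C" if "s \<in> {0..T}" for s
    unfolding g_def using that C(2) by (intro mt_integral_Cc_le admissible_Cc[OF admissible]) auto
  have est: "\<bar>(LINT s:{0..<t}|lborel. g s) - (LINT s:{\<epsilon>..t}|lborel. g s)\<bar> \<le> \<epsilon> * C" if e: "0 < \<epsilon>" "\<epsilon> < t" for \<epsilon>
  proof -
    have un: "{0..<t} = {0..<\<epsilon>} \<union> {\<epsilon>..<t}" "{0..<\<epsilon>} \<inter> {\<epsilon>..<t} = {}" using e by auto
    have i1: "set_integrable lborel {0..<\<epsilon>} g" "set_integrable lborel {\<epsilon>..<t} g" "set_integrable lborel {\<epsilon>..t} g"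
      using e t by (auto intro!: int)
    have "AE x in lborel. x \<noteq> t" by (rule AE_lborel_singleton)
    then have "AE x in lborel. (x \<in> {\<epsilon>..t}) = (x \<in> {\<epsilon>..<t})" by eventually_elim auto
    moreover have "set_borel_measurable lborel {\<epsilon>..<t} g" "set_borel_measurable lborel {\<epsilon>..t} g"
      using i1 by (auto simp: set_integrable_def set_borel_measurable_def)
    ultimately have "(LINT s:{\<epsilon>..<t}|lborel. g s) = (LINT s:{\<epsilon>..t}|lborel. g s)"
      by (intro set_integral_cong_set)
    moreover have "(LINT s:{0..<t}|lborel. g s) = (LINT s:{0..<\<epsilon>}|lborel. g s) + (LINT s:{\<epsilon>..<t}|lborel. g s)"
      unfolding un(1) by (rule set_integral_Un[OF un(2) i1(1,2)])
    moreover have "\<bar>LINT s:{0..<0 + \<epsilon>}|lborel. g s\<bar> \<le> \<epsilon> * C"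
      using i1(1) e t by (intro set_lebesgue_integral_abs_le g_le) auto
    ultimately show ?thesis by simp
  qed
  have "((\<lambda>\<epsilon>. (LINT s:{0..<t}|lborel. g s) - (LINT s:{\<epsilon>..t}|lborel. g s)) \<longlongrightarrow> 0) (at_right 0)"
  proof (rule Lim_null_comparison)
    have "\<forall>\<^sub>F \<epsilon> in at_right 0. 0 < \<epsilon> \<and> \<epsilon> < t"
      using t eventually_at_right_real[of 0 t] by simp
    then show "\<forall>\<^sub>F \<epsilon> in at_right 0. norm ((LINT s:{0..<t}|lborel. g s) - (LINT s:{\<epsilon>..t}|lborel. g s)) \<le> \<epsilon> * C"
      by eventually_elim (simp add: est)
    have "((\<lambda>\<epsilon>. \<epsilon> * C) \<longlongrightarrow> 0 * C) (at_right 0)" by (intro tendsto_intros)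
    then show "((\<lambda>\<epsilon>. \<epsilon> * C) \<longlongrightarrow> 0) (at_right 0)" by simp
  qed
  then have "((\<lambda>\<epsilon>. (LINT s:{0..<t}|lborel. g s) - ((LINT s:{0..<t}|lborel. g s) - (LINT s:{\<epsilon>..t}|lborel. g s)))
      \<longlongrightarrow> (LINT s:{0..<t}|lborel. g s) - 0) (at_right 0)"
    by (intro tendsto_intros)
  then show ?thesis unfolding I Lop_D[OF \<phi>] g_def[symmetric] by simp
qed

text \<open>A cutoff equal to 1 on \<open>C\<close> turns g into a bounded Caratheodory function,
  jointly measurable and hence integrable against the finite measure \<open>mu\<close>; on
  \<open>C \<times> S\<close> it agrees with g.\<close>

lemma coefficient_integrable_mu:
  assumes S: "S \<in> sets borel" "S \<subseteq> {0..T}" and C: "compact C" "C \<subseteq> D"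
    and g: "\<And>f. f \<in> Cc D \<Longrightarrow> admissible (\<lambda>x s. g x s * f x)"
  shows "set_integrable mu (C \<times> S) (\<lambda>p. g (fst p) (snd p))"
proof -
  obtain \<psi> where \<psi>: "\<psi> \<in> Cc D" "\<And>x. x \<in> C \<Longrightarrow> \<psi> x = 1"
    using Cc_cutoff[OF C(1) D_open C(2)] by metis
  define F where "F p = indicator {0..T} (snd p) * (g (fst p) (snd p) * \<psi> (fst p))" for p
  have admissible: "admissible (\<lambda>x s. g x s * \<psi> x)" by (rule g[OF \<psi>(1)])
  obtain B where B: "0 \<le> B" "\<forall>x. \<forall>s\<in>{0..T}. \<bar>g x s * \<psi> x\<bar> \<le> B" using admissible_bounded[OF admissible] by blast
  have "F \<in> borel_measurable borel"
    using admissible_measurable[OF admissible] unfolding F_def[abs_def] borel_prod .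
  then have "integrable mu F"
    by (rule integrable_mu[of F B]) (use B in \<open>auto simp: F_def indicator_def\<close>)
  moreover have "C \<times> S \<in> sets mu"
    using S(1) compact_imp_closed[OF C(1)] unfolding sets_mu by (intro borel_Times) auto
  ultimately have "integrable mu (\<lambda>p. indicator (C \<times> S) p *\<^sub>R F p)"
    by (intro integrable_mult_indicator)
  moreover have "(\<lambda>p. indicator (C \<times> S) p *\<^sub>R F p) = (\<lambda>p. indicator (C \<times> S) p *\<^sub>R g (fst p) (snd p))"
    using S(2) \<psi>(2) by (auto simp: F_def fun_eq_iff indicator_def)
  ultimately show ?thesis by (simp add: set_integrable_def)
qed

text \<open>Rate of mass loss as an extended nonnegative integral: integrability of c against
  \<open>mt s\<close> is not known in advance and is obtained only for almost every s.\<close>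

definition killed :: "real \<Rightarrow> ennreal" where
  "killed s = (\<integral>\<^sup>+x. ennreal (- (indicator D x * c x s)) \<partial>mt s)"

lemma c_D_measurable: "s \<in> {0..T} \<Longrightarrow> (\<lambda>x. indicator D x * c x s) \<in> borel_measurable borel"
  using borel_measurable_continuous_on_indicator[OF _ c_cont[of s]] D_open by simp

lemma c_D_nonpos: "s \<in> {0..T} \<Longrightarrow> indicator D x * c x s \<le> 0"
  using c_nonpos[of x s] by (auto simp: indicator_def)

text \<open>This also holds when \<open>killed s\<close> is infinite: the Bochner integral then has
  its default value 0, and so has \<open>enn2real\<close>.\<close>

lemma LINT_c_eq:
  assumes s: "s \<in> {0..T}"
  shows "(LINT x:D|mt s. c x s) = - enn2real (killed s)"
proof -
  have "(\<integral>x. - (indicator D x * c x s) \<partial>mt s) = enn2real (killed s)"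
    unfolding killed_def using c_D_measurable[OF s] c_D_nonpos[OF s]
    by (intro integral_eq_nn_integral mt_borel_measurable[OF s]) auto
  then show ?thesis by (simp add: set_lebesgue_integral_def)
qed

text \<open>\<open>P n s\<close> is the killing rate truncated by the n-th cutoff. It increases to
  \<open>killed s\<close>, and \<open>flow_mass\<close> bounds its time integral by the missing mass
  \<open>1 - measure (mt t) D\<close> uniformly in n. Monotone convergence yields integrability of
  c; dominated convergence, with the limit itself as majorant, yields the inequality.\<close>

lemma mass_inequality:
  shows c_integrable_mu: "set_integrable mu (D \<times> {0<..<T}) (\<lambda>p. \<bar>c (fst p) (snd p)\<bar>)"
    and mass_le: "t \<in> {0<..<T} \<Longrightarrow> measure (mt t) D \<le> 1 + (LINT s:{0<..<t}|lborel. LINT x:D|mt s. c x s)"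
proof -
  obtain \<psi> :: "nat \<Rightarrow> real^'n \<Rightarrow> real" where \<psi>: "\<And>n. \<psi> n \<in> Cc D" "\<And>n x. 0 \<le> \<psi> n x" "\<And>n x. \<psi> n x \<le> 1"
    "\<And>x. incseq (\<lambda>n. \<psi> n x)" "\<And>x. (\<lambda>n. \<psi> n x) \<longlonglongrightarrow> indicator D x"
    using open_exhaustion_Cc[OF D_open] by metis
  define P where "P n s = - (\<integral>x. c x s * \<psi> n x \<partial>mt s)" for n s
  note admissible = admissible_c[OF \<psi>(1)]
  have nonneg: "0 \<le> - (c x s * \<psi> n x)" if "s \<in> {0..T}" for n x s
    using c_nonpos[of x s] \<psi>(2)[of n x] Cc_outside[OF \<psi>(1), of x n] that
    by (cases "x \<in> D") (auto simp: mult_nonpos_nonneg)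
  have m1: "(\<lambda>x. c x s * \<psi> n x) \<in> borel_measurable (mt s)" if "s \<in> {0..T}" for n s
    using that by (intro mt_borel_measurable Cc_measurable[OF admissible_Cc[OF admissible]])
  have i1: "integrable (mt s) (\<lambda>x. c x s * \<psi> n x)" if s: "s \<in> {0..T}" for n s
  proof -
    obtain B where "\<forall>x. \<forall>s\<in>{0..T}. \<bar>c x s * \<psi> n x\<bar> \<le> B" using admissible_bounded[OF admissible] by blast
    then show ?thesis using s by (intro mt_integrable[where B=B] Cc_measurable[OF admissible_Cc[OF admissible]]) auto
  qed
  have P_nonneg: "0 \<le> P n s" if "s \<in> {0..T}" for n s
    using integral_nonneg_AE[of "\<lambda>x. - (c x s * \<psi> n x)" "mt s"] nonneg[OF that] by (simp add: P_def)
  have P_nn: "ennreal (P n s) = (\<integral>\<^sup>+x. ennreal (- (c x s * \<psi> n x)) \<partial>mt s)" if "s \<in> {0..T}" for n s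
    using nn_integral_eq_integral[of "mt s" "\<lambda>x. - (c x s * \<psi> n x)"] i1[OF that] nonneg[OF that] by (simp add: P_def)
  have inc: "incseq (\<lambda>n. - (c x s * \<psi> n x))" if "s \<in> {0..T}" for x s
  proof (cases "x \<in> D")
    case True
    then show ?thesis
      using \<psi>(4)[of x] c_nonpos[OF True that] by (auto simp: incseq_def intro: mult_left_mono_neg)
  next
    case False
    then show ?thesis using Cc_outside[OF \<psi>(1) False] by simp
  qed
  have killed_SUP: "killed s = (SUP n. ennreal (P n s))" if s: "s \<in> {0..T}" for s
  proof -
    have "killed s = (\<integral>\<^sup>+x. (SUP n. ennreal (- (c x s * \<psi> n x))) \<partial>mt s)"
      unfolding killed_def
    proof (rule nn_integral_cong)
      fix x
      have "(\<lambda>n. - (c x s * \<psi> n x)) \<longlonglongrightarrow> - (c x s * indicator D x)" by (intro tendsto_intros \<psi>(5))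
      from SUP_ennreal_LIMSEQ[OF inc[OF s] this]
      show "ennreal (- (indicator D x * c x s)) = (SUP n. ennreal (- (c x s * \<psi> n x)))" by (simp add: mult.commute)
    qed
    also have "\<dots> = (SUP n. \<integral>\<^sup>+x. ennreal (- (c x s * \<psi> n x)) \<partial>mt s)"
      using inc[OF s] m1[OF s] by (intro nn_integral_monotone_convergence_SUP)
        (auto simp: incseq_def le_fun_def simp del: ennreal_neg intro!: ennreal_leI)
    finally show ?thesis by (simp add: P_nn[OF s])
  qed
  have P_inc: "incseq (\<lambda>n. ennreal (P n s))" if s: "s \<in> {0..T}" for s
    unfolding P_nn[OF s] using inc[OF s] by (auto simp: incseq_def intro!: nn_integral_mono ennreal_leI)
  have P_int: "set_integrable lborel {0..<t} (P n)" if "t \<in> {0..T}" for n t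
    using flow_integrable[OF admissible that, of n] by (simp add: P_def[abs_def] set_integrable_def)
  have P_LINT: "(LINT s:{0..<t}|lborel. P n s) = - (LINT s:{0..<t}|lborel. \<integral>x. c x s * \<psi> n x \<partial>mt s)" for n t
    by (simp add: P_def set_lebesgue_integral_def)
  \<comment> \<open>The cutoff in the mass is released to \<open>indicator D\<close> while the one
    in the killing stays fixed at n.\<close>
  have P_le: "measure (mt t) D + (LINT s:{0..<t}|lborel. P n s) \<le> 1" if t: "t \<in> {0..T}" for n t
  proof -
    interpret subprob_space "mt t" by (rule mt_subprob[OF t])
    have D: "D \<in> sets (mt t)" using mt_sets[OF t] D_open by simp
    have "(\<lambda>m. integral\<^sup>L (mt t) (\<psi> m)) \<longlonglongrightarrow> (\<integral>x. indicator D x \<partial>mt t)"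
    proof (rule integral_dominated_convergence[where w="\<lambda>x. 1"])
      show "\<psi> m \<in> borel_measurable (mt t)" for m by (intro mt_borel_measurable[OF t] Cc_measurable[OF \<psi>(1)])
      show "AE x in mt t. norm (\<psi> m x) \<le> 1" for m using \<psi>(2,3) by simp
    qed (use D \<psi>(5) in auto)
    then have "(\<lambda>m. integral\<^sup>L (mt t) (\<psi> m)) \<longlonglongrightarrow> measure (mt t) D" using D by simp
    moreover have "integral\<^sup>L (mt t) (\<psi> m) \<le> 1 - (LINT s:{0..<t}|lborel. P n s)" for m
      using flow_mass[OF \<psi>(1,3) \<psi>(1,2,3) t, of m n] unfolding P_LINT by simp
    ultimately have "measure (mt t) D \<le> 1 - (LINT s:{0..<t}|lborel. P n s)"
      by (intro LIMSEQ_le_const2) auto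
    then show ?thesis by simp
  qed
  have P_meas: "(\<lambda>s. indicator {0..<T} s * P n s) \<in> borel_measurable lborel" for n
    using P_int[of T n] T by (auto simp: set_integrable_def dest: borel_measurable_integrable)
  define \<kappa> where "\<kappa> s = indicator {0..<T} s * killed s" for s
  have \<kappa>_SUP: "\<kappa> s = (SUP n. ennreal (indicator {0..<T} s * P n s))" for s
    using killed_SUP[of s] by (auto simp: \<kappa>_def indicator_def)
  have \<kappa>_meas: "\<kappa> \<in> borel_measurable lborel"
    unfolding \<kappa>_SUP[abs_def] using P_meas by measurable
  have \<kappa>_le: "(\<integral>\<^sup>+s. \<kappa> s \<partial>lborel) \<le> 1"
  proof -
    have "(\<integral>\<^sup>+s. \<kappa> s \<partial>lborel) = (SUP n. \<integral>\<^sup>+s. ennreal (indicator {0..<T} s * P n s) \<partial>lborel)"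
      unfolding \<kappa>_SUP using P_inc P_meas
      by (intro nn_integral_monotone_convergence_SUP) (auto simp: incseq_def le_fun_def indicator_def)
    also have "\<dots> \<le> 1"
    proof (rule SUP_least)
      fix n
      have "(\<integral>\<^sup>+s. ennreal (indicator {0..<T} s * P n s) \<partial>lborel) = ennreal (LINT s:{0..<T}|lborel. P n s)"
        using P_int[of T n] P_nonneg[of _ n] T
        unfolding set_lebesgue_integral_def set_integrable_def
        by (subst nn_integral_eq_integral) (auto simp: indicator_def)
      moreover have "(LINT s:{0..<T}|lborel. P n s) \<le> 1"
        using P_le[of T n] T by (intro order_trans[OF _ P_le[of T n]]) simp_all
      ultimately show "(\<integral>\<^sup>+s. ennreal (indicator {0..<T} s * P n s) \<partial>lborel) \<le> 1" by simp
    qed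
    finally show ?thesis .
  qed
  \<comment> \<open>Infinite killing is confined to a null set of times; there
    \<open>enn2real\<close> would return 0 instead of the limit of the truncated rates.\<close>
  have fin: "AE s in lborel. \<kappa> s \<noteq> \<infinity>"
    using \<kappa>_le by (intro nn_integral_PInf_AE \<kappa>_meas) (auto simp: top_unique)

  show "set_integrable mu (D \<times> {0<..<T}) (\<lambda>p. \<bar>c (fst p) (snd p)\<bar>)"
    unfolding set_integrable_def
  proof (rule integrableI_nonneg)
    \<comment> \<open>Set to 0 outside \<open>D\<close> and [0, T], c becomes a pointwise limit of
      the jointly measurable truncations.\<close>
    define q where "q p = indicator {0..T} (snd p) * (c (fst p) (snd p) * indicator D (fst p))" for p
    have q: "q \<in> borel_measurable borel"
    proof (rule borel_measurable_LIMSEQ_real)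
      show "(\<lambda>p. indicator {0..T} (snd p) * (c (fst p) (snd p) * \<psi> n (fst p))) \<in> borel_measurable borel" for n
        using admissible_measurable[OF admissible, of n] unfolding borel_prod .
      show "(\<lambda>n. indicator {0..T} (snd p) * (c (fst p) (snd p) * \<psi> n (fst p))) \<longlonglongrightarrow> q p" for p
        unfolding q_def by (intro tendsto_intros \<psi>(5))
    qed
    have eq: "(\<lambda>p. indicator (D \<times> {0<..<T}) p *\<^sub>R \<bar>c (fst p) (snd p)\<bar>) = (\<lambda>p. indicator (UNIV \<times> {0<..<T}) p * - q p)"
      using c_nonpos by (fastforce simp: q_def indicator_def fun_eq_iff)
    have "UNIV \<times> {0<..<T} \<in> sets (borel :: ((real^'n) \<times> real) measure)"
      by (intro borel_open open_Times) auto
    then have m: "(\<lambda>p. indicator (UNIV \<times> {0<..<T}) p * - q p) \<in> borel_measurable borel" using q by measurable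
    then show "(\<lambda>p. indicator (D \<times> {0<..<T}) p *\<^sub>R \<bar>c (fst p) (snd p)\<bar>) \<in> borel_measurable mu"
      unfolding eq using measurable_cong_sets[OF sets_mu refl] by blast
    have "(\<integral>\<^sup>+p. ennreal (indicator (D \<times> {0<..<T}) p *\<^sub>R \<bar>c (fst p) (snd p)\<bar>) \<partial>mu)
        = (\<integral>\<^sup>+p. ennreal (indicator (UNIV \<times> {0<..<T}) p * - q p) \<partial>mu)" unfolding fun_cong[OF eq] ..
    also have "\<dots> = (\<integral>\<^sup>+s. (\<integral>\<^sup>+x. ennreal (indicator (UNIV \<times> {0<..<T}) (x, s) * - q (x, s)) \<partial>mt s) \<partial>R)"
      by (rule nn_integral_mu[OF measurable_compose[OF m measurable_ennreal]])
    also have "\<dots> = (\<integral>\<^sup>+s. killed s \<partial>R)"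
      unfolding killed_def by (intro nn_integral_cong) (auto simp: q_def indicator_def)
    also have "\<dots> = (\<integral>\<^sup>+s. killed s * indicator {0<..<T} s \<partial>lborel)"
      by (intro nn_integral_restrict_space) simp
    also have "\<dots> \<le> (\<integral>\<^sup>+s. \<kappa> s \<partial>lborel)"
      by (intro nn_integral_mono) (auto simp: \<kappa>_def indicator_def)
    also have "\<dots> < \<infinity>" using \<kappa>_le by (auto simp: top_unique less_top[symmetric])
    finally show "(\<integral>\<^sup>+p. ennreal (indicator (D \<times> {0<..<T}) p *\<^sub>R \<bar>c (fst p) (snd p)\<bar>) \<partial>mu) < \<infinity>" .
  qed auto

  show "measure (mt t) D \<le> 1 + (LINT s:{0<..<t}|lborel. LINT x:D|mt s. c x s)" if t: "t \<in> {0<..<T}" for t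
  proof -
    have t': "t \<in> {0..T}" using t by simp
    have \<kappa>_real: "integrable lborel (\<lambda>s. enn2real (\<kappa> s))"
    proof (rule integrableI_nonneg)
      show "(\<lambda>s. enn2real (\<kappa> s)) \<in> borel_measurable lborel" using \<kappa>_meas by measurable
      have "(\<integral>\<^sup>+s. ennreal (enn2real (\<kappa> s)) \<partial>lborel) \<le> (\<integral>\<^sup>+s. \<kappa> s \<partial>lborel)"
        by (intro nn_integral_mono) (simp add: ennreal_enn2real_if)
      then show "(\<integral>\<^sup>+s. ennreal (enn2real (\<kappa> s)) \<partial>lborel) < \<infinity>"
        using \<kappa>_le by (auto simp: less_top[symmetric] top_unique)
    qed auto
    have "(\<lambda>n. LINT s:{0..<t}|lborel. P n s) \<longlonglongrightarrow> (\<integral>s. indicator {0..<t} s * enn2real (\<kappa> s) \<partial>lborel)"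
      unfolding set_lebesgue_integral_def
    proof (rule integral_dominated_convergence[OF _ _ \<kappa>_real])
      show "(\<lambda>s. indicator {0..<t} s * enn2real (\<kappa> s)) \<in> borel_measurable lborel" using \<kappa>_meas by measurable
      show "(\<lambda>s. indicator {0..<t} s *\<^sub>R P n s) \<in> borel_measurable lborel" for n
        using P_int[OF t', of n] unfolding set_integrable_def by (rule borel_measurable_integrable)
      have conv: "(\<lambda>n. P n s) \<longlonglongrightarrow> enn2real (\<kappa> s) \<and> (\<forall>n. P n s \<le> enn2real (\<kappa> s))"
        if "s \<in> {0..<t}" "\<kappa> s \<noteq> \<infinity>" for s
      proof -
        have s: "s \<in> {0..T}" "s \<in> {0..<T}" using that(1) t by auto
        then have k: "\<kappa> s = (SUP n. ennreal (P n s))" using killed_SUP[of s] by (simp add: \<kappa>_def)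
        have "(\<lambda>n. ennreal (P n s)) \<longlonglongrightarrow> \<kappa> s" unfolding k by (rule LIMSEQ_SUP[OF P_inc[OF s(1)]])
        moreover have "ennreal (enn2real (\<kappa> s)) = \<kappa> s" using that(2) by (simp add: less_top)
        ultimately have "(\<lambda>n. ennreal (P n s)) \<longlonglongrightarrow> ennreal (enn2real (\<kappa> s))" by simp
        from tendsto_enn2real[OF this enn2real_nonneg]
        have "(\<lambda>n. enn2real (ennreal (P n s))) \<longlonglongrightarrow> enn2real (\<kappa> s)" .
        moreover have "P n s \<le> enn2real (\<kappa> s)" for n
        proof -
          have "ennreal (P n s) \<le> \<kappa> s" unfolding k by (rule SUP_upper) simp
          then have "enn2real (ennreal (P n s)) \<le> enn2real (\<kappa> s)" using that(2) by (intro enn2real_mono) (auto simp: less_top)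
          then show ?thesis using P_nonneg[OF s(1)] by simp
        qed
        ultimately show ?thesis using P_nonneg[OF s(1)] by simp
      qed
      show "AE s in lborel. (\<lambda>n. indicator {0..<t} s *\<^sub>R P n s) \<longlonglongrightarrow> indicator {0..<t} s * enn2real (\<kappa> s)"
        using fin by eventually_elim (use conv in \<open>auto simp: indicator_def\<close>)
      show "AE s in lborel. norm (indicator {0..<t} s *\<^sub>R P n s) \<le> enn2real (\<kappa> s)" for n
        using fin
      proof eventually_elim
        fix s assume "\<kappa> s \<noteq> \<infinity>"
        then show "norm (indicator {0..<t} s *\<^sub>R P n s) \<le> enn2real (\<kappa> s)"
          using conv[of s] P_nonneg[of s n] t by (cases "s \<in> {0..<t}") (auto simp: enn2real_nonneg)
      qed
    qed
    then have "(\<lambda>n. measure (mt t) D + (LINT s:{0..<t}|lborel. P n s))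
        \<longlonglongrightarrow> measure (mt t) D + (\<integral>s. indicator {0..<t} s * enn2real (\<kappa> s) \<partial>lborel)"
      by (intro tendsto_intros)
    then have "measure (mt t) D + (\<integral>s. indicator {0..<t} s * enn2real (\<kappa> s) \<partial>lborel) \<le> 1"
      using P_le[OF t'] by (intro LIMSEQ_le_const2) auto
    moreover have "(LINT s:{0<..<t}|lborel. LINT x:D|mt s. c x s) = (\<integral>s. - (indicator {0..<t} s * enn2real (\<kappa> s)) \<partial>lborel)"
    proof -
      have "(LINT s:{0<..<t}|lborel. LINT x:D|mt s. c x s) = (\<integral>s. - (indicator {0<..<t} s * enn2real (\<kappa> s)) \<partial>lborel)"
        unfolding set_lebesgue_integral_def[of lborel] using LINT_c_eq t
        by (intro Bochner_Integration.integral_cong) (auto simp: \<kappa>_def indicator_def)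
      also have "\<dots> = (\<integral>s. - (indicator {0..<t} s * enn2real (\<kappa> s)) \<partial>lborel)"
      proof (rule integral_cong_AE)
        have "AE s in lborel. s \<noteq> (0::real)" by (rule AE_lborel_singleton)
        then show "AE s in lborel. - (indicator {0<..<t} s * enn2real (\<kappa> s)) = - (indicator {0..<t} s * enn2real (\<kappa> s))"
          by eventually_elim (auto simp: indicator_def)
      qed (use \<kappa>_meas in measurable)
      finally show ?thesis .
    qed
    ultimately show ?thesis by simp
  qed
qed

text \<open>Boundedness makes each \<open>closure (Dk k)\<close> compact and \<open>Dk_incr\<close>
  puts it inside \<open>D\<close>, which gives local integrability of the coefficients. The equation
  and the mass bound hold for every t in (0, T), so the almost-everywhere clauses are
  immediate.\<close>

lemma M_class_member:
  assumes Dk_bounded: "\<And>k. bounded (Dk k)"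
  shows "(mu, mt) \<in> M_class D Dk T a b c \<nu>"
proof -
  interpret N: prob_space \<nu> by (rule \<nu>_prob)
  have "measure \<nu> D = 1"
  proof -
    have sp: "space \<nu> = UNIV" using sets_eq_imp_space_eq[OF \<nu>_sets] by simp
    have D: "D \<in> sets \<nu>" using \<nu>_sets D_open by simp
    have "measure \<nu> (UNIV - D) = 0" using \<nu>_on_D by (simp add: measure_def)
    then show ?thesis using N.prob_compl[OF D] unfolding sp by simp
  qed
  moreover have "solves_cauchy D Dk T a b c \<nu> mu mt"
    unfolding solves_cauchy_def
  proof (intro conjI allI impI AE_I2)
    fix k :: nat and \<alpha> \<beta> :: real assume ab: "0 < \<alpha> \<and> \<alpha> \<le> \<beta> \<and> \<beta> < T"
    have C: "compact (closure (Dk k))" "closure (Dk k) \<subseteq> D"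
      using Dk_bounded[of k] Dk_incr[of k] Dk_subset_D[of "Suc k"] by (auto simp: compact_closure)
    have S: "{\<alpha>..\<beta>} \<in> sets borel" "{\<alpha>..\<beta>} \<subseteq> {0..T}" using ab by auto
    show "set_integrable mu (closure (Dk k) \<times> {\<alpha>..\<beta>}) (\<lambda>p. a i j (fst p) (snd p))" for i j
      by (rule coefficient_integrable_mu[OF S C admissible_a])
    show "set_integrable mu (closure (Dk k) \<times> {\<alpha>..\<beta>}) (\<lambda>p. b i (fst p) (snd p))" for i
      by (rule coefficient_integrable_mu[OF S C admissible_b])
    show "set_integrable mu (closure (Dk k) \<times> {\<alpha>..\<beta>}) (\<lambda>p. c (fst p) (snd p))"
      by (rule coefficient_integrable_mu[OF S C admissible_c])
  next
    fix \<phi> t assume "test_fun D \<phi>" "t \<in> {0<..<T}"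
    then show "((\<lambda>\<epsilon>. LINT s:{\<epsilon>..t}|lborel. LINT x:D|mt s. Lop a b c \<phi> x s)
        \<longlongrightarrow> (LINT x:D|mt t. \<phi> x) - (LINT x:D|\<nu>. \<phi> x)) (at_right 0)"
      by (rule flow_equation_limit)
  qed
  moreover have "emeasure (mt t) D < \<infinity>" if "t \<in> {0<..<T}" for t
  proof -
    interpret subprob_space "mt t" using that by (intro mt_subprob) simp
    show ?thesis by (simp add: less_top[symmetric])
  qed
  ultimately show ?thesis
    unfolding M_class_def using given_by_flow_mu c_integrable_mu mass_le by auto
qed

end

theorem theorem3:
  fixes D :: "(real^'n::finite) set" and Dk :: "nat \<Rightarrow> (real^'n) set" and T :: real
    and a :: "'n \<Rightarrow> 'n \<Rightarrow> real^'n \<Rightarrow> real \<Rightarrow> real"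
    and b :: "'n \<Rightarrow> real^'n \<Rightarrow> real \<Rightarrow> real"
    and c :: "real^'n \<Rightarrow> real \<Rightarrow> real"
    and \<nu> :: "(real^'n) measure"
  assumes T: "T > 0"
    and D_open: "open D"
    and Dk_open: "\<And>k. open (Dk k)"
    and Dk_bounded: "\<And>k. bounded (Dk k)"
    and Dk_incr: "\<And>k. closure (Dk k) \<subseteq> Dk (Suc k)"
    and Dk_union: "(\<Union>k. Dk k) = D"
    and c_nonpos: "\<And>x t. x \<in> D \<Longrightarrow> t \<in> {0..T} \<Longrightarrow> c x t \<le> 0"
    and a_cont: "\<And>i j t. t \<in> {0..T} \<Longrightarrow> continuous_on D (\<lambda>x. a i j x t)"
    and b_cont: "\<And>i t. t \<in> {0..T} \<Longrightarrow> continuous_on D (\<lambda>x. b i x t)"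
    and c_cont: "\<And>t. t \<in> {0..T} \<Longrightarrow> continuous_on D (\<lambda>x. c x t)"
    and a_meas: "\<And>i j x. x \<in> D \<Longrightarrow> (\<lambda>t. a i j x t) \<in> borel_measurable (restrict_space lborel {0..T})"
    and b_meas: "\<And>i x. x \<in> D \<Longrightarrow> (\<lambda>t. b i x t) \<in> borel_measurable (restrict_space lborel {0..T})"
    and c_meas: "\<And>x. x \<in> D \<Longrightarrow> (\<lambda>t. c x t) \<in> borel_measurable (restrict_space lborel {0..T})"
    and a_bdd: "\<And>i j k. \<exists>M. \<forall>x\<in>Dk k. \<forall>t\<in>{0..T}. \<bar>a i j x t\<bar> \<le> M"
    and b_bdd: "\<And>i k. \<exists>M. \<forall>x\<in>Dk k. \<forall>t\<in>{0..T}. \<bar>b i x t\<bar> \<le> M"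
    and c_bdd: "\<And>k. \<exists>M. \<forall>x\<in>Dk k. \<forall>t\<in>{0..T}. \<bar>c x t\<bar> \<le> M"
    and a_sym: "\<And>i j x t. x \<in> D \<Longrightarrow> t \<in> {0..T} \<Longrightarrow> a i j x t = a j i x t"
    and a_psd: "\<And>x t y. x \<in> D \<Longrightarrow> t \<in> {0..T} \<Longrightarrow>
                   (\<Sum>i\<in>UNIV. \<Sum>j\<in>UNIV. a i j x t * y $ j * y $ i) \<ge> 0"
    and \<nu>_prob: "prob_space \<nu>"
    and \<nu>_sets: "sets \<nu> = sets borel"
    and \<nu>_on_D: "emeasure \<nu> (UNIV - D) = 0"
  shows "M_class D Dk T a b c \<nu> \<noteq> {}"
proof -
  interpret cauchy_data D Dk T a b c \<nu>
    by (rule cauchy_data.intro) (fact assms)+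
  obtain r mt where rm: "strict_mono (r :: nat \<Rightarrow> nat)"
    "\<forall>t\<in>{0..T}. sets (mt t) = sets borel \<and> emeasure (mt t) (UNIV - D) = 0 \<and>
     emeasure (mt t) UNIV \<le> 1 \<and> (\<forall>f\<in>Cc D. (\<lambda>j. path (r j) t f) \<longlonglongrightarrow> integral\<^sup>L (mt t) f)"
    using limit_flow_exists by blast
  interpret limit_flow D Dk T a b c \<nu> r mt
    by unfold_locales (use rm in auto)
  show ?thesis using M_class_member[OF Dk_bounded] by blast
qed

end
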